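(* Let $N\geq 3$ and let $V:(0,+\infty)\to[0,+\infty)$ and $K:(0,+\infty)\to(0,+\infty)$ be continuous functions such that there exists $C>0$ with $V(r)\leq C/r^2$ for all $r\in(0,1)$. Assume: (i) there exist $R_1>0$, $\beta_0\in[0,1]$, $\alpha_0\in\mathbb{R}$ with $\sup_{r\in(0,R_1)}\frac{K(r)}{r^{\alpha_0}V(r)^{\beta_0}}<+\infty$, and $R_2>0$, $\beta_\infty\in[0,1]$, $\alpha_\infty\in\mathbb{R}$ with $\sup_{r>R_2}\frac{K(r)}{r^{\alpha_\infty}V(r)^{\beta_\infty}}<+\infty$; (ii) $q_1,q_2\in\mathbb{R}$ satisfy $4<q_1<2q_0^*(\alpha_0,\beta_0)$ and $q_2>\max\{4,\,2q_\infty^*(\alpha_\infty,\beta_\infty)\}$, where $q_0^*(\alpha,\beta)=\frac{2\alpha+2N-\beta(N+2)}{N-2}$ and $q_\infty^*(\alpha,\beta)=\frac{2(\alpha+N-2\beta)}{N-2}$. Let $g:\mathbb{R}\to\mathbb{R}$ be continuous, let $G(t)=\int_0^t g(s)\,ds$, and assume: there exists $\theta>2$ with $0\leq 2\theta G(t)\leq g(t)t$ for all $t\in\mathbb{R}$; there exists $t_0>0$ with $G(t_0)>0$; there exists $C>0$ with $|g(t)|\leq C\min\{|t|^{q_1-1},|t|^{q_2-1}\}$ for all $t\in\mathbb{R}$. Define $I:E\to\mathbb{R}$ by $$I(u)=\frac12\int_{\mathbb{R}^N}|\nabla u|^2dx+\frac12\int_{\mathbb{R}^N}V(|x|)f^2(u)\,dx-\int_{\mathbb{R}^N}K(|x|)G(f(u))\,dx.$$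 Then (1) $I$ is well defined and continuous on $E$; (2) $I$ is of class $C^1$ on $E$, and for all $u,h\in E$, $$I'(u)h=\int_{\mathbb{R}^N}\nabla u\cdot\nabla h\,dx+\int_{\mathbb{R}^N}V(|x|)f(u)f'(u)h\,dx-\int_{\mathbb{R}^N}K(|x|)g(f(u))f'(u)h\,dx.$$
   Context: Convention: $V(r)^0=1$ for every $r$, even if $V(r)=0$. Let $f:\mathbb{R}\to\mathbb{R}$ be the unique solution of the Cauchy problem $f'(t)=\frac{1}{\sqrt{1+2f(t)^2}}$, $f(0)=0$ (it is smooth, odd, strictly increasing and bijective). $D_r^{1,2}(\mathbb{R}^N)$ is the closure of the space of radial $C^\infty$ compactly supported functions on $\mathbb{R}^N$ with respect to the norm $\|u\|_{1,2}=(\int_{\mathbb{R}^N}|\nabla u|^2dx)^{1/2}$. $E=\{u\in D_r^{1,2}(\mathbb{R}^N):\int_{\mathbb{R}^N}V(|x|)f^2(u)\,dx<+\infty\}$, normed by $\|u\|=\|u\|_{1,2}+\|u\|_o$, where $\|u\|_o=\inf_{k>0}\frac1k\big[1+\int_{\mathbb{R}^N}V(|x|)f^2(ku)\,dx\big]$; it is a Banach space. *)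

theory Defs
  imports "HOL-Analysis.Analysis"
begin

definition fsol :: "real \<Rightarrow> real" where
  "fsol = (THE f. f 0 = 0 \<and> (\<forall>t. (f has_real_derivative 1 / sqrt (1 + 2 * (f t)\<^sup>2)) (at t)))"

definition fsol' :: "real \<Rightarrow> real" where
  "fsol' t = 1 / sqrt (1 + 2 * (fsol t)\<^sup>2)"

text \<open>Power with the convention v^0 = 1 (even for v = 0).\<close>
definition vpow :: "real \<Rightarrow> real \<Rightarrow> real" where
  "vpow v b = (if b = 0 then 1 else v powr b)"

definition pdiff :: "'n::finite \<Rightarrow> (real^'n \<Rightarrow> real) \<Rightarrow> real^'n \<Rightarrow> real" where
  "pdiff i \<phi> x = frechet_derivative \<phi> (at x) (axis i 1)"

fun pdiffs :: "'n::finite list \<Rightarrow> (real^'n \<Rightarrow> real) \<Rightarrow> real^'n \<Rightarrow> real" where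
  "pdiffs [] \<phi> = \<phi>"
| "pdiffs (i # is) \<phi> = pdiff i (pdiffs is \<phi>)"

definition smooth_fn :: "(real^'n::finite \<Rightarrow> real) \<Rightarrow> bool" where
  "smooth_fn \<phi> \<longleftrightarrow> (\<forall>is x. pdiffs is \<phi> differentiable (at x))"

definition radial_fn :: "(real^'n::finite \<Rightarrow> real) \<Rightarrow> bool" where
  "radial_fn \<phi> \<longleftrightarrow> (\<forall>x y. norm x = norm y \<longrightarrow> \<phi> x = \<phi> y)"

definition radial_test :: "(real^'n::finite \<Rightarrow> real) \<Rightarrow> bool" where
  "radial_test \<phi> \<longleftrightarrow> smooth_fn \<phi> \<and> radial_fn \<phi> \<and> (\<exists>R. \<forall>x. R < norm x \<longrightarrow> \<phi> x = 0)"

definition grad_s :: "(real^'n::finite \<Rightarrow> real) \<Rightarrow> real^'n \<Rightarrow> real^'n" where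
  "grad_s \<phi> x = (\<chi> i. pdiff i \<phi> x)"

text \<open>D_r^{1,2}: u (with gradient w) is the limit of radial test functions phi_k,
  with grad phi_k -> w in L^2 and phi_k -> u in L^{2^*}, 2^* = 2N/(N-2).\<close>
definition D12r_rel :: "(real^'n::finite \<Rightarrow> real) \<Rightarrow> (real^'n \<Rightarrow> real^'n) \<Rightarrow> bool" where
  "D12r_rel u w \<longleftrightarrow> u \<in> borel_measurable lborel \<and> w \<in> borel_measurable lborel \<and>
     (\<exists>\<phi>. (\<forall>k::nat. radial_test (\<phi> k)) \<and>
        ((\<lambda>k. \<integral>\<^sup>+x. ennreal (\<bar>\<phi> k x - u x\<bar> powr (2 * real CARD('n) / (real CARD('n) - 2))) \<partial>lborel)
            \<longlonglongrightarrow> 0) \<and>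
        ((\<lambda>k. \<integral>\<^sup>+x. ennreal ((norm (grad_s (\<phi> k) x - w x))\<^sup>2) \<partial>lborel) \<longlonglongrightarrow> 0))"

definition D12r :: "(real^'n::finite \<Rightarrow> real) set" where
  "D12r = {u. \<exists>w. D12r_rel u w}"

definition dgrad :: "(real^'n::finite \<Rightarrow> real) \<Rightarrow> real^'n \<Rightarrow> real^'n" where
  "dgrad u = (SOME w. D12r_rel u w)"

definition Espace :: "(real \<Rightarrow> real) \<Rightarrow> (real^'n::finite \<Rightarrow> real) set" where
  "Espace V = {u \<in> D12r. (\<integral>\<^sup>+x. ennreal (V (norm x) * (fsol (u x))\<^sup>2) \<partial>lborel) < \<infinity>}"

definition norm12 :: "(real^'n::finite \<Rightarrow> real) \<Rightarrow> real" where
  "norm12 u = sqrt (\<integral>x. (norm (dgrad u x))\<^sup>2 \<partial>lborel)"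

definition normo :: "(real \<Rightarrow> real) \<Rightarrow> (real^'n::finite \<Rightarrow> real) \<Rightarrow> real" where
  "normo V u = Inf {(1 / k) * (1 + (\<integral>x. V (norm x) * (fsol (k * u x))\<^sup>2 \<partial>lborel)) | k. k > 0}"

definition Enorm :: "(real \<Rightarrow> real) \<Rightarrow> (real^'n::finite \<Rightarrow> real) \<Rightarrow> real" where
  "Enorm V u = norm12 u + normo V u"

definition Gprim :: "(real \<Rightarrow> real) \<Rightarrow> real \<Rightarrow> real" where
  "Gprim g t = (LBINT s=0..t. g s)"

definition Ifun :: "(real \<Rightarrow> real) \<Rightarrow> (real \<Rightarrow> real) \<Rightarrow> (real \<Rightarrow> real) \<Rightarrow> (real^'n::finite \<Rightarrow> real) \<Rightarrow> real" where
  "Ifun V K g u = 1/2 * (\<integral>x. (norm (dgrad u x))\<^sup>2 \<partial>lborel)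
      + 1/2 * (\<integral>x. V (norm x) * (fsol (u x))\<^sup>2 \<partial>lborel)
      - (\<integral>x. K (norm x) * Gprim g (fsol (u x)) \<partial>lborel)"

definition Ider :: "(real \<Rightarrow> real) \<Rightarrow> (real \<Rightarrow> real) \<Rightarrow> (real \<Rightarrow> real) \<Rightarrow> (real^'n::finite \<Rightarrow> real) \<Rightarrow> (real^'n \<Rightarrow> real) \<Rightarrow> real" where
  "Ider V K g u h = (\<integral>x. dgrad u x \<bullet> dgrad h x \<partial>lborel)
      + (\<integral>x. V (norm x) * fsol (u x) * fsol' (u x) * h x \<partial>lborel)
      - (\<integral>x. K (norm x) * g (fsol (u x)) * fsol' (u x) * h x \<partial>lborel)"

end

theory Submission
  imports Defs
begin

text \<open>
For a radial test function, the fundamental theorem of calculus applied to $r^{N-2}\varphi(r)^2$ gives both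
the decay estimate $|u(x)| \le C \|\nabla u\|_2 |x|^{-(N-2)/2}$ and Hardy's inequality, and both pass to the limit
in $D_r^{1,2}$. Since $V \le C/r^2$ near the origin and $u$ is bounded away from it, where $f^2(t)$ is comparable
to $t^2$, the norm of $E$ controls $\int V u^2$ as well. Hence $u \mapsto \int V f^2(u)$ is a $C^1$ functional on
$E$ because $f f'$ is Lipschitz. For the last term, on a ball the exponent $q_1$ and the decay estimate give an
integrable majorant, so dominated convergence applies; outside a large ball, weighted AM-GM and the exponent
$q_2$ make the contribution uniformly small on bounded sets. Tonelli's theorem along the segment from $u$ to $u+h$
turns continuity of the derivative into Frechet differentiability.
\<close>

section \<open>The solution of the Cauchy problem\<close>

text \<open>Three obstacles shape the argument. The norm of E contains an infimum and its modular is
  not homogeneous, so E is never treated as a normed type: estimates go through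
  \<open>wbound\<close>, a decay bound together with a weighted L2 bound, which scales and adds
  almost like a norm; a strict inequality \<open>Enorm V u < l\<close> supplies it with a multiple
  of l, and l is then let down to the norm. Second, \<open>dgrad\<close> is an arbitrary choice
  among gradients, so its linearity holds only almost everywhere and rests on uniqueness: if test
  functions tend to 0 in L^p, p = 2N/(N-2), and their gradients converge in L2, then the gradients
  tend to 0. Third, the exponents: |f f'| <= 1 and f^2(t) <= 2|t| turn the power q1 of f(u) into the
  power q1/2 of u, which is why the bound on q1 carries a factor 2. Near the origin V <= C/r^2
  bounds K by a multiple of r^(\<alpha>0 - 2 \<beta>0); at infinity the surplus exponent is split in
  halves, one for integrability and one for smallness.\<close>

lemma sqrt_1_2sq_pos: "0 < 1 + 2 * (y::real)\<^sup>2"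
  by (intro add_pos_nonneg) auto

text \<open>Separating variables in f' sqrt(1 + 2 f^2) = 1 leads to the integral of sqrt(1 + 2 y^2)
  from 0; this is its closed form.\<close>

definition fsol_inv :: "real \<Rightarrow> real" where
  "fsol_inv y = y * sqrt (1 + 2 * y\<^sup>2) / 2 + arsinh (sqrt 2 * y) / (2 * sqrt 2)"

lemma DERIV_fsol_inv: "(fsol_inv has_real_derivative sqrt (1 + 2 * y\<^sup>2)) (at y)"
proof -
  let ?s = "sqrt (1 + 2 * y\<^sup>2)"
  have s: "?s > 0" "?s * ?s = 1 + 2 * y\<^sup>2" using sqrt_1_2sq_pos[of y] by auto
  have "(fsol_inv has_real_derivative
     ((y * (inverse ?s / 2 * (2 * (2 * y))) + ?s) / 2 + (sqrt 2 * (1 / sqrt ((sqrt 2 * y)\<^sup>2 + 1))) / (2 * sqrt 2))) (at y)"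
  proof -
    have "((\<lambda>y::real. sqrt (1 + 2 * y\<^sup>2)) has_real_derivative inverse ?s / 2 * (2 * (2 * y))) (at y)"
      using sqrt_1_2sq_pos[of y] by (auto intro!: derivative_eq_intros)
    moreover have "((\<lambda>y::real. arsinh (sqrt 2 * y)) has_real_derivative (1 / sqrt ((sqrt 2 * y)\<^sup>2 + 1)) * sqrt 2) (at y)"
      by (intro DERIV_chain2[OF arsinh_real_has_field_derivative]) (auto intro!: derivative_eq_intros)
    ultimately have "((\<lambda>y. y * sqrt (1 + 2 * y\<^sup>2) / 2 + arsinh (sqrt 2 * y) / (2 * sqrt 2)) has_real_derivative
      (1 * ?s + inverse ?s / 2 * (2 * (2 * y)) * y) / 2 + (1 / sqrt ((sqrt 2 * y)\<^sup>2 + 1)) * sqrt 2 / (2 * sqrt 2)) (at y)"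
      by (intro DERIV_add DERIV_cdivide DERIV_mult DERIV_ident) auto
    then show ?thesis unfolding fsol_inv_def[abs_def] by (simp add: mult.commute add.commute)
  qed
  moreover have "(sqrt 2 * y)\<^sup>2 + 1 = 1 + 2 * y\<^sup>2" by (simp add: power_mult_distrib)
  moreover have "(y * (inverse ?s / 2 * (2 * (2 * y))) + ?s) / 2 + (sqrt 2 * (1 / ?s)) / (2 * sqrt 2) = ?s"
  proof -
    have "\<And>s::real. s > 0 \<Longrightarrow> (2 * (s * s)) / (2 * s) = s" by simp
    have "(y * (inverse ?s / 2 * (2 * (2 * y))) + ?s) / 2 + (sqrt 2 * (1 / ?s)) / (2 * sqrt 2)
       = (2 * y\<^sup>2 + ?s * ?s + 1) / (2 * ?s)"
      using s(1) by (simp add: field_simps power2_eq_square)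
    also have "\<dots> = (2 * (?s * ?s)) / (2 * ?s)" unfolding s(2) by simp
    also have "\<dots> = ?s" using s(1) \<open>\<And>s::real. s > 0 \<Longrightarrow> (2 * (s * s)) / (2 * s) = s\<close> by blast
    finally show ?thesis .
  qed
  ultimately show ?thesis by metis
qed

lemma fsol_inv_0: "fsol_inv 0 = 0"
  by (simp add: fsol_inv_def)

lemma fsol_inv_minus: "fsol_inv (- y) = - fsol_inv y"
  by (simp add: fsol_inv_def)

lemma fsol_inv_strict_mono: "strict_mono fsol_inv"
proof (rule strict_monoI)
  fix x y :: real assume "x < y"
  then show "fsol_inv x < fsol_inv y"
    by (rule DERIV_pos_imp_increasing) (use DERIV_fsol_inv sqrt_1_2sq_pos real_sqrt_gt_zero in blast)
qed

text \<open>The derivative is at least 1. This coercivity yields surjectivity by the intermediate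
  value theorem.\<close>

lemma fsol_inv_ge: assumes "0 \<le> y" shows "y \<le> fsol_inv y"
proof -
  have "fsol_inv 0 - 0 \<le> fsol_inv y - y"
  proof (rule DERIV_nonneg_imp_nondecreasing[OF assms])
    fix x :: real
    have "((\<lambda>x. fsol_inv x - x) has_real_derivative sqrt (1 + 2 * x\<^sup>2) - 1) (at x)"
      by (intro derivative_intros DERIV_fsol_inv)
    moreover have "sqrt (1 + 2 * x\<^sup>2) \<ge> 1" by simp
    ultimately show "\<exists>z. ((\<lambda>x. fsol_inv x - x) has_real_derivative z) (at x) \<and> 0 \<le> z" by force
  qed
  then show ?thesis by (simp add: fsol_inv_0)
qed

lemma fsol_inv_isCont: "isCont fsol_inv x"
  using DERIV_fsol_inv DERIV_isCont by blast

lemma fsol_inv_surj: "\<exists>y. fsol_inv y = t"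
proof -
  have pos: "\<exists>y. fsol_inv y = t" if "0 \<le> t" for t
    using IVT[of fsol_inv 0 t t] fsol_inv_ge[OF that] fsol_inv_isCont that fsol_inv_0 by auto
  show ?thesis
    using pos[of t] pos[of "- t"] fsol_inv_minus by (cases "0 \<le> t") (auto, metis add.inverse_inverse)
qed

text \<open>By the chain rule \<open>fsol_inv (f t) - t\<close> has derivative 0, and it vanishes at
  t = 0. Uniqueness in the Cauchy problem thereby becomes injectivity of
  \<open>fsol_inv\<close>.\<close>

lemma ode_solution_eq_inverse:
  assumes f0: "f 0 = 0" and f: "\<And>t. (f has_real_derivative 1 / sqrt (1 + 2 * (f t)\<^sup>2)) (at t)"
  shows "fsol_inv (f t) = t"
proof -
  have D: "((\<lambda>t. fsol_inv (f t) - t) has_real_derivative 0) (at t)" for t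
  proof -
    have "((\<lambda>t. fsol_inv (f t) - t) has_real_derivative
        sqrt (1 + 2 * (f t)\<^sup>2) * (1 / sqrt (1 + 2 * (f t)\<^sup>2)) - 1) (at t)"
      by (intro derivative_intros DERIV_chain2[OF DERIV_fsol_inv f])
    moreover have "sqrt (1 + 2 * (f t)\<^sup>2) \<noteq> 0" by (smt (verit) real_sqrt_gt_zero sqrt_1_2sq_pos)
    ultimately show ?thesis by simp
  qed
  have "fsol_inv (f t) - t = fsol_inv (f 0) - 0"
    using D by (rule DERIV_isconst_all[rule_format])
  then show ?thesis by (simp add: f0 fsol_inv_0)
qed

definition fsol_model :: "real \<Rightarrow> real" where "fsol_model = inv fsol_inv"

lemma fsol_inv_model: "fsol_inv (fsol_model t) = t"
  unfolding fsol_model_def by (rule surj_f_inv_f) (metis fsol_inv_surj surjI)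

lemma fsol_model_inv: "fsol_model (fsol_inv t) = t"
  unfolding fsol_model_def using fsol_inv_strict_mono by (simp add: strict_mono_imp_inj_on)

lemma DERIV_fsol_model: "(fsol_model has_real_derivative 1 / sqrt (1 + 2 * (fsol_model t)\<^sup>2)) (at t)"
proof -
  have "isCont fsol_model (fsol_inv (fsol_model t))"
    by (rule isCont_inverse_function[of 1]) (auto simp: fsol_model_inv fsol_inv_isCont)
  then have c: "isCont fsol_model t" by (simp add: fsol_inv_model)
  have "(fsol_model has_real_derivative inverse (sqrt (1 + 2 * (fsol_model t)\<^sup>2))) (at t)"
    by (rule DERIV_inverse_function[where f = fsol_inv and a = "t - 1" and b = "t + 1"])
       (use sqrt_1_2sq_pos[of "fsol_model t"] c in \<open>auto simp: fsol_inv_model DERIV_fsol_inv\<close>)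
  then show ?thesis by (simp add: inverse_eq_divide)
qed

text \<open>Existence and uniqueness together discharge the definite description in
  \<open>fsol\<close>; from here on the function is handled through its derivative, oddness and
  monotonicity.\<close>

lemma fsol_eq_model: "fsol = fsol_model"
  unfolding fsol_def
proof (rule the_equality)
  show "fsol_model 0 = 0 \<and> (\<forall>t. (fsol_model has_real_derivative 1 / sqrt (1 + 2 * (fsol_model t)\<^sup>2)) (at t))"
    using DERIV_fsol_model fsol_model_inv[of 0] by (simp add: fsol_inv_0)
next
  fix f :: "real \<Rightarrow> real"
  assume f: "f 0 = 0 \<and> (\<forall>t. (f has_real_derivative 1 / sqrt (1 + 2 * (f t)\<^sup>2)) (at t))"
  show "f = fsol_model"
  proof
    fix t
    have "fsol_inv (f t) = t" using f by (intro ode_solution_eq_inverse) auto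
    then show "f t = fsol_model t" by (metis fsol_model_inv)
  qed
qed

lemma fsol_0 [simp]: "fsol 0 = 0"
  using fsol_model_inv[of 0] by (simp add: fsol_eq_model fsol_inv_0)

lemma DERIV_fsol: "(fsol has_real_derivative fsol' t) (at t)"
  using DERIV_fsol_model by (simp add: fsol'_def fsol_eq_model)

lemma fsol_minus [simp]: "fsol (- t) = - fsol t"
  by (metis fsol_eq_model fsol_inv_minus fsol_inv_model fsol_model_inv)

lemma fsol'_pos: "fsol' t > 0"
  using sqrt_1_2sq_pos by (simp add: fsol'_def)

lemma fsol'_le_1: "fsol' t \<le> 1"
  using sqrt_1_2sq_pos[of "fsol t"] by (simp add: fsol'_def divide_le_eq)

lemma fsol_strict_mono: "s < t \<Longrightarrow> fsol s < fsol t"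
  by (rule DERIV_pos_imp_increasing) (use DERIV_fsol fsol'_pos in blast)+

lemma fsol_mono: "s \<le> t \<Longrightarrow> fsol s \<le> fsol t"
  using fsol_strict_mono[of s t] by (cases "s = t") auto

lemma fsol_nonneg: "0 \<le> t \<Longrightarrow> 0 \<le> fsol t"
  using fsol_mono[of 0 t] by simp

lemma fsol_abs: "fsol \<bar>t\<bar> = \<bar>fsol t\<bar>"
  using fsol_nonneg[of t] fsol_nonneg[of "- t"] by (auto simp: abs_if)

lemma fsol_sq_abs: "(fsol \<bar>t\<bar>)\<^sup>2 = (fsol t)\<^sup>2"
  by (simp add: fsol_abs)

lemma continuous_on_fsol [continuous_intros]: "continuous_on S h \<Longrightarrow> continuous_on S (\<lambda>x. fsol (h x))"
  using DERIV_fsol DERIV_isCont continuous_at_imp_continuous_on continuous_on_compose2[of UNIV fsol S h]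
  by (metis subset_UNIV)

lemma continuous_on_fsol' [continuous_intros]: "continuous_on S h \<Longrightarrow> continuous_on S (\<lambda>x. fsol' (h x))"
proof -
  assume "continuous_on S h"
  moreover have "sqrt (1 + 2 * (fsol (h x))\<^sup>2) \<noteq> 0" for x
    by (smt (verit) real_sqrt_gt_zero sqrt_1_2sq_pos)
  ultimately show ?thesis unfolding fsol'_def by (intro continuous_intros) auto
qed

section \<open>Concavity of \<open>fsol\<close>, convexity of its square, and growth bounds\<close>

lemma fsol'_antimono: assumes "0 \<le> s" "s \<le> t" shows "fsol' t \<le> fsol' s"
proof -
  have "(fsol s)\<^sup>2 \<le> (fsol t)\<^sup>2" using assms fsol_mono fsol_nonneg by (intro power_mono) auto
  then show ?thesis using sqrt_1_2sq_pos[of "fsol s"] unfolding fsol'_def by (intro divide_left_mono) auto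
qed

text \<open>\<open>fsol'\<close> decreases on the nonnegative half-line, so c f(x) - f(c x) has
  derivative c (f'(x) - f'(c x)) >= 0 and vanishes at 0.\<close>

lemma fsol_scale_le: assumes "1 \<le> c" "0 \<le> t" shows "fsol (c * t) \<le> c * fsol t"
proof -
  have "c * fsol 0 - fsol (c * 0) \<le> c * fsol t - fsol (c * t)"
  proof (rule DERIV_nonneg_imp_nondecreasing[OF assms(2)])
    fix x :: real assume x: "0 \<le> x"
    have "((\<lambda>x. c * fsol x - fsol (c * x)) has_real_derivative c * fsol' x - fsol' (c * x) * c) (at x)"
      by (auto intro!: derivative_eq_intros DERIV_fsol DERIV_chain2[OF DERIV_fsol])
    moreover have "fsol' (c * x) \<le> fsol' x" using x assms by (intro fsol'_antimono) (auto simp: mult_le_cancel_right1)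
    then have "0 \<le> c * fsol' x - fsol' (c * x) * c" using assms by (simp add: mult.commute mult_left_mono)
    ultimately show "\<exists>y. ((\<lambda>x. c * fsol x - fsol (c * x)) has_real_derivative y) (at x) \<and> 0 \<le> y" by blast
  qed
  then show ?thesis by simp
qed

text \<open>A doubling condition for f^2: the modular is finite on all multiples of a function as
  soon as it is finite on the function itself.\<close>

lemma fsol_mult_bound: "(fsol (c * t))\<^sup>2 \<le> (max 1 \<bar>c\<bar>)\<^sup>2 * (fsol t)\<^sup>2"
proof -
  have "fsol \<bar>c * t\<bar> \<le> fsol (max 1 \<bar>c\<bar> * \<bar>t\<bar>)"
    by (intro fsol_mono) (auto simp: abs_mult intro: mult_right_mono)
  also have "\<dots> \<le> max 1 \<bar>c\<bar> * fsol \<bar>t\<bar>" by (intro fsol_scale_le) auto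
  finally have "(fsol \<bar>c * t\<bar>)\<^sup>2 \<le> (max 1 \<bar>c\<bar> * fsol \<bar>t\<bar>)\<^sup>2" by (intro power_mono fsol_nonneg) auto
  then show ?thesis by (simp only: fsol_sq_abs power_mult_distrib)
qed

lemma fsol_sq_mono: "\<bar>s\<bar> \<le> \<bar>t\<bar> \<Longrightarrow> (fsol s)\<^sup>2 \<le> (fsol t)\<^sup>2"
  using power_mono[OF fsol_mono fsol_nonneg, of "\<bar>s\<bar>" "\<bar>t\<bar>" 2] by (simp add: fsol_sq_abs)

lemma fsol_sq_add: "(fsol (s + t))\<^sup>2 \<le> 4 * ((fsol s)\<^sup>2 + (fsol t)\<^sup>2)"
proof -
  define m where "m = max \<bar>s\<bar> \<bar>t\<bar>"
  have "(fsol (s + t))\<^sup>2 \<le> (fsol (2 * m))\<^sup>2" by (intro fsol_sq_mono) (auto simp: m_def)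
  also have "\<dots> \<le> 4 * (fsol m)\<^sup>2" using fsol_mult_bound[of 2 m] by simp
  also have "(fsol m)\<^sup>2 \<le> (fsol s)\<^sup>2 + (fsol t)\<^sup>2" by (auto simp: m_def max_def fsol_sq_abs)
  finally show ?thesis by simp
qed

text \<open>Half the derivative of f^2; it plays for the V-term the role that g(f) f' plays for the
  K-term.\<close>

definition fsol_prod :: "real \<Rightarrow> real" where "fsol_prod t = fsol t * fsol' t"

lemma DERIV_half_fsol_sq: "((\<lambda>t. (fsol t)\<^sup>2 / 2) has_real_derivative fsol_prod t) (at t)"
  unfolding fsol_prod_def by (rule derivative_eq_intros DERIV_fsol refl | simp)+

text \<open>\<open>fsol_prod\<close> is this quotient composed with \<open>fsol\<close>. The
  derivative lies in (0, 1], which gives both the Lipschitz bound and the monotonicity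
  below.\<close>

lemma DERIV_div_sqrt: "((\<lambda>y::real. y / sqrt (1 + 2 * y\<^sup>2)) has_real_derivative 1 / (sqrt (1 + 2 * y\<^sup>2))^3) (at y)"
proof -
  let ?s = "sqrt (1 + 2 * y\<^sup>2)"
  have s: "?s > 0" "?s\<^sup>2 = 1 + 2 * y\<^sup>2" using sqrt_1_2sq_pos[of y] by auto
  have "((\<lambda>y::real. y / sqrt (1 + 2 * y\<^sup>2)) has_real_derivative
     (1 * ?s - y * (inverse ?s / 2 * (2 * (2 * y)))) / (?s * ?s)) (at y)"
    using s by (auto intro!: derivative_eq_intros sqrt_1_2sq_pos)
  also have "(1 * ?s - y * (inverse ?s / 2 * (2 * (2 * y)))) / (?s * ?s) = (?s\<^sup>2 - 2 * y\<^sup>2) / ?s^3"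
    using s(1) by (simp add: field_simps power2_eq_square power3_eq_cube)
  also have "\<dots> = 1 / ?s^3" using s(2) by simp
  finally show ?thesis .
qed

lemma fsol_prod_lipschitz: "\<bar>fsol_prod s - fsol_prod t\<bar> \<le> \<bar>s - t\<bar>"
proof -
  have D: "(fsol_prod has_real_derivative 1 / (sqrt (1 + 2 * (fsol t)\<^sup>2))^3 * fsol' t) (at t)" for t
    using DERIV_chain2[OF DERIV_div_sqrt DERIV_fsol, of t]
    by (simp add: fsol_prod_def[abs_def] fsol'_def)
  have b: "\<bar>1 / (sqrt (1 + 2 * (fsol t)\<^sup>2))^3 * fsol' t\<bar> \<le> 1" for t
  proof -
    have "1 \<le> (sqrt (1 + 2 * (fsol t)\<^sup>2))^3" by simp
    then have "1 / (sqrt (1 + 2 * (fsol t)\<^sup>2))^3 \<le> 1" by (subst divide_le_eq_1_pos) linarith+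
    then have "1 / (sqrt (1 + 2 * (fsol t)\<^sup>2))^3 * fsol' t \<le> 1"
      using fsol'_le_1[of t] fsol'_pos[of t] by (intro mult_le_one) auto
    then show ?thesis using fsol'_pos[of t] by simp
  qed
  show ?thesis
    using field_differentiable_bound[OF convex_UNIV, where f = fsol_prod and B = 1 and x = s and y = t] D b by force
qed

lemma abs_fsol_prod_le: "\<bar>fsol_prod t\<bar> \<le> \<bar>t\<bar>"
  using fsol_prod_lipschitz[of t 0] by (simp add: fsol_prod_def)

lemma fsol_prod_mono: assumes "s \<le> t" shows "fsol_prod s \<le> fsol_prod t"
proof -
  have "(\<lambda>y::real. y / sqrt (1 + 2 * y\<^sup>2)) (fsol s) \<le> (\<lambda>y::real. y / sqrt (1 + 2 * y\<^sup>2)) (fsol t)"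
  proof (rule DERIV_nonneg_imp_nondecreasing[OF fsol_mono[OF assms]])
    fix y :: real
    show "\<exists>z. ((\<lambda>y::real. y / sqrt (1 + 2 * y\<^sup>2)) has_real_derivative z) (at y) \<and> 0 \<le> z"
      using DERIV_div_sqrt[of y] sqrt_1_2sq_pos[of y] by (intro exI conjI) auto
  qed
  then show ?thesis by (simp add: fsol_prod_def fsol'_def)
qed

text \<open>f^2 is convex and vanishes at 0, since half its derivative, \<open>fsol_prod\<close>,
  increases. Opposite in direction to the doubling bound, this is what allows the infimum norm to be
  compared with the modular.\<close>

lemma fsol_sq_superlinear: assumes "1 \<le> k" shows "k * (fsol t)\<^sup>2 \<le> (fsol (k * t))\<^sup>2"
proof -
  have "(fsol (k * 0))\<^sup>2 / 2 - k * ((fsol 0)\<^sup>2 / 2) \<le> (fsol (k * \<bar>t\<bar>))\<^sup>2 / 2 - k * ((fsol \<bar>t\<bar>)\<^sup>2 / 2)"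
  proof (rule DERIV_nonneg_imp_nondecreasing[where f = "\<lambda>x. (fsol (k * x))\<^sup>2 / 2 - k * ((fsol x)\<^sup>2 / 2)"])
    fix x :: real assume x: "0 \<le> x"
    have "((\<lambda>x. (fsol (k * x))\<^sup>2 / 2 - k * ((fsol x)\<^sup>2 / 2)) has_real_derivative
       fsol_prod (k * x) * k - k * fsol_prod x) (at x)"
      by (intro DERIV_diff DERIV_cmult DERIV_chain2[OF DERIV_half_fsol_sq] DERIV_half_fsol_sq)
         (auto intro!: derivative_eq_intros)
    moreover have "fsol_prod x \<le> fsol_prod (k * x)" using x assms by (intro fsol_prod_mono) (auto simp: mult_le_cancel_right1)
    then have "0 \<le> fsol_prod (k * x) * k - k * fsol_prod x" using assms by (simp add: mult.commute mult_left_mono)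
    ultimately show "\<exists>y. ((\<lambda>x. (fsol (k * x))\<^sup>2 / 2 - k * ((fsol x)\<^sup>2 / 2)) has_real_derivative y) (at x) \<and> 0 \<le> y" by blast
  qed auto
  moreover have "(fsol (k * \<bar>t\<bar>))\<^sup>2 = (fsol (k * t))\<^sup>2"
    using fsol_sq_abs[of "k * t"] assms by (simp add: abs_mult)
  ultimately show ?thesis using fsol_sq_abs[of t] by simp
qed

lemma abs_fsol_le: "\<bar>fsol t\<bar> \<le> \<bar>t\<bar>"
  using field_differentiable_bound[of UNIV fsol fsol' 1 t 0] DERIV_fsol fsol'_le_1 fsol'_pos
  by (simp add: less_imp_le)

text \<open>Concavity gives |t| f'(t) <= f(|t|). Squaring, with f'^2 = 1/(1 + 2 f^2) and |f(t)| <=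
  |t|, produces a converse to f^2 <= t^2 that is effective where t stays bounded.\<close>

lemma sq_le_fsol_sq: "t\<^sup>2 \<le> (1 + 2 * t\<^sup>2) * (fsol t)\<^sup>2"
proof -
  have "\<bar>t\<bar> * fsol' t \<le> fsol \<bar>t\<bar>"
  proof -
    have "fsol 0 - 0 * fsol' t \<le> fsol \<bar>t\<bar> - \<bar>t\<bar> * fsol' t"
    proof (rule DERIV_nonneg_imp_nondecreasing[where f = "\<lambda>x. fsol x - x * fsol' t"])
      fix x :: real assume x: "0 \<le> x" "x \<le> \<bar>t\<bar>"
      have "((\<lambda>x. fsol x - x * fsol' t) has_real_derivative fsol' x - 1 * fsol' t) (at x)"
        by (intro derivative_intros DERIV_fsol DERIV_cmult_right)
      moreover have "fsol' t = fsol' \<bar>t\<bar>" by (simp add: fsol'_def fsol_abs)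
      ultimately show "\<exists>y. ((\<lambda>x. fsol x - x * fsol' t) has_real_derivative y) (at x) \<and> 0 \<le> y"
        using fsol'_antimono[OF x] by force
    qed simp
    then show ?thesis by simp
  qed
  then have "(\<bar>t\<bar> * fsol' t)\<^sup>2 \<le> (fsol \<bar>t\<bar>)\<^sup>2" using fsol'_pos[of t] by (intro power_mono) auto
  then have "t\<^sup>2 * (fsol' t)\<^sup>2 \<le> (fsol t)\<^sup>2" by (simp add: power_mult_distrib fsol_sq_abs)
  moreover have e: "(fsol' t)\<^sup>2 = 1 / (1 + 2 * (fsol t)\<^sup>2)"
    using sqrt_1_2sq_pos[of "fsol t"] by (simp add: fsol'_def power_divide)
  ultimately have "t\<^sup>2 \<le> (1 + 2 * (fsol t)\<^sup>2) * (fsol t)\<^sup>2"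
    using sqrt_1_2sq_pos[of "fsol t"] by (simp add: field_simps)
  also have "\<dots> \<le> (1 + 2 * t\<^sup>2) * (fsol t)\<^sup>2"
    using abs_fsol_le[of t] by (intro mult_right_mono) (auto simp: abs_le_square_iff)
  finally show ?thesis .
qed

lemma two_fsol_prod_sq_le: "2 * (fsol t * fsol' t)\<^sup>2 \<le> 1"
proof -
  have "(fsol' t)\<^sup>2 = 1 / (1 + 2 * (fsol t)\<^sup>2)"
    using sqrt_1_2sq_pos[of "fsol t"] by (simp add: fsol'_def power_divide)
  then show ?thesis using sqrt_1_2sq_pos[of "fsol t"] by (simp add: power_mult_distrib divide_le_eq)
qed

lemma abs_fsol_prod_le_1: "\<bar>fsol t * fsol' t\<bar> \<le> 1"
proof -
  have "(fsol t * fsol' t)\<^sup>2 \<le> 1\<^sup>2" using two_fsol_prod_sq_le[of t] by (simp add: power2_eq_square)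
  then show ?thesis by (simp add: abs_square_le_1)
qed

text \<open>Integration of |f f'| <= 1 from 0. Better than f^2 <= t^2 for large t, it is what halves
  the growth exponent of the nonlinearity.\<close>

lemma fsol_sq_le: "(fsol t)\<^sup>2 \<le> 2 * \<bar>t\<bar>"
proof -
  have "\<bar>(fsol t)\<^sup>2 / 2 - (fsol 0)\<^sup>2 / 2\<bar> \<le> 1 * \<bar>t - 0\<bar>"
    using field_differentiable_bound[of UNIV "\<lambda>t. (fsol t)\<^sup>2 / 2" fsol_prod 1 t 0]
      DERIV_half_fsol_sq abs_fsol_prod_le_1 unfolding fsol_prod_def by simp
  then show ?thesis by simp
qed

section \<open>Radial integrals\<close>

lemma emeasure_lborel_cball:
  assumes "0 \<le> r"
  shows "emeasure lborel (cball (0::'a::euclidean_space) r) = ennreal (measure lborel (ball (0::'a) 1) * r ^ DIM('a))"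
proof -
  have "emeasure lborel (cball (0::'a) r) = ennreal (measure lborel (cball (0::'a) r))"
    using emeasure_lborel_cball_finite[of "0::'a" r] by (intro emeasure_eq_ennreal_measure) (simp add: less_top)
  also have "measure lborel (cball (0::'a) r) = measure lborel (ball (0::'a) 1) * r ^ DIM('a)"
    using content_ball_conv_unit_ball[OF assms] by (simp add: content_cball_conv_ball mult.commute)
  finally show ?thesis .
qed

text \<open>The surface measure of the unit sphere, taken as the derivative at r = 1 of the volume
  of the ball of radius r, so that no measure on the sphere enters.\<close>

definition sphere_area :: "'a::euclidean_space itself \<Rightarrow> real" where
  "sphere_area _ = real DIM('a) * measure lborel (ball (0::'a) 1)"

lemma sphere_area_pos: "0 < sphere_area TYPE('a::euclidean_space)"
  by (simp add: sphere_area_def content_ball_pos)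

text \<open>Polar coordinates for radial integrands. Balls have volume v r^N, so both measures agree
  on the half-lines up to a; these are stable under intersection and generate the Borel
  sets.\<close>

lemma distr_norm_lborel:
  "distr lborel borel (norm :: 'a::euclidean_space \<Rightarrow> real) =
   density lborel (\<lambda>r. ennreal (sphere_area TYPE('a) * r ^ (DIM('a) - 1)) * indicator {0<..} r)"
   (is "?M = ?N")
proof -
  define v where "v = measure lborel (ball (0::'a) 1)"
  define f where "f = (\<lambda>r. ennreal (sphere_area TYPE('a) * r ^ (DIM('a) - 1)) * indicator {0<..} r)"
  have f_meas [measurable]: "f \<in> borel_measurable borel" unfolding f_def by measurable
  have M: "emeasure ?M {..a} = (if 0 \<le> a then ennreal (v * a ^ DIM('a)) else 0)" for a
  proof -
    have "norm -` {..a} \<inter> space lborel = cball (0::'a) a" by (auto simp: cball_def)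
    then have "emeasure ?M {..a} = emeasure lborel (cball (0::'a) a)" by (subst emeasure_distr) auto
    then show ?thesis using emeasure_lborel_cball[where 'a='a, of a] by (auto simp: v_def)
  qed
  have N: "emeasure ?N {..a} = (if 0 \<le> a then ennreal (v * a ^ DIM('a)) else 0)" for a
  proof -
    have "emeasure ?N {..a} = (\<integral>\<^sup>+r. f r * indicator {..a} r \<partial>lborel)"
      unfolding f_def[symmetric] by (subst emeasure_density) auto
    also have "\<dots> = (\<integral>\<^sup>+r. ennreal (sphere_area TYPE('a) * r ^ (DIM('a) - 1)) * indicator {0..a} r \<partial>lborel)"
    proof (rule nn_integral_cong_AE)
      \<comment> \<open>Adding the single point 0 changes no integral and produces a closed
        interval, over which the fundamental theorem of calculus applies.\<close>
      have "AE r in lborel. r \<noteq> (0::real)" using AE_lborel_singleton .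
      then show "AE r in lborel. f r * indicator {..a} r =
          ennreal (sphere_area TYPE('a) * r ^ (DIM('a) - 1)) * indicator {0..a} r"
        by eventually_elim (auto simp: f_def indicator_def)
    qed
    also have "\<dots> = (if 0 \<le> a then ennreal (v * a ^ DIM('a)) else 0)"
    proof (cases "0 \<le> a")
      case True
      have "(\<integral>\<^sup>+r. ennreal (sphere_area TYPE('a) * r ^ (DIM('a) - 1)) * indicator {0..a} r \<partial>lborel) =
        ennreal (v * a ^ DIM('a) - v * 0 ^ DIM('a))"
      proof (rule nn_integral_FTC_Icc[where F = "\<lambda>r. v * r ^ DIM('a)"])
        fix r :: real assume "r \<in> {0..a}"
        then have "0 \<le> r" by simp
        show "((\<lambda>r. v * r ^ DIM('a)) has_real_derivative sphere_area TYPE('a) * r ^ (DIM('a) - 1)) (at r)"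
          by (auto intro!: derivative_eq_intros simp: sphere_area_def v_def)
        show "0 \<le> sphere_area TYPE('a) * r ^ (DIM('a) - 1)"
          using sphere_area_pos[where 'a='a] \<open>0 \<le> r\<close> by simp
      qed (use True in auto)
      with True show ?thesis by (simp add: zero_power)
    qed (auto simp: indicator_def)
    finally show ?thesis .
  qed
  show ?thesis
  proof (rule measure_eqI_generator_eq[where E = "range atMost" and \<Omega> = UNIV and A = "\<lambda>i. {..real i}"])
    show "Int_stable (range (atMost :: real \<Rightarrow> _))"
      by (auto simp: Int_stable_def)
    show "emeasure ?M X = emeasure ?N X" if "X \<in> range atMost" for X
      using that M N by auto
    show "sets ?M = sigma_sets UNIV (range atMost)" "sets ?N = sigma_sets UNIV (range atMost)"
      by (simp_all add: borel_eq_atMost)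
    show "(\<Union>i. {..real i}) = UNIV" by (auto simp: real_arch_simple)
    show "emeasure ?M {..real i} \<noteq> \<infinity>" for i using M by simp
  qed auto
qed

lemma nn_integral_norm_lborel:
  fixes F :: "real \<Rightarrow> ennreal"
  assumes [measurable]: "F \<in> borel_measurable borel"
  shows "(\<integral>\<^sup>+x. F (norm (x::'a::euclidean_space)) \<partial>lborel) =
    (\<integral>\<^sup>+r. ennreal (sphere_area TYPE('a) * r ^ (DIM('a) - 1)) * indicator {0<..} r * F r \<partial>lborel)"
proof -
  have "(\<integral>\<^sup>+x. F (norm (x::'a)) \<partial>lborel) = (\<integral>\<^sup>+r. F r \<partial>distr lborel borel (norm :: 'a \<Rightarrow> real))"
    by (subst nn_integral_distr) auto
  also have "\<dots> = (\<integral>\<^sup>+r. ennreal (sphere_area TYPE('a) * r ^ (DIM('a) - 1)) * indicator {0<..} r * F r \<partial>lborel)"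
    unfolding distr_norm_lborel by (subst nn_integral_density) auto
  finally show ?thesis .
qed

lemma nn_integral_norm_powr_near_0:
  assumes "a + real DIM('a) > 0" "0 \<le> R"
  shows "(\<integral>\<^sup>+x. ennreal (norm (x::'a::euclidean_space) powr a) * indicator {..R} (norm x) \<partial>lborel) < \<infinity>"
proof -
  let ?c = "sphere_area TYPE('a)" and ?b = "a + real DIM('a) - 1"
  have "(\<integral>\<^sup>+x. ennreal (norm (x::'a) powr a) * indicator {..R} (norm x) \<partial>lborel) =
     (\<integral>\<^sup>+r. ennreal (?c * r ^ (DIM('a) - 1)) * indicator {0<..} r * (ennreal (r powr a) * indicator {..R} r) \<partial>lborel)"
    by (intro nn_integral_norm_lborel) measurable
  also have "\<dots> = (\<integral>\<^sup>+r. ennreal ?c * (ennreal (r powr ?b) * indicator {0..R} r) \<partial>lborel)"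
  proof (rule nn_integral_cong_AE)
    have "AE r in lborel. r \<noteq> (0::real)" using AE_lborel_singleton .
    then show "AE r in lborel. ennreal (?c * r ^ (DIM('a) - 1)) * indicator {0<..} r * (ennreal (r powr a) * indicator {..R} r)
        = ennreal ?c * (ennreal (r powr ?b) * indicator {0..R} r)"
    proof eventually_elim
      case (elim r)
      show ?case
      proof (cases "0 < r \<and> r \<le> R")
        case True
        have "r powr ?b = r powr real (DIM('a) - 1) * r powr a"
          by (simp add: powr_add[symmetric] of_nat_diff Suc_leI algebra_simps)
        then have "r powr ?b = r ^ (DIM('a) - 1) * r powr a"
          using True by (simp only: powr_realpow)
        then show ?thesis using True sphere_area_pos[where 'a='a]
          by (simp add: indicator_def ennreal_mult[symmetric] mult_ac)
      qed (use elim in \<open>auto simp: indicator_def\<close>)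
    qed
  qed
  also have "\<dots> = ennreal ?c * (\<integral>\<^sup>+r. ennreal (r powr ?b) * indicator {0..R} r \<partial>lborel)"
    by (rule nn_integral_cmult) measurable
  also have "(\<integral>\<^sup>+r. ennreal (r powr ?b) * indicator {0..R} r \<partial>lborel) = ennreal (R powr (?b + 1) / (?b + 1))"
    by (rule nn_integral_has_integral_lebesgue'[OF _ has_integral_powr_from_0]) (use assms in auto)
  finally show ?thesis by (simp add: ennreal_mult_less_top)
qed

lemma nn_integral_norm_powr_at_top:
  assumes "a + real DIM('a) < 0" "0 < R"
  shows "(\<integral>\<^sup>+x. ennreal (norm (x::'a::euclidean_space) powr a) * indicator {R..} (norm x) \<partial>lborel) < \<infinity>"
proof -
  let ?c = "sphere_area TYPE('a)" and ?b = "a + real DIM('a) - 1"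
  have "(\<integral>\<^sup>+x. ennreal (norm (x::'a) powr a) * indicator {R..} (norm x) \<partial>lborel) =
     (\<integral>\<^sup>+r. ennreal (?c * r ^ (DIM('a) - 1)) * indicator {0<..} r * (ennreal (r powr a) * indicator {R..} r) \<partial>lborel)"
    by (intro nn_integral_norm_lborel) measurable
  also have "\<dots> = (\<integral>\<^sup>+r. ennreal ?c * (ennreal (r powr ?b) * indicator {R..} r) \<partial>lborel)"
  proof (rule nn_integral_cong)
    fix r :: real
    show "ennreal (?c * r ^ (DIM('a) - 1)) * indicator {0<..} r * (ennreal (r powr a) * indicator {R..} r)
        = ennreal ?c * (ennreal (r powr ?b) * indicator {R..} r)"
    proof (cases "R \<le> r")
      case True
      have "r powr ?b = r powr real (DIM('a) - 1) * r powr a"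
        by (simp add: powr_add[symmetric] of_nat_diff Suc_leI algebra_simps)
      then have "r powr ?b = r ^ (DIM('a) - 1) * r powr a"
        using True assms by (simp only: powr_realpow)
      then show ?thesis using True assms sphere_area_pos[where 'a='a]
        by (simp add: indicator_def ennreal_mult[symmetric] mult_ac)
    qed (auto simp: indicator_def)
  qed
  also have "\<dots> = ennreal ?c * (\<integral>\<^sup>+r. ennreal (r powr ?b) * indicator {R..} r \<partial>lborel)"
    by (rule nn_integral_cmult) measurable
  also have "(\<integral>\<^sup>+r. ennreal (r powr ?b) * indicator {R..} r \<partial>lborel) = ennreal (- (R powr (?b + 1)) / (?b + 1))"
    by (rule nn_integral_has_integral_lebesgue'[OF _ has_integral_powr_to_inf]) (use assms in auto)
  finally show ?thesis by (simp add: ennreal_mult_less_top)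
qed

section \<open>Radial test functions\<close>

lemma integrable_continuous_bounded_support:
  fixes F :: "'a::euclidean_space \<Rightarrow> 'b::{banach, second_countable_topology}"
  assumes "continuous_on UNIV F" "\<And>x. R < norm x \<Longrightarrow> F x = 0"
  shows "integrable lborel F"
proof -
  have "integrable lborel (\<lambda>x. indicator (cball 0 R) x *\<^sub>R F x)"
    using assms(1) by (intro borel_integrable_compact continuous_on_subset[OF assms(1)]) auto
  moreover have "(\<lambda>x. indicator (cball 0 R) x *\<^sub>R F x) = F"
    using assms(2) by (force simp: indicator_def)
  ultimately show ?thesis by simp
qed

lemma bounded_continuous_bounded_support:
  fixes F :: "'a::euclidean_space \<Rightarrow> real"
  assumes "continuous_on UNIV F" "\<And>x. R < norm x \<Longrightarrow> F x = 0"
  obtains B where "0 \<le> B" "\<And>x. \<bar>F x\<bar> \<le> B"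
proof -
  have "compact (F ` cball 0 R)"
    using assms(1) by (intro compact_continuous_image continuous_on_subset[OF assms(1)]) auto
  then have "bounded (F ` cball 0 R)" by (rule compact_imp_bounded)
  then obtain B where "\<forall>y\<in>F ` cball 0 R. norm y \<le> B"
    unfolding bounded_iff by blast
  then have B: "\<bar>F x\<bar> \<le> B" if "x \<in> cball 0 R" for x using that by simp
  have "\<bar>F x\<bar> \<le> max 0 B" for x
    using B[of x] assms(2)[of x] by (cases "R < norm x") auto
  then show ?thesis using that[of "max 0 B"] by auto
qed

text \<open>Translation invariance makes the difference quotients integrate to zero.\<close>
lemma integral_directional_derivative_eq_0:
  fixes F F' :: "'a::euclidean_space \<Rightarrow> real"
  assumes D: "\<And>x. ((\<lambda>t. F (x + t *\<^sub>R e)) has_real_derivative F' x) (at 0)"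
    and cont: "continuous_on UNIV F" "continuous_on UNIV F'"
    and supp: "\<And>x. R < norm x \<Longrightarrow> F x = 0" "\<And>x. R < norm x \<Longrightarrow> F' x = 0"
  shows "(\<integral>x. F' x \<partial>lborel) = 0"
proof -
  have Dt: "((\<lambda>t. F (x + t *\<^sub>R e)) has_real_derivative F' (x + s *\<^sub>R e)) (at s)" for x s
  proof -
    have "((\<lambda>t. F ((x + s *\<^sub>R e) + (t - s) *\<^sub>R e)) has_real_derivative F' (x + s *\<^sub>R e) * 1) (at s)"
      by (rule DERIV_chain2[where g = "\<lambda>t. t - s"]) (use D in \<open>auto intro!: derivative_eq_intros\<close>)
    then show ?thesis by (simp add: algebra_simps)
  qed
  obtain B where B: "0 \<le> B" "\<And>x. \<bar>F' x\<bar> \<le> B"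
    using bounded_continuous_bounded_support[OF cont(2) supp(2)] by blast
  define h where "h n = inverse (real (Suc n))" for n
  have h: "0 < h n" "h n \<le> 1" for n by (auto simp: h_def field_simps)
  have h0: "h \<longlonglongrightarrow> 0" unfolding h_def by (rule LIMSEQ_inverse_real_of_nat)
  define q where "q n x = (F (x + h n *\<^sub>R e) - F x) / h n" for n x
  have [measurable]: "F \<in> borel_measurable borel" "F' \<in> borel_measurable borel"
    using cont by (auto intro: borel_measurable_continuous_onI)
  have int: "integrable lborel F"
    by (rule integrable_continuous_bounded_support[OF cont(1) supp(1)])
  have tr: "has_bochner_integral lborel (\<lambda>x. F (x + c)) (\<integral>x. F x \<partial>lborel)" for c
  proof -
    have "integrable (distr lborel borel ((+) c)) F" using int by (simp add: lborel_distr_plus)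
    then have "integrable lborel (\<lambda>x. F (c + x))" by (subst (asm) integrable_distr_eq) auto
    moreover have "(\<integral>x. F x \<partial>lborel) = (\<integral>x. F x \<partial>distr lborel borel ((+) c))" by (simp add: lborel_distr_plus)
    then have "(\<integral>x. F x \<partial>lborel) = (\<integral>x. F (c + x) \<partial>lborel)" by (subst (asm) integral_distr) auto
    ultimately show ?thesis by (simp add: has_bochner_integral_iff add.commute)
  qed
  have q0: "(\<integral>x. q n x \<partial>lborel) = 0" for n
    using tr[of "h n *\<^sub>R e"] int unfolding q_def has_bochner_integral_iff by simp
  have "(\<lambda>n. \<integral>x. q n x \<partial>lborel) \<longlonglongrightarrow> (\<integral>x. F' x \<partial>lborel)"
  proof (rule integral_dominated_convergence[where w = "\<lambda>x. B * indicator (cball 0 (R + norm e)) x"])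
    show "integrable lborel (\<lambda>x::'a. B * indicator (cball 0 (R + norm e)) x)"
      using emeasure_lborel_cball_finite[of "0::'a" "R + norm e"]
      by (intro integrable_mult_right integrable_real_indicator) (auto simp: less_top)
    show "AE x in lborel. (\<lambda>n. q n x) \<longlonglongrightarrow> F' x"
    proof (intro AE_I2)
      fix x
      have "((\<lambda>t. (F (x + t *\<^sub>R e) - F x) / t) \<longlongrightarrow> F' x) (at 0)"
        using D[of x] by (simp add: DERIV_def)
      moreover have "filterlim h (at 0) sequentially"
        using h0 h(1) by (auto simp: filterlim_at less_le intro!: always_eventually)
      ultimately show "(\<lambda>n. q n x) \<longlonglongrightarrow> F' x"
        unfolding q_def by (rule filterlim_compose)
    qed
    show "AE x in lborel. norm (q n x) \<le> B * indicator (cball 0 (R + norm e)) x" for n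
    proof (intro AE_I2)
      fix x
      show "norm (q n x) \<le> B * indicator (cball 0 (R + norm e)) x"
      proof (cases "norm x \<le> R + norm e")
        case True
        have "norm (F (x + h n *\<^sub>R e) - F (x + 0 *\<^sub>R e)) \<le> B * norm (h n - 0)"
          by (rule field_differentiable_bound[OF convex_UNIV, where f = "\<lambda>t. F (x + t *\<^sub>R e)" and f' = "\<lambda>s. F' (x + s *\<^sub>R e)"])
             (use Dt B in auto)
        then show ?thesis using True h(1)[of n] by (simp add: q_def field_simps)
      next
        case False
        \<comment> \<open>Since h n <= 1, a point beyond R + |e| cannot be shifted into the ball of
          radius R, so the difference quotient vanishes there.\<close>
        have "norm x \<le> norm (x + h n *\<^sub>R e) + norm (h n *\<^sub>R e)"
          by (metis add_diff_cancel_right' norm_triangle_ineq4)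
        moreover have "norm (h n *\<^sub>R e) \<le> norm e" using h[of n] by (simp add: mult_left_le_one_le)
        ultimately have "R < norm (x + h n *\<^sub>R e)" "R < norm x" using False norm_ge_zero[of e] by linarith+
        then show ?thesis using supp(1) B(1) by (simp add: q_def)
      qed
    qed
  qed (auto simp: q_def)
  then show ?thesis using q0 LIMSEQ_unique[OF tendsto_const] by fastforce
qed

section \<open>Calculus of smooth test functions and Green's identity\<close>

lemma pdiffs_append: "pdiffs (xs @ ys) \<phi> = pdiffs xs (pdiffs ys \<phi>)"
  by (induction xs) auto

lemma smooth_fn_pdiff: "smooth_fn \<phi> \<Longrightarrow> smooth_fn (pdiff i \<phi>)"
  unfolding smooth_fn_def by (metis pdiffs_append pdiffs.simps)

lemma smooth_fn_differentiable: "smooth_fn \<phi> \<Longrightarrow> \<phi> differentiable (at x)"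
  unfolding smooth_fn_def by (metis pdiffs.simps(1))

lemma smooth_fn_continuous: "smooth_fn \<phi> \<Longrightarrow> continuous_on UNIV \<phi>"
  by (simp add: continuous_at_imp_continuous_on differentiable_imp_continuous_within smooth_fn_differentiable)

text \<open>Differentiability provides some linear map; its values on the coordinate axes identify
  it with the vector of partial derivatives.\<close>

lemma smooth_fn_has_derivative:
  assumes "smooth_fn \<phi>"
  shows "(\<phi> has_derivative (\<lambda>v. grad_s \<phi> x \<bullet> v)) (at x)"
proof -
  let ?L = "frechet_derivative \<phi> (at x)"
  have D: "(\<phi> has_derivative ?L) (at x)"
    using smooth_fn_differentiable[OF assms] frechet_derivative_works by blast
  then interpret L: linear ?L using has_derivative_linear by blast
  have "?L v = grad_s \<phi> x \<bullet> v" for v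
  proof -
    have "?L v = ?L (\<Sum>i\<in>UNIV. v $ i *\<^sub>R axis i 1)"
      by (simp add: basis_expansion flip: scalar_mult_eq_scaleR)
    also have "\<dots> = (\<Sum>i\<in>UNIV. v $ i * ?L (axis i 1))" by (simp add: L.sum L.scale)
    also have "\<dots> = grad_s \<phi> x \<bullet> v" by (simp add: inner_vec_def grad_s_def pdiff_def mult.commute)
    finally show ?thesis .
  qed
  then have "?L = (\<lambda>v. grad_s \<phi> x \<bullet> v)" by auto
  with D show ?thesis by simp
qed

lemma smooth_fn_DERIV_line:
  assumes "smooth_fn \<phi>"
  shows "((\<lambda>t. \<phi> (x + t *\<^sub>R v)) has_real_derivative grad_s \<phi> (x + s *\<^sub>R v) \<bullet> v) (at s)"
proof -
  have "((\<lambda>t. x + t *\<^sub>R v) has_derivative (\<lambda>t. t *\<^sub>R v)) (at s)"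
    by (auto intro!: derivative_eq_intros)
  then have "((\<lambda>t. \<phi> (x + t *\<^sub>R v)) has_derivative (\<lambda>t. grad_s \<phi> (x + s *\<^sub>R v) \<bullet> (t *\<^sub>R v))) (at s)"
    using has_derivative_compose smooth_fn_has_derivative[OF assms] by blast
  moreover have "(\<lambda>t. grad_s \<phi> (x + s *\<^sub>R v) \<bullet> (t *\<^sub>R v)) = (*) (grad_s \<phi> (x + s *\<^sub>R v) \<bullet> v)"
    by (auto simp: mult.commute)
  ultimately show ?thesis by (simp add: has_field_derivative_def)
qed

lemma grad_s_inner_axis: "grad_s \<phi> x \<bullet> axis i 1 = pdiff i \<phi> x"
  by (simp add: grad_s_def inner_axis)

lemma grad_s_continuous: "smooth_fn \<phi> \<Longrightarrow> continuous_on UNIV (grad_s \<phi>)"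
  unfolding grad_s_def by (intro continuous_intros smooth_fn_continuous smooth_fn_pdiff)

lemma grad_s_eq_0:
  assumes "smooth_fn \<phi>" "\<And>y. R < norm y \<Longrightarrow> \<phi> y = 0" "R < norm x"
  shows "grad_s \<phi> x = 0"
proof -
  have "(\<phi> has_derivative (\<lambda>v. 0)) (at x)"
    by (rule has_derivative_transform_within_open[where f = "\<lambda>_. 0" and s = "{y. R < norm y}"])
       (use assms in \<open>auto intro!: open_Collect_less continuous_intros\<close>)
  then have "(\<lambda>v. grad_s \<phi> x \<bullet> v) = (\<lambda>v. 0)"
    using smooth_fn_has_derivative[OF assms(1)] has_derivative_unique by blast
  then show ?thesis by (metis inner_eq_zero_iff)
qed

lemma pdiff_eq_0:
  assumes "smooth_fn \<phi>" "\<And>y. R < norm y \<Longrightarrow> \<phi> y = 0" "R < norm x"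
  shows "pdiff i \<phi> x = 0"
  using grad_s_eq_0[OF assms] grad_s_inner_axis[of \<phi> x i] by simp

text \<open>For each i the product of \<phi> and the i-th partial derivative of \<eta> is supported
  in the ball of \<phi>, and its i-th derivative integrates to 0. The product rule and summation
  over i give the claim.\<close>

lemma Green_identity:
  assumes "smooth_fn \<phi>" "smooth_fn \<eta>" "\<And>y. R < norm y \<Longrightarrow> \<phi> y = 0"
  shows "(\<integral>x. grad_s \<phi> x \<bullet> grad_s \<eta> x \<partial>lborel) = - (\<integral>x. \<phi> x * (\<Sum>i\<in>UNIV. pdiff i (pdiff i \<eta>) x) \<partial>lborel)"
proof -
  note c = smooth_fn_continuous smooth_fn_pdiff assms
  have z: "pdiff i \<phi> x = 0" if "R < norm x" for x i using pdiff_eq_0[OF assms(1,3) that] .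
  have i1: "integrable lborel (\<lambda>x. pdiff i \<phi> x * pdiff i \<eta> x)" for i
    using z by (intro integrable_continuous_bounded_support[where R = R] continuous_intros c) auto
  have i2: "integrable lborel (\<lambda>x. \<phi> x * pdiff i (pdiff i \<eta>) x)" for i
    using assms(3) by (intro integrable_continuous_bounded_support[where R = R] continuous_intros c) auto
  have "(\<integral>x. pdiff i \<phi> x * pdiff i \<eta> x + \<phi> x * pdiff i (pdiff i \<eta>) x \<partial>lborel) = 0" for i
  proof (rule integral_directional_derivative_eq_0[where F = "\<lambda>x. \<phi> x * pdiff i \<eta> x" and e = "axis i 1" and R = R])
    fix x
    have "((\<lambda>t. \<phi> (x + t *\<^sub>R axis i 1)) has_real_derivative pdiff i \<phi> x) (at 0)"
      using smooth_fn_DERIV_line[OF assms(1), of x "axis i 1" 0] by (simp add: grad_s_inner_axis)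
    moreover have "((\<lambda>t. pdiff i \<eta> (x + t *\<^sub>R axis i 1)) has_real_derivative pdiff i (pdiff i \<eta>) x) (at 0)"
      using smooth_fn_DERIV_line[OF smooth_fn_pdiff[OF assms(2)], of i x "axis i 1" 0] by (simp add: grad_s_inner_axis)
    ultimately show "((\<lambda>t. \<phi> (x + t *\<^sub>R axis i 1) * pdiff i \<eta> (x + t *\<^sub>R axis i 1)) has_real_derivative
        pdiff i \<phi> x * pdiff i \<eta> x + \<phi> x * pdiff i (pdiff i \<eta>) x) (at 0)"
      by (auto intro!: derivative_eq_intros)
  next
    show "continuous_on UNIV (\<lambda>x. \<phi> x * pdiff i \<eta> x)"
      "continuous_on UNIV (\<lambda>x. pdiff i \<phi> x * pdiff i \<eta> x + \<phi> x * pdiff i (pdiff i \<eta>) x)"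
      by (intro continuous_intros c)+
  qed (use z assms(3) in auto)
  then have "(\<integral>x. pdiff i \<phi> x * pdiff i \<eta> x \<partial>lborel) = - (\<integral>x. \<phi> x * pdiff i (pdiff i \<eta>) x \<partial>lborel)" for i
    using Bochner_Integration.integral_add[OF i1 i2, of i i] by simp
  then have "(\<Sum>i\<in>UNIV. \<integral>x. pdiff i \<phi> x * pdiff i \<eta> x \<partial>lborel) = - (\<Sum>i\<in>UNIV. \<integral>x. \<phi> x * pdiff i (pdiff i \<eta>) x \<partial>lborel)"
    by (simp add: sum_negf)
  then show ?thesis
    using i1 i2 by (simp add: inner_vec_def grad_s_def sum_distrib_left Bochner_Integration.integral_sum)
qed

text \<open>With d = N - 3 the boundary term is the source of the decay estimate and the integral on
  the left that of Hardy's inequality. The cross term 2 s^(d+1) \<psi> \<psi>' from the product rule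
  is absorbed by completing a square, which still leaves half of the term (d+1) s^d
  \<psi>^2.\<close>

lemma radial_inequality_1d:
  fixes \<psi> \<psi>' :: "real \<Rightarrow> real"
  assumes D: "\<And>s. (\<psi> has_real_derivative \<psi>' s) (at s)" and cont: "continuous_on UNIV \<psi>'"
    and supp: "\<And>s. R < s \<Longrightarrow> \<psi> s = 0" and r: "0 \<le> r"
  shows "ennreal (r ^ (d+1) * (\<psi> r)\<^sup>2)
      + (\<integral>\<^sup>+s. ennreal ((real d + 1) / 2 * (s ^ d * (\<psi> s)\<^sup>2)) * indicator {r..} s \<partial>lborel)
    \<le> (\<integral>\<^sup>+s. ennreal (2 / (real d + 1) * (s ^ (d+2) * (\<psi>' s)\<^sup>2)) * indicator {r..} s \<partial>lborel)"
proof -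
  \<comment> \<open>An endpoint beyond the support, so that the boundary term at b vanishes.\<close>
  define b where "b = max r R + 1"
  have b: "r \<le> b" "R < b" by (auto simp: b_def)
  have cpsi: "continuous_on UNIV \<psi>" by (intro continuous_at_imp_continuous_on ballI DERIV_isCont[OF D])
  define A where "A s = (real d + 1) / 2 * (s ^ d * (\<psi> s)\<^sup>2)" for s
  define B where "B s = 2 / (real d + 1) * (s ^ (d+2) * (\<psi>' s)\<^sup>2)" for s
  define H' where "H' s = - ((real d + 1) * s ^ d * (\<psi> s)\<^sup>2 + s ^ (d+1) * (2 * \<psi> s * \<psi>' s))" for s
  have A0: "0 \<le> A s" and B0: "0 \<le> B s" if "s \<in> {r..b}" for s using that r by (auto simp: A_def B_def)
  have cA: "continuous_on S A" and cB: "continuous_on S B" for S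
    unfolding A_def B_def using continuous_on_subset[OF cont] continuous_on_subset[OF cpsi]
    by (auto intro!: continuous_intros)
  have hA: "(A has_integral integral {r..b} A) {r..b}" and hB: "(B has_integral integral {r..b} B) {r..b}"
    using cA cB by (auto intro!: integrable_integral integrable_continuous_real)
  have "(H' has_integral (- (b ^ (d+1) * (\<psi> b)\<^sup>2) - (- (r ^ (d+1) * (\<psi> r)\<^sup>2)))) {r..b}"
  proof (rule fundamental_theorem_of_calculus[OF b(1)])
    fix s
    have pw: "((\<lambda>s. s ^ (d+1)) has_real_derivative (real d + 1) * s ^ d) (at s)"
      using DERIV_pow[of "d+1" s UNIV] by (simp add: add.commute)
    have "((\<lambda>s. (\<psi> s)\<^sup>2) has_real_derivative 2 * \<psi> s * \<psi>' s) (at s)"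
      using DERIV_power[OF D, of 2 s] by (simp add: mult_ac)
    from DERIV_minus[OF DERIV_mult[OF pw this]]
    have "((\<lambda>s. - (s ^ (d+1) * (\<psi> s)\<^sup>2)) has_real_derivative H' s) (at s)"
      unfolding H'_def by (rule DERIV_cong) (simp only: mult_ac add_ac)
    then show "((\<lambda>s. - (s ^ (d+1) * (\<psi> s)\<^sup>2)) has_vector_derivative H' s) (at s within {r..b})"
      unfolding has_real_derivative_iff_has_vector_derivative by (rule has_vector_derivative_at_within)
  qed
  then have hH: "(H' has_integral r ^ (d+1) * (\<psi> r)\<^sup>2) {r..b}" using supp[OF b(2)] by simp
  have key: "H' s + A s \<le> B s" if "s \<in> {r..b}" for s
  proof -
    have s: "0 \<le> s" using that r by auto
    let ?c = "real d + 1"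
    \<comment> \<open>Instantiated with c = d + 1, y = \<psi> s, t = s and z = \<psi>' s; multiplied
      by s^d, the right-hand side is B - A - H'.\<close>
    have sq: "(c * y + 2 * t * z)\<^sup>2 / (2 * c) = c / 2 * y\<^sup>2 + t * (2 * y * z) + 2 / c * (t\<^sup>2 * z\<^sup>2)"
      if "0 < c" for c y t z :: real
      using that by (simp add: field_simps power2_eq_square)
    have "0 \<le> s ^ d * ((?c * \<psi> s + 2 * s * \<psi>' s)\<^sup>2 / (2 * ?c))" using s by simp
    also have "\<dots> = s ^ d * (?c / 2 * (\<psi> s)\<^sup>2 + s * (2 * \<psi> s * \<psi>' s) + 2 / ?c * (s\<^sup>2 * (\<psi>' s)\<^sup>2))"
      by (subst sq) auto
    also have "\<dots> = B s - A s - H' s"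
    proof -
      have alg: "p * (c / 2 * y + s * z + e * (s\<^sup>2 * w)) = e * (s\<^sup>2 * p * w) - c / 2 * (p * y) + (c * p * y + s * p * z)"
        for p c y z e w :: real by (simp add: algebra_simps)
      have "s ^ (d + 1) = s * s ^ d" "s ^ (d + 2) = s\<^sup>2 * s ^ d" by (simp_all add: power2_eq_square)
      then show ?thesis unfolding A_def B_def H'_def alg by (simp add: power2_eq_square)
    qed
    finally show ?thesis by simp
  qed
  have le: "r ^ (d+1) * (\<psi> r)\<^sup>2 + integral {r..b} A \<le> integral {r..b} B"
    by (rule has_integral_le[OF has_integral_add[OF hH hA] hB]) (use key in auto)
  have nA: "(\<integral>\<^sup>+s. ennreal (A s) * indicator {r..} s \<partial>lborel) = ennreal (integral {r..b} A)"
  proof -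
    have "ennreal (A s) * indicator {r..} s = ennreal (A s) * indicator {r..b} s" for s
      using supp[of s] b by (cases "s \<le> b") (auto simp: A_def indicator_def)
    then show ?thesis using nn_integral_has_integral_lebesgue'[OF A0 hA] by simp
  qed
  have "ennreal (integral {r..b} B) = (\<integral>\<^sup>+s. ennreal (B s) * indicator {r..b} s \<partial>lborel)"
    by (rule nn_integral_has_integral_lebesgue'[OF B0 hB, symmetric])
  also have "\<dots> \<le> (\<integral>\<^sup>+s. ennreal (B s) * indicator {r..} s \<partial>lborel)"
    by (intro nn_integral_mono) (auto simp: indicator_def)
  finally have nB: "ennreal (integral {r..b} B) \<le> (\<integral>\<^sup>+s. ennreal (B s) * indicator {r..} s \<partial>lborel)" .
  have "ennreal (r ^ (d+1) * (\<psi> r)\<^sup>2) + ennreal (integral {r..b} A) \<le> ennreal (integral {r..b} B)"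
  proof -
    have "ennreal (r ^ (d+1) * (\<psi> r)\<^sup>2) + ennreal (integral {r..b} A) = ennreal (r ^ (d+1) * (\<psi> r)\<^sup>2 + integral {r..b} A)"
      using r has_integral_nonneg[OF hA A0] by (intro ennreal_plus[symmetric]) auto
    then show ?thesis using ennreal_leI[OF le] by simp
  qed
  then show ?thesis using order_trans[OF _ nB] nA unfolding A_def B_def by simp
qed

text \<open>The profile is taken along a whole line through 0 rather than a half-line, so it is
  continuously differentiable without any condition at 0. Radiality allows the axis to be turned
  onto x, where the radial derivative is a component of the gradient.\<close>

lemma radial_test_profile:
  fixes \<phi> :: "real^'n::finite \<Rightarrow> real"
  assumes "radial_test \<phi>"
  obtains \<psi> \<psi>' R where "\<And>s. (\<psi> has_real_derivative \<psi>' s) (at s)" "continuous_on UNIV \<psi>'"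
    "\<And>s. R < s \<Longrightarrow> \<psi> s = 0" "\<And>x. \<phi> x = \<psi> (norm x)" "\<And>x. x \<noteq> 0 \<Longrightarrow> \<bar>\<psi>' (norm x)\<bar> \<le> norm (grad_s \<phi> x)"
proof -
  obtain R where sm: "smooth_fn \<phi>" and rad: "radial_fn \<phi>" and R: "\<And>x. R < norm x \<Longrightarrow> \<phi> x = 0"
    using assms unfolding radial_test_def by blast
  obtain k :: 'n where True by blast
  define e :: "real^'n" where "e = axis k 1"
  have e: "norm e = 1" by (simp add: e_def)
  define \<psi> where "\<psi> s = \<phi> (s *\<^sub>R e)" for s
  define \<psi>' where "\<psi>' s = grad_s \<phi> (s *\<^sub>R e) \<bullet> e" for s
  show thesis
  proof (rule that)
    show D: "(\<psi> has_real_derivative \<psi>' s) (at s)" for s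
      using smooth_fn_DERIV_line[OF sm, of 0 e s] by (simp add: \<psi>_def[abs_def] \<psi>'_def)
    show "continuous_on UNIV \<psi>'"
      unfolding \<psi>'_def by (intro continuous_intros continuous_on_compose2[OF grad_s_continuous[OF sm]]) auto
    show "\<psi> s = 0" if "R < s" for s using R[of "s *\<^sub>R e"] that e by (simp add: \<psi>_def)
    show "\<phi> x = \<psi> (norm x)" for x
      using rad e unfolding radial_fn_def \<psi>_def by (metis abs_norm_cancel mult.right_neutral norm_scaleR)
    show "\<bar>\<psi>' (norm x)\<bar> \<le> norm (grad_s \<phi> x)" if "x \<noteq> 0" for x
    proof -
      let ?u = "x /\<^sub>R norm x"
      have u: "norm ?u = 1" "norm x *\<^sub>R ?u = x" using that by auto
      have "\<phi> (s *\<^sub>R e) = \<phi> (s *\<^sub>R ?u)" for s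
        using rad e u unfolding radial_fn_def by (metis norm_scaleR)
      then have "\<psi> = (\<lambda>s. \<phi> (s *\<^sub>R ?u))" unfolding \<psi>_def by blast
      then have "(\<psi> has_real_derivative grad_s \<phi> x \<bullet> ?u) (at (norm x))"
        using smooth_fn_DERIV_line[OF sm, of 0 ?u "norm x"] unfolding u(2) by (simp only: add_0 u(2))
      then have "\<psi>' (norm x) = grad_s \<phi> x \<bullet> ?u" using D DERIV_unique by blast
      then show ?thesis using Cauchy_Schwarz_ineq2[of "grad_s \<phi> x" ?u] u by simp
    qed
  qed
qed

text \<open>Writing N = d + 3 keeps the powers N - 2 and N - 1 natural numbers. The one-dimensional
  inequality is multiplied by the area of the sphere: dropping its integral at r = |x| gives the
  first estimate, dropping its boundary term at r = 0 the second, with the classical Hardy constant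
  4 / (N-2)^2.\<close>

lemma
  fixes \<phi> :: "real^'n::finite \<Rightarrow> real"
  assumes "radial_test \<phi>" and n: "CARD('n) = d + 3"
  shows radial_test_pointwise: "x \<noteq> 0 \<Longrightarrow> ennreal (sphere_area TYPE(real^'n) * norm x ^ (d+1) * (\<phi> x)\<^sup>2)
      \<le> ennreal (2 / (real d + 1)) * (\<integral>\<^sup>+y. ennreal ((norm (grad_s \<phi> y))\<^sup>2) \<partial>lborel)"
    and radial_test_Hardy: "(\<integral>\<^sup>+y. ennreal ((\<phi> y)\<^sup>2 / (norm y)\<^sup>2) \<partial>lborel)
      \<le> ennreal (4 / (real d + 1)\<^sup>2) * (\<integral>\<^sup>+y. ennreal ((norm (grad_s \<phi> y))\<^sup>2) \<partial>lborel)"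
proof -
  obtain \<psi> \<psi>' R where D: "\<And>s. (\<psi> has_real_derivative \<psi>' s) (at s)" and c: "continuous_on UNIV \<psi>'"
    and s: "\<And>s. R < s \<Longrightarrow> \<psi> s = 0" and eq: "\<And>x. \<phi> x = \<psi> (norm x)"
    and g: "\<And>x. x \<noteq> 0 \<Longrightarrow> \<bar>\<psi>' (norm x)\<bar> \<le> norm (grad_s \<phi> x)"
    using radial_test_profile[OF assms(1)] by metis
  let ?c = "sphere_area TYPE(real^'n)"
  have c0: "?c > 0" by (rule sphere_area_pos)
  have dim: "DIM(real^'n) - 1 = d + 2" using n by simp
  have [measurable]: "\<psi>' \<in> borel_measurable borel" using c by (rule borel_measurable_continuous_onI)
  have [measurable]: "\<psi> \<in> borel_measurable borel"
    by (intro borel_measurable_continuous_onI continuous_at_imp_continuous_on ballI DERIV_isCont[OF D])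
  define G where "G = (\<integral>\<^sup>+y. ennreal ((norm (grad_s \<phi> y))\<^sup>2) \<partial>lborel)"
  have "(\<integral>\<^sup>+s. ennreal (?c * s ^ (d+2)) * indicator {0<..} s * ennreal ((\<psi>' s)\<^sup>2) \<partial>lborel)
      = (\<integral>\<^sup>+y. ennreal ((\<psi>' (norm (y::real^'n)))\<^sup>2) \<partial>lborel)"
    unfolding dim[symmetric] by (rule nn_integral_norm_lborel[symmetric]) measurable
  also have "\<dots> \<le> G"
    unfolding G_def
  proof (rule nn_integral_mono_AE)
    have "AE y in lborel. y \<noteq> (0::real^'n)" using AE_lborel_singleton .
    then show "AE y in lborel. ennreal ((\<psi>' (norm (y::real^'n)))\<^sup>2) \<le> ennreal ((norm (grad_s \<phi> y))\<^sup>2)"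
      by eventually_elim (use g in \<open>auto intro!: ennreal_leI simp: abs_le_square_iff[symmetric]\<close>)
  qed
  finally have G1: "(\<integral>\<^sup>+s. ennreal (?c * s ^ (d+2)) * indicator {0<..} s * ennreal ((\<psi>' s)\<^sup>2) \<partial>lborel) \<le> G" .
  have G2: "ennreal ?c * (\<integral>\<^sup>+s. ennreal (2 / (real d + 1) * (s ^ (d+2) * (\<psi>' s)\<^sup>2)) * indicator {r..} s \<partial>lborel)
     \<le> ennreal (2 / (real d + 1)) * G" if "0 \<le> r" for r
  proof -
    have "ennreal ?c * (\<integral>\<^sup>+s. ennreal (2 / (real d + 1) * (s ^ (d+2) * (\<psi>' s)\<^sup>2)) * indicator {r..} s \<partial>lborel)
      = (\<integral>\<^sup>+s. ennreal ?c * (ennreal (2 / (real d + 1) * (s ^ (d+2) * (\<psi>' s)\<^sup>2)) * indicator {r..} s) \<partial>lborel)"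
      by (subst nn_integral_cmult) auto
    also have "\<dots> \<le> (\<integral>\<^sup>+s. ennreal (2 / (real d + 1)) * (ennreal (?c * s ^ (d+2)) * indicator {0<..} s * ennreal ((\<psi>' s)\<^sup>2)) \<partial>lborel)"
    proof (intro nn_integral_mono)
      fix s :: real
      have e: "ennreal ?c * (ennreal (2 / (real d + 1) * (s ^ (d+2) * (\<psi>' s)\<^sup>2))) =
          ennreal (2 / (real d + 1)) * (ennreal (?c * s ^ (d+2)) * ennreal ((\<psi>' s)\<^sup>2))" if "0 \<le> s"
        using that c0 by (simp add: ennreal_mult[symmetric] mult_ac)
      \<comment> \<open>At s = 0 the power s^(d+2) vanishes, so passing from \<open>{r..}\<close> to
        \<open>{0<..}\<close> loses nothing.\<close>
      consider "s < r" | "s = 0" | "r \<le> s" "0 < s" using \<open>0 \<le> r\<close> by linarith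
      then show "ennreal ?c * (ennreal (2 / (real d + 1) * (s ^ (d+2) * (\<psi>' s)\<^sup>2)) * indicator {r..} s)
         \<le> ennreal (2 / (real d + 1)) * (ennreal (?c * s ^ (d+2)) * indicator {0<..} s * ennreal ((\<psi>' s)\<^sup>2))"
        by cases (use e in \<open>auto simp: indicator_def\<close>)
    qed
    also have "\<dots> = ennreal (2 / (real d + 1)) * (\<integral>\<^sup>+s. ennreal (?c * s ^ (d+2)) * indicator {0<..} s * ennreal ((\<psi>' s)\<^sup>2) \<partial>lborel)"
      by (subst nn_integral_cmult) auto
    also have "\<dots> \<le> ennreal (2 / (real d + 1)) * G" using G1 by (intro mult_left_mono) auto
    finally show ?thesis .
  qed
  note I = radial_inequality_1d[OF D c s, of R _ d]
  show "ennreal (?c * norm x ^ (d+1) * (\<phi> x)\<^sup>2) \<le> ennreal (2 / (real d + 1)) * (\<integral>\<^sup>+y. ennreal ((norm (grad_s \<phi> y))\<^sup>2) \<partial>lborel)"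
    if "x \<noteq> 0"
  proof -
    have "ennreal (?c * norm x ^ (d+1) * (\<phi> x)\<^sup>2) = ennreal ?c * ennreal (norm x ^ (d+1) * (\<psi> (norm x))\<^sup>2)"
      using c0 by (simp add: ennreal_mult[symmetric] eq mult_ac)
    also have "\<dots> \<le> ennreal ?c * (\<integral>\<^sup>+s. ennreal (2 / (real d + 1) * (s ^ (d+2) * (\<psi>' s)\<^sup>2)) * indicator {norm x..} s \<partial>lborel)"
      by (intro mult_left_mono order_trans[OF _ I[OF _ norm_ge_zero]]) auto
    also have "\<dots> \<le> ennreal (2 / (real d + 1)) * G" by (rule G2) simp
    finally show ?thesis unfolding G_def .
  qed
  let ?k = "(real d + 1) / 2"
  have "(\<integral>\<^sup>+y. ennreal ((\<phi> y)\<^sup>2 / (norm y)\<^sup>2) \<partial>lborel) = (\<integral>\<^sup>+y. ennreal ((\<psi> (norm (y::real^'n)))\<^sup>2 / (norm y)\<^sup>2) \<partial>lborel)"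
    by (simp add: eq)
  also have "\<dots> = (\<integral>\<^sup>+s. ennreal (?c * s ^ (d+2)) * indicator {0<..} s * ennreal ((\<psi> s)\<^sup>2 / s\<^sup>2) \<partial>lborel)"
    unfolding dim[symmetric] by (rule nn_integral_norm_lborel[where F = "\<lambda>s. ennreal ((\<psi> s)\<^sup>2 / s\<^sup>2)"]) measurable
  also have "\<dots> \<le> (\<integral>\<^sup>+s. ennreal (?c / ?k) * (ennreal (?k * (s ^ d * (\<psi> s)\<^sup>2)) * indicator {0..} s) \<partial>lborel)"
  proof (intro nn_integral_mono)
    fix s :: real
    show "ennreal (?c * s ^ (d+2)) * indicator {0<..} s * ennreal ((\<psi> s)\<^sup>2 / s\<^sup>2)
       \<le> ennreal (?c / ?k) * (ennreal (?k * (s ^ d * (\<psi> s)\<^sup>2)) * indicator {0..} s)"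
    proof (cases "0 < s")
      case True
      have "ennreal (?c * s ^ (d+2)) * ennreal ((\<psi> s)\<^sup>2 / s\<^sup>2) = ennreal (?c * s ^ (d+2) * ((\<psi> s)\<^sup>2 / s\<^sup>2))"
        using True c0 by (simp add: ennreal_mult[symmetric])
      also have "?c * s ^ (d+2) * ((\<psi> s)\<^sup>2 / s\<^sup>2) = (?c / ?k) * (?k * (s ^ d * (\<psi> s)\<^sup>2))"
        using True by (simp add: field_simps power_add power2_eq_square)
      also have "ennreal \<dots> = ennreal (?c / ?k) * ennreal (?k * (s ^ d * (\<psi> s)\<^sup>2))"
        using True c0 by (intro ennreal_mult) auto
      finally show ?thesis using True by simp
    qed simp
  qed
  also have "\<dots> = ennreal (?c / ?k) * (\<integral>\<^sup>+s. ennreal (?k * (s ^ d * (\<psi> s)\<^sup>2)) * indicator {0..} s \<partial>lborel)"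
    by (rule nn_integral_cmult) measurable
  also have "\<dots> \<le> ennreal (?c / ?k) * (\<integral>\<^sup>+s. ennreal (2 / (real d + 1) * (s ^ (d+2) * (\<psi>' s)\<^sup>2)) * indicator {0..} s \<partial>lborel)"
    by (intro mult_left_mono order_trans[OF _ I[of 0]]) (auto intro: order_trans[OF _ I[of 0]])
  also have "\<dots> = ennreal (1 / ?k) * (ennreal ?c * (\<integral>\<^sup>+s. ennreal (2 / (real d + 1) * (s ^ (d+2) * (\<psi>' s)\<^sup>2)) * indicator {0..} s \<partial>lborel))"
  proof -
    have "ennreal (?c / ?k) = ennreal (1 / ?k) * ennreal ?c"
      using c0 by (simp add: ennreal_mult[symmetric] mult.commute)
    then show ?thesis by (simp only: mult.assoc)
  qed
  also have "\<dots> \<le> ennreal (1 / ?k) * (ennreal (2 / (real d + 1)) * G)"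
    by (intro mult_left_mono G2) auto
  also have "\<dots> = ennreal (4 / (real d + 1)\<^sup>2) * G"
    by (simp add: mult.assoc[symmetric] ennreal_mult[symmetric] power2_eq_square)
  finally show "(\<integral>\<^sup>+y. ennreal ((\<phi> y)\<^sup>2 / (norm y)\<^sup>2) \<partial>lborel)
      \<le> ennreal (4 / (real d + 1)\<^sup>2) * (\<integral>\<^sup>+y. ennreal ((norm (grad_s \<phi> y))\<^sup>2) \<partial>lborel)"
    unfolding G_def .
qed

section \<open>The generalized gradient\<close>

lemma abs_add_powr_le:
  fixes s t p :: real assumes "0 \<le> p"
  shows "\<bar>s + t\<bar> powr p \<le> 2 powr p * (\<bar>s\<bar> powr p + \<bar>t\<bar> powr p)"
proof -
  have "\<bar>s + t\<bar> powr p \<le> (2 * max \<bar>s\<bar> \<bar>t\<bar>) powr p" using assms by (intro powr_mono2) auto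
  also have "\<dots> = 2 powr p * max \<bar>s\<bar> \<bar>t\<bar> powr p" by (simp add: powr_mult)
  also have "\<dots> \<le> 2 powr p * (\<bar>s\<bar> powr p + \<bar>t\<bar> powr p)" by (intro mult_left_mono) (auto simp: max_def)
  finally show ?thesis .
qed

lemma norm_add_sq_le:
  fixes s t :: "'a::real_inner" shows "(norm (s + t))\<^sup>2 \<le> 2 * ((norm s)\<^sup>2 + (norm t)\<^sup>2)"
proof -
  have "0 \<le> (norm (s - t))\<^sup>2" by simp
  then show ?thesis by (simp add: power2_norm_eq_inner inner_add inner_diff inner_commute)
qed

text \<open>A squeeze shared by the two convergences in \<open>D12r_rel\<close>; working in
  \<open>ennreal\<close> spares any prior integrability of the errors.\<close>

lemma nn_integral_tendsto_0_lincomb: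
  fixes f g h :: "nat \<Rightarrow> 'a \<Rightarrow> real"
  assumes [measurable]: "\<And>k. f k \<in> borel_measurable M" "\<And>k. g k \<in> borel_measurable M"
    and nn: "\<And>k x. 0 \<le> f k x" "\<And>k x. 0 \<le> g k x" "0 \<le> a" "0 \<le> b"
    and le: "\<And>k x. h k x \<le> a * f k x + b * g k x"
    and lim: "(\<lambda>k. \<integral>\<^sup>+x. ennreal (f k x) \<partial>M) \<longlonglongrightarrow> 0" "(\<lambda>k. \<integral>\<^sup>+x. ennreal (g k x) \<partial>M) \<longlonglongrightarrow> 0"
  shows "(\<lambda>k. \<integral>\<^sup>+x. ennreal (h k x) \<partial>M) \<longlonglongrightarrow> 0"
proof (rule tendsto_sandwich[OF _ _ tendsto_const])
  have "(\<lambda>k. ennreal a * (\<integral>\<^sup>+x. ennreal (f k x) \<partial>M) + ennreal b * (\<integral>\<^sup>+x. ennreal (g k x) \<partial>M)) \<longlonglongrightarrow>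
     ennreal a * 0 + ennreal b * 0"
    by (intro tendsto_add ennreal_tendsto_cmult lim) auto
  then show "(\<lambda>k. ennreal a * (\<integral>\<^sup>+x. ennreal (f k x) \<partial>M) + ennreal b * (\<integral>\<^sup>+x. ennreal (g k x) \<partial>M)) \<longlonglongrightarrow> 0"
    by simp
  have "(\<integral>\<^sup>+x. ennreal (h k x) \<partial>M) \<le> ennreal a * (\<integral>\<^sup>+x. ennreal (f k x) \<partial>M) + ennreal b * (\<integral>\<^sup>+x. ennreal (g k x) \<partial>M)" for k
  proof -
    have "(\<integral>\<^sup>+x. ennreal (h k x) \<partial>M) \<le> (\<integral>\<^sup>+x. ennreal a * ennreal (f k x) + ennreal b * ennreal (g k x) \<partial>M)"
    proof (intro nn_integral_mono)
      fix x
      have "ennreal a * ennreal (f k x) + ennreal b * ennreal (g k x) = ennreal (a * f k x + b * g k x)"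
        using nn by (simp add: ennreal_mult)
      then show "ennreal (h k x) \<le> ennreal a * ennreal (f k x) + ennreal b * ennreal (g k x)"
        using ennreal_leI[OF le[of k x]] by simp
    qed
    also have "\<dots> = ennreal a * (\<integral>\<^sup>+x. ennreal (f k x) \<partial>M) + ennreal b * (\<integral>\<^sup>+x. ennreal (g k x) \<partial>M)"
      by (simp add: nn_integral_add nn_integral_cmult)
    finally show ?thesis .
  qed
  then show "\<forall>\<^sub>F k in sequentially. (\<integral>\<^sup>+x. ennreal (h k x) \<partial>M) \<le>
      ennreal a * (\<integral>\<^sup>+x. ennreal (f k x) \<partial>M) + ennreal b * (\<integral>\<^sup>+x. ennreal (g k x) \<partial>M)"
    by simp
qed auto

lemma L2_Cauchy_Schwarz:
  fixes f g :: "'a \<Rightarrow> 'b::euclidean_space"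
  assumes [measurable]: "f \<in> borel_measurable M" "g \<in> borel_measurable M"
    and f: "integrable M (\<lambda>x. (norm (f x))\<^sup>2)" and g: "integrable M (\<lambda>x. (norm (g x))\<^sup>2)"
  shows "integrable M (\<lambda>x. f x \<bullet> g x)"
    "\<bar>\<integral>x. f x \<bullet> g x \<partial>M\<bar> \<le> sqrt (\<integral>x. (norm (f x))\<^sup>2 \<partial>M) * sqrt (\<integral>x. (norm (g x))\<^sup>2 \<partial>M)"
proof -
  have b: "norm (f x \<bullet> g x) \<le> norm (f x) * norm (g x)" for x
    using Cauchy_Schwarz_ineq2 by simp
  have i: "integrable M (\<lambda>x. norm (f x) * norm (g x))"
  proof (rule Bochner_Integration.integrable_bound[OF Bochner_Integration.integrable_add[OF f g]])
    have "norm (f x) * norm (g x) \<le> (norm (f x))\<^sup>2 + (norm (g x))\<^sup>2" for x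
      using sum_squares_bound[of "norm (f x)" "norm (g x)"] mult_nonneg_nonneg[OF norm_ge_zero norm_ge_zero, of "f x" "g x"]
      by linarith
    then show "AE x in M. norm (norm (f x) * norm (g x)) \<le> norm ((norm (f x))\<^sup>2 + (norm (g x))\<^sup>2)"
      by (auto simp: abs_mult)
  qed measurable
  show I: "integrable M (\<lambda>x. f x \<bullet> g x)"
    using b by (intro Bochner_Integration.integrable_bound[OF i]) auto
  let ?F = "\<integral>x. (norm (f x))\<^sup>2 \<partial>M" and ?G = "\<integral>x. (norm (g x))\<^sup>2 \<partial>M" and ?P = "\<integral>x. norm (f x) * norm (g x) \<partial>M"
  have "(\<integral>\<^sup>+x. ennreal (norm (f x)) * ennreal (norm (g x)) \<partial>M)\<^sup>2
     \<le> (\<integral>\<^sup>+x. (ennreal (norm (f x)))\<^sup>2 \<partial>M) * (\<integral>\<^sup>+x. (ennreal (norm (g x)))\<^sup>2 \<partial>M)"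
    by (rule Cauchy_Schwarz_nn_integral) auto
  also have "(\<integral>\<^sup>+x. (ennreal (norm (f x)))\<^sup>2 \<partial>M) = ennreal ?F"
    using nn_integral_eq_integral[OF f] by (simp add: ennreal_power)
  also have "(\<integral>\<^sup>+x. (ennreal (norm (g x)))\<^sup>2 \<partial>M) = ennreal ?G"
    using nn_integral_eq_integral[OF g] by (simp add: ennreal_power)
  also have "(\<integral>\<^sup>+x. ennreal (norm (f x)) * ennreal (norm (g x)) \<partial>M) = ennreal ?P"
    using nn_integral_eq_integral[OF i] by (simp add: ennreal_mult)
  finally have "ennreal (?P\<^sup>2) \<le> ennreal (?F * ?G)" by (simp add: ennreal_power ennreal_mult')
  then have "?P\<^sup>2 \<le> ?F * ?G" by (subst (asm) ennreal_le_iff) auto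
  then have "?P \<le> sqrt (?F * ?G)" by (rule real_le_rsqrt)
  moreover have "\<bar>\<integral>x. f x \<bullet> g x \<partial>M\<bar> \<le> ?P"
  proof -
    have "norm (\<integral>x. f x \<bullet> g x \<partial>M) \<le> (\<integral>x. norm (f x \<bullet> g x) \<partial>M)" by (rule integral_norm_bound)
    also have "\<dots> \<le> ?P" using b I i by (intro integral_mono) auto
    finally show ?thesis by simp
  qed
  ultimately show "\<bar>\<integral>x. f x \<bullet> g x \<partial>M\<bar> \<le> sqrt ?F * sqrt ?G" by (simp add: real_sqrt_mult)
qed

section \<open>Linearity of the pairs (function, gradient) and uniqueness of the gradient\<close>

lemma pdiff_lincomb:
  assumes "\<And>x. \<phi> differentiable (at x)" "\<And>x. \<eta> differentiable (at x)"
  shows "pdiff i (\<lambda>x. a * \<phi> x + b * \<eta> x) = (\<lambda>x. a * pdiff i \<phi> x + b * pdiff i \<eta> x)"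
proof
  fix x
  have D: "(\<phi> has_derivative frechet_derivative \<phi> (at x)) (at x)" "(\<eta> has_derivative frechet_derivative \<eta> (at x)) (at x)"
    using assms frechet_derivative_works by blast+
  have "((\<lambda>x. a * \<phi> x + b * \<eta> x) has_derivative
     (\<lambda>v. a * frechet_derivative \<phi> (at x) v + b * frechet_derivative \<eta> (at x) v)) (at x)"
    by (rule has_derivative_add[OF has_derivative_mult_right[OF D(1)] has_derivative_mult_right[OF D(2)]])
  from frechet_derivative_at[OF this, symmetric]
  show "pdiff i (\<lambda>x. a * \<phi> x + b * \<eta> x) x = a * pdiff i \<phi> x + b * pdiff i \<eta> x"
    unfolding pdiff_def by simp
qed

lemma pdiffs_lincomb:
  assumes "smooth_fn \<phi>" "smooth_fn \<eta>"
  shows "pdiffs is (\<lambda>x. a * \<phi> x + b * \<eta> x) = (\<lambda>x. a * pdiffs is \<phi> x + b * pdiffs is \<eta> x)"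
proof (induction "is")
  case (Cons i "is")
  show ?case unfolding pdiffs.simps Cons
    by (rule pdiff_lincomb) (use assms in \<open>auto simp: smooth_fn_def\<close>)
qed simp

lemma smooth_fn_lincomb:
  assumes "smooth_fn \<phi>" "smooth_fn \<eta>"
  shows "smooth_fn (\<lambda>x. a * \<phi> x + b * \<eta> x)"
  using assms unfolding smooth_fn_def pdiffs_lincomb[OF assms] by (auto intro!: derivative_intros)

lemma grad_s_lincomb:
  assumes "smooth_fn \<phi>" "smooth_fn \<eta>"
  shows "grad_s (\<lambda>x. a * \<phi> x + b * \<eta> x) x = a *\<^sub>R grad_s \<phi> x + b *\<^sub>R grad_s \<eta> x"
proof -
  have "pdiff i (\<lambda>x. a * \<phi> x + b * \<eta> x) = (\<lambda>x. a * pdiff i \<phi> x + b * pdiff i \<eta> x)" for i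
    using pdiffs_lincomb[OF assms, of "[i]"] by simp
  then show ?thesis by (simp add: grad_s_def vec_eq_iff)
qed

lemma radial_test_lincomb:
  assumes "radial_test \<phi>" "radial_test \<eta>"
  shows "radial_test (\<lambda>x. a * \<phi> x + b * \<eta> x)"
proof -
  obtain R1 R2 where "\<And>x. R1 < norm x \<Longrightarrow> \<phi> x = 0" "\<And>x. R2 < norm x \<Longrightarrow> \<eta> x = 0"
    using assms unfolding radial_test_def by blast
  then have "\<forall>x. max R1 R2 < norm x \<longrightarrow> a * \<phi> x + b * \<eta> x = 0" by auto
  moreover have "radial_fn (\<lambda>x. a * \<phi> x + b * \<eta> x)"
    using assms unfolding radial_test_def radial_fn_def by metis
  ultimately show ?thesis
    using assms smooth_fn_lincomb unfolding radial_test_def by blast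
qed

lemma radial_test_measurable [measurable_dest]:
  assumes "radial_test \<phi>"
  shows "\<phi> \<in> borel_measurable borel" "grad_s \<phi> \<in> borel_measurable borel"
  using assms unfolding radial_test_def
  by (auto intro: borel_measurable_continuous_onI smooth_fn_continuous grad_s_continuous)

lemma D12r_rel_lincomb:
  fixes u v :: "real^'n::finite \<Rightarrow> real"
  assumes u: "D12r_rel u w" and v: "D12r_rel v z" and N: "CARD('n) \<ge> 3"
  shows "D12r_rel (\<lambda>x. a * u x + b * v x) (\<lambda>x. a *\<^sub>R w x + b *\<^sub>R z x)"
proof -
  let ?p = "2 * real CARD('n) / (real CARD('n) - 2)"
  have p: "0 \<le> ?p" using N by simp
  have [measurable]: "u \<in> borel_measurable borel" "w \<in> borel_measurable borel"
    "v \<in> borel_measurable borel" "z \<in> borel_measurable borel"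
    using u v unfolding D12r_rel_def by auto
  obtain \<phi> where \<phi>: "\<And>k::nat. radial_test (\<phi> k)"
    and \<phi>1: "(\<lambda>k. \<integral>\<^sup>+x. ennreal (\<bar>\<phi> k x - u x\<bar> powr ?p) \<partial>lborel) \<longlonglongrightarrow> 0"
    and \<phi>2: "(\<lambda>k. \<integral>\<^sup>+x. ennreal ((norm (grad_s (\<phi> k) x - w x))\<^sup>2) \<partial>lborel) \<longlonglongrightarrow> 0"
    using u unfolding D12r_rel_def by auto
  obtain \<eta> where \<eta>: "\<And>k::nat. radial_test (\<eta> k)"
    and \<eta>1: "(\<lambda>k. \<integral>\<^sup>+x. ennreal (\<bar>\<eta> k x - v x\<bar> powr ?p) \<partial>lborel) \<longlonglongrightarrow> 0"
    and \<eta>2: "(\<lambda>k. \<integral>\<^sup>+x. ennreal ((norm (grad_s (\<eta> k) x - z x))\<^sup>2) \<partial>lborel) \<longlonglongrightarrow> 0"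
    using v unfolding D12r_rel_def by auto
  note [measurable] = radial_test_measurable[OF \<phi>] radial_test_measurable[OF \<eta>]
  define \<zeta> where "\<zeta> k x = a * \<phi> k x + b * \<eta> k x" for k x
  have g: "grad_s (\<zeta> k) x = a *\<^sub>R grad_s (\<phi> k) x + b *\<^sub>R grad_s (\<eta> k) x" for k x
    unfolding \<zeta>_def using \<phi> \<eta> by (intro grad_s_lincomb) (auto simp: radial_test_def)
  have 1: "(\<lambda>k. \<integral>\<^sup>+x. ennreal (\<bar>\<zeta> k x - (a * u x + b * v x)\<bar> powr ?p) \<partial>lborel) \<longlonglongrightarrow> 0"
  proof (rule nn_integral_tendsto_0_lincomb[OF _ _ _ _ _ _ _ \<phi>1 \<eta>1])
    show "\<bar>\<zeta> k x - (a * u x + b * v x)\<bar> powr ?p \<le>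
       (2 powr ?p * \<bar>a\<bar> powr ?p) * \<bar>\<phi> k x - u x\<bar> powr ?p + (2 powr ?p * \<bar>b\<bar> powr ?p) * \<bar>\<eta> k x - v x\<bar> powr ?p" for k x
    proof -
      have "\<zeta> k x - (a * u x + b * v x) = a * (\<phi> k x - u x) + b * (\<eta> k x - v x)"
        by (simp add: \<zeta>_def algebra_simps)
      then show ?thesis
        using abs_add_powr_le[OF p, of "a * (\<phi> k x - u x)" "b * (\<eta> k x - v x)"]
        by (simp only: abs_mult powr_mult distrib_left mult.assoc)
    qed
  qed auto
  have 2: "(\<lambda>k. \<integral>\<^sup>+x. ennreal ((norm (grad_s (\<zeta> k) x - (a *\<^sub>R w x + b *\<^sub>R z x)))\<^sup>2) \<partial>lborel) \<longlonglongrightarrow> 0"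
  proof (rule nn_integral_tendsto_0_lincomb[OF _ _ _ _ _ _ _ \<phi>2 \<eta>2])
    show "(norm (grad_s (\<zeta> k) x - (a *\<^sub>R w x + b *\<^sub>R z x)))\<^sup>2 \<le>
       (2 * a\<^sup>2) * (norm (grad_s (\<phi> k) x - w x))\<^sup>2 + (2 * b\<^sup>2) * (norm (grad_s (\<eta> k) x - z x))\<^sup>2" for k x
    proof -
      have "grad_s (\<zeta> k) x - (a *\<^sub>R w x + b *\<^sub>R z x) = a *\<^sub>R (grad_s (\<phi> k) x - w x) + b *\<^sub>R (grad_s (\<eta> k) x - z x)"
        by (simp add: g algebra_simps)
      then show ?thesis
        using norm_add_sq_le[of "a *\<^sub>R (grad_s (\<phi> k) x - w x)" "b *\<^sub>R (grad_s (\<eta> k) x - z x)"]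
        by (simp add: power_mult_distrib)
    qed
  qed auto
  have "radial_test (\<zeta> k)" for k unfolding \<zeta>_def using \<phi> \<eta> by (rule radial_test_lincomb)
  then show ?thesis unfolding D12r_rel_def using 1 2 by auto
qed

lemma radial_test_grad_L2:
  assumes "radial_test \<phi>"
  shows "integrable lborel (\<lambda>x. (norm (grad_s \<phi> x))\<^sup>2)"
proof -
  obtain R where R: "smooth_fn \<phi>" "\<And>x. R < norm x \<Longrightarrow> \<phi> x = 0" using assms unfolding radial_test_def by blast
  show ?thesis
    by (rule integrable_continuous_bounded_support[where R = R])
       (use grad_s_continuous[OF R(1)] grad_s_eq_0[OF R] in \<open>auto intro!: continuous_intros\<close>)
qed

lemma D12r_rel_grad_L2:
  assumes "D12r_rel u w"
  shows "integrable lborel (\<lambda>x. (norm (w x))\<^sup>2)"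
proof -
  have [measurable]: "w \<in> borel_measurable borel" using assms unfolding D12r_rel_def by auto
  obtain \<phi> where \<phi>: "\<And>k::nat. radial_test (\<phi> k)"
    and \<phi>2: "(\<lambda>k. \<integral>\<^sup>+x. ennreal ((norm (grad_s (\<phi> k) x - w x))\<^sup>2) \<partial>lborel) \<longlonglongrightarrow> 0"
    using assms unfolding D12r_rel_def by auto
  note [measurable] = radial_test_measurable[OF \<phi>]
  have "\<forall>\<^sub>F k in sequentially. (\<integral>\<^sup>+x. ennreal ((norm (grad_s (\<phi> k) x - w x))\<^sup>2) \<partial>lborel) < 1"
    using \<phi>2 by (rule order_tendstoD(2)) simp
  then obtain k where "(\<integral>\<^sup>+x. ennreal ((norm (grad_s (\<phi> k) x - w x))\<^sup>2) \<partial>lborel) < 1"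
    using eventually_happens'[OF sequentially_bot] by blast
  then have i: "integrable lborel (\<lambda>x. (norm (grad_s (\<phi> k) x - w x))\<^sup>2)"
    by (intro integrableI_nonneg) (auto simp: less_trans[OF _ ennreal_one_less_top])
  show ?thesis
  proof (rule Bochner_Integration.integrable_bound)
    show "integrable lborel (\<lambda>x. 2 * ((norm (grad_s (\<phi> k) x - w x))\<^sup>2 + (norm (grad_s (\<phi> k) x))\<^sup>2))"
      by (intro integrable_mult_right Bochner_Integration.integrable_add i radial_test_grad_L2 \<phi>)
    have "(norm (w x))\<^sup>2 \<le> 2 * ((norm (grad_s (\<phi> k) x - w x))\<^sup>2 + (norm (grad_s (\<phi> k) x))\<^sup>2)" for x
      using norm_add_sq_le[of "w x - grad_s (\<phi> k) x" "grad_s (\<phi> k) x"] by (simp add: norm_minus_commute)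
    then show "AE x in lborel. norm ((norm (w x))\<^sup>2) \<le> norm (2 * ((norm (grad_s (\<phi> k) x - w x))\<^sup>2 + (norm (grad_s (\<phi> k) x))\<^sup>2))"
      by auto
  qed measurable
qed

text \<open>The constant may depend on \<epsilon>, because \<open>b\<close> is sent to 0 only after
  \<epsilon> has been fixed.\<close>

lemma tendsto_0_if_le_all:
  fixes x b :: "nat \<Rightarrow> real"
  assumes "\<And>\<epsilon>. 0 < \<epsilon> \<Longrightarrow> \<exists>C. \<forall>k. \<bar>x k\<bar> \<le> \<epsilon> + C * b k" and "b \<longlonglongrightarrow> 0"
  shows "x \<longlonglongrightarrow> 0"
proof (rule LIMSEQ_I)
  fix r :: real assume r: "0 < r"
  then obtain C where C: "\<And>k. \<bar>x k\<bar> \<le> r / 2 + C * b k" using assms(1)[of "r / 2"] by auto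
  have "(\<lambda>k. C * b k) \<longlonglongrightarrow> C * 0" by (intro tendsto_intros assms(2))
  then have "\<forall>\<^sub>F k in sequentially. C * b k < r / 2" using r by (intro order_tendstoD(2)) auto
  then obtain K where K: "\<And>k. K \<le> k \<Longrightarrow> C * b k < r / 2" unfolding eventually_sequentially by auto
  have "norm (x k - 0) < r" if "K \<le> k" for k
    using C[of k] K[OF that] unfolding real_norm_def diff_zero by argo
  then show "\<exists>K. \<forall>k\<ge>K. norm (x k - 0) < r" by blast
qed

text \<open>$\int |w|^2 = \lim_k \lim_j \int \nabla\varphi_j \cdot \nabla\varphi_k
  = - \lim_k \lim_j \int \varphi_j \Delta\varphi_k = 0$.\<close>
lemma D12r_rel_0_imp_grad_0:
  fixes w :: "real^'n::finite \<Rightarrow> real^'n"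
  assumes w: "D12r_rel (\<lambda>_. 0) w" and N: "CARD('n) \<ge> 3"
  shows "AE x in lborel. w x = 0"
proof -
  define p where "p = 2 * real CARD('n) / (real CARD('n) - 2)"
  have p: "1 \<le> p" using N unfolding p_def by (subst le_divide_eq) auto
  have [measurable]: "w \<in> borel_measurable borel" using w unfolding D12r_rel_def by auto
  obtain \<phi> where \<phi>: "\<And>k::nat. radial_test (\<phi> k)"
    and \<phi>1: "(\<lambda>k. \<integral>\<^sup>+x. ennreal (\<bar>\<phi> k x\<bar> powr p) \<partial>lborel) \<longlonglongrightarrow> 0"
    and \<phi>2: "(\<lambda>k. \<integral>\<^sup>+x. ennreal ((norm (grad_s (\<phi> k) x - w x))\<^sup>2) \<partial>lborel) \<longlonglongrightarrow> 0"
    using w unfolding D12r_rel_def p_def by auto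
  note [measurable] = radial_test_measurable[OF \<phi>]
  have sm: "smooth_fn (\<phi> k)" for k using \<phi> unfolding radial_test_def by blast
  have wL2: "integrable lborel (\<lambda>x. (norm (w x))\<^sup>2)" by (rule D12r_rel_grad_L2[OF w])
  note gL2 = radial_test_grad_L2[OF \<phi>]
  have dL2: "integrable lborel (\<lambda>x. (norm (grad_s (\<phi> k) x - w x))\<^sup>2)" for k
  proof (rule Bochner_Integration.integrable_bound)
    show "integrable lborel (\<lambda>x. 2 * ((norm (grad_s (\<phi> k) x))\<^sup>2 + (norm (w x))\<^sup>2))"
      by (intro integrable_mult_right Bochner_Integration.integrable_add gL2 wL2)
    show "AE x in lborel. norm ((norm (grad_s (\<phi> k) x - w x))\<^sup>2) \<le> norm (2 * ((norm (grad_s (\<phi> k) x))\<^sup>2 + (norm (w x))\<^sup>2))"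
      using norm_add_sq_le[of "grad_s (\<phi> k) _" "- w _"] by (auto intro!: AE_I2)
  qed measurable
  define a where "a k = (\<integral>x. (norm (grad_s (\<phi> k) x - w x))\<^sup>2 \<partial>lborel)" for k
  have a0: "0 \<le> a k" for k unfolding a_def by simp
  have a: "a \<longlonglongrightarrow> 0"
  proof -
    have "(\<lambda>k. ennreal (a k)) \<longlonglongrightarrow> ennreal 0"
      using \<phi>2 nn_integral_eq_integral[OF dL2] unfolding a_def by simp
    then show ?thesis using a0 by (subst (asm) tendsto_ennreal_iff) auto
  qed
  have orth: "(\<integral>x. w x \<bullet> grad_s (\<phi> k) x \<partial>lborel) = 0" for k
  proof -
    obtain R where R: "\<And>x. R < norm x \<Longrightarrow> \<phi> k x = 0" using \<phi> unfolding radial_test_def by blast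
    define L where "L x = (\<Sum>i\<in>UNIV. pdiff i (pdiff i (\<phi> k)) x)" for x
    have cL: "continuous_on UNIV L" unfolding L_def
      by (intro continuous_intros smooth_fn_continuous smooth_fn_pdiff sm)
    have L0: "L x = 0" if "R < norm x" for x
      unfolding L_def using that by (intro sum.neutral ballI pdiff_eq_0[OF smooth_fn_pdiff[OF sm]] pdiff_eq_0[OF sm R]) auto
    obtain B where B: "0 \<le> B" "\<And>x. \<bar>L x\<bar> \<le> B" using bounded_continuous_bounded_support[OF cL L0] by blast
    have [measurable]: "L \<in> borel_measurable borel" using cL by (rule borel_measurable_continuous_onI)
    have int_p: "integrable lborel (\<lambda>x. \<bar>\<phi> j x\<bar> powr p)" for j
    proof -
      obtain R' where R': "\<And>x. R' < norm x \<Longrightarrow> \<phi> j x = 0" using \<phi> unfolding radial_test_def by blast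
      show ?thesis
      proof (rule integrable_continuous_bounded_support[where R = R'])
        show "continuous_on UNIV (\<lambda>x. \<bar>\<phi> j x\<bar> powr p)"
          using p by (intro continuous_on_powr' continuous_on_rabs continuous_on_const smooth_fn_continuous sm) auto
      qed (use p R' in auto)
    qed
    define b where "b j = (\<integral>x. \<bar>\<phi> j x\<bar> powr p \<partial>lborel)" for j
    have b0: "0 \<le> b j" for j unfolding b_def by simp
    have b: "b \<longlonglongrightarrow> 0"
    proof -
      have "(\<lambda>k. ennreal (b k)) \<longlonglongrightarrow> ennreal 0"
        using \<phi>1 nn_integral_eq_integral[OF int_p] unfolding b_def by simp
      then show ?thesis using b0 by (subst (asm) tendsto_ennreal_iff) auto
    qed
    define \<Omega> where "\<Omega> = cball (0::real^'n) R"
    have iO: "integrable lborel (indicator \<Omega> :: _ \<Rightarrow> real)"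
      unfolding \<Omega>_def using emeasure_lborel_cball_finite[of "0::real^'n" R]
      by (intro integrable_real_indicator) (auto simp: less_top)
    define m where "m = (\<integral>x. indicator \<Omega> x \<partial>lborel :: real)"
    have m0: "0 \<le> m" unfolding m_def by simp
    have lim1: "(\<lambda>j. \<integral>x. \<phi> j x * L x \<partial>lborel) \<longlonglongrightarrow> 0"
    proof (rule tendsto_0_if_le_all[OF _ b])
      fix \<epsilon> :: real assume "0 < \<epsilon>"
      \<comment> \<open>The summand 1 in the denominator covers the case B m = 0.\<close>
      define t where "t = \<epsilon> / (B * m + 1)"
      have Bm: "0 < B * m + 1" using B m0 by (simp add: add_nonneg_pos)
      have t: "0 < t" "B * t * m \<le> \<epsilon>" using Bm \<open>0 < \<epsilon>\<close>
        by (auto simp: t_def divide_simps) 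
      have "\<bar>\<integral>x. \<phi> j x * L x \<partial>lborel\<bar> \<le> \<epsilon> + B * t powr (1 - p) * b j" for j
      proof -
        have pt: "\<bar>\<phi> j x * L x\<bar> \<le> B * t * indicator \<Omega> x + B * t powr (1 - p) * \<bar>\<phi> j x\<bar> powr p" for x
        proof (cases "R < norm x")
          case True then show ?thesis using L0 B t by simp
        next
          case False
          \<comment> \<open>Truncation at height t: where |\<phi>| exceeds t, the factor (|\<phi>| /
            t)^(p-1) is at least 1. This replaces Hoelder's inequality on the bounded support of
            L.\<close>
          have "\<bar>\<phi> j x\<bar> \<le> t + t powr (1 - p) * \<bar>\<phi> j x\<bar> powr p"
          proof (cases "\<bar>\<phi> j x\<bar> \<le> t")
            case True then show ?thesis by (simp add: add_increasing2)
          next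
            case False
            have "\<bar>\<phi> j x\<bar> = \<bar>\<phi> j x\<bar> powr (1 - p) * \<bar>\<phi> j x\<bar> powr p"
              using False t by (simp add: powr_add[symmetric])
            also have "\<dots> \<le> t powr (1 - p) * \<bar>\<phi> j x\<bar> powr p"
              using False t p by (intro mult_right_mono powr_mono2') auto
            finally show ?thesis using t by simp
          qed
          then have "\<bar>\<phi> j x\<bar> * \<bar>L x\<bar> \<le> (t + t powr (1 - p) * \<bar>\<phi> j x\<bar> powr p) * B"
            using B by (intro mult_mono) auto
          then show ?thesis using False by (simp add: \<Omega>_def abs_mult algebra_simps)
        qed
        have ir: "integrable lborel (\<lambda>x. B * t * indicator \<Omega> x + B * t powr (1 - p) * \<bar>\<phi> j x\<bar> powr p)"
          by (intro Bochner_Integration.integrable_add integrable_mult_right iO int_p)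
        have "\<bar>\<integral>x. \<phi> j x * L x \<partial>lborel\<bar> \<le> (\<integral>x. norm (\<phi> j x * L x) \<partial>lborel)"
          using integral_norm_bound[of lborel "\<lambda>x. \<phi> j x * L x"] by simp
        also have "\<dots> \<le> (\<integral>x. B * t * indicator \<Omega> x + B * t powr (1 - p) * \<bar>\<phi> j x\<bar> powr p \<partial>lborel)"
        proof (rule integral_mono[OF _ ir])
          show "integrable lborel (\<lambda>x. norm (\<phi> j x * L x))"
            by (rule Bochner_Integration.integrable_bound[OF ir]) (use pt in \<open>auto intro!: AE_I2 order_trans[OF pt]\<close>)
        qed (use pt in auto)
        also have "\<dots> = B * t * m + B * t powr (1 - p) * b j"
          unfolding m_def b_def
          by (subst Bochner_Integration.integral_add) (auto intro!: integrable_mult_right iO int_p)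
        finally show ?thesis using t by linarith
      qed
      then show "\<exists>C. \<forall>j. \<bar>\<integral>x. \<phi> j x * L x \<partial>lborel\<bar> \<le> \<epsilon> + C * b j" by blast
    qed
    have Gr: "(\<integral>x. grad_s (\<phi> j) x \<bullet> grad_s (\<phi> k) x \<partial>lborel) = - (\<integral>x. \<phi> j x * L x \<partial>lborel)" for j
    proof -
      obtain R' where R': "\<And>x. R' < norm x \<Longrightarrow> \<phi> j x = 0" using \<phi> unfolding radial_test_def by blast
      show ?thesis unfolding L_def by (rule Green_identity[OF sm sm R'])
    qed
    have lim2: "(\<lambda>j. \<integral>x. grad_s (\<phi> j) x \<bullet> grad_s (\<phi> k) x \<partial>lborel) \<longlonglongrightarrow> 0"
      unfolding Gr using tendsto_minus[OF lim1] by simp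
    have lim3: "(\<lambda>j. \<integral>x. (grad_s (\<phi> j) x - w x) \<bullet> grad_s (\<phi> k) x \<partial>lborel) \<longlonglongrightarrow> 0"
    proof (rule Lim_null_comparison)
      show "\<forall>\<^sub>F j in sequentially. norm (\<integral>x. (grad_s (\<phi> j) x - w x) \<bullet> grad_s (\<phi> k) x \<partial>lborel)
          \<le> sqrt (a j) * sqrt (\<integral>x. (norm (grad_s (\<phi> k) x))\<^sup>2 \<partial>lborel)"
        using L2_Cauchy_Schwarz(2)[OF _ _ dL2 gL2] unfolding a_def by (intro always_eventually) auto
      have "(\<lambda>j. sqrt (a j) * sqrt (\<integral>x. (norm (grad_s (\<phi> k) x))\<^sup>2 \<partial>lborel)) \<longlonglongrightarrow> sqrt 0 * sqrt (\<integral>x. (norm (grad_s (\<phi> k) x))\<^sup>2 \<partial>lborel)"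
        by (intro tendsto_intros a)
      then show "(\<lambda>j. sqrt (a j) * sqrt (\<integral>x. (norm (grad_s (\<phi> k) x))\<^sup>2 \<partial>lborel)) \<longlonglongrightarrow> 0" by simp
    qed
    have "(\<lambda>j. (\<integral>x. grad_s (\<phi> j) x \<bullet> grad_s (\<phi> k) x \<partial>lborel) - (\<integral>x. (grad_s (\<phi> j) x - w x) \<bullet> grad_s (\<phi> k) x \<partial>lborel)) \<longlonglongrightarrow> 0 - 0"
      by (intro tendsto_diff lim2 lim3)
    moreover have "(\<integral>x. grad_s (\<phi> j) x \<bullet> grad_s (\<phi> k) x \<partial>lborel) - (\<integral>x. (grad_s (\<phi> j) x - w x) \<bullet> grad_s (\<phi> k) x \<partial>lborel)
        = (\<integral>x. w x \<bullet> grad_s (\<phi> k) x \<partial>lborel)" for j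
      using L2_Cauchy_Schwarz(1)[OF _ _ dL2 gL2] L2_Cauchy_Schwarz(1)[OF _ _ gL2 gL2]
      by (subst Bochner_Integration.integral_diff[symmetric]) (auto simp: inner_diff_left)
    ultimately have "(\<lambda>j::nat. \<integral>x. w x \<bullet> grad_s (\<phi> k) x \<partial>lborel) \<longlonglongrightarrow> 0" by simp
    then show ?thesis using LIMSEQ_unique tendsto_const by blast
  qed
  \<comment> \<open>Orthogonality of w to the gradient of \<open>\<phi> k\<close> removes the mixed
    term from the expanded square, so a k is the sum of two energies, one of which is that of
    w.\<close>
  have "(\<integral>x. (norm (w x))\<^sup>2 \<partial>lborel) \<le> a k" for k
  proof -
    have "(norm (grad_s (\<phi> k) x - w x))\<^sup>2 = (norm (grad_s (\<phi> k) x))\<^sup>2 + (norm (w x))\<^sup>2 - 2 * (w x \<bullet> grad_s (\<phi> k) x)" for x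
      by (simp add: power2_norm_eq_inner inner_diff inner_commute)
    then have "a k = (\<integral>x. (norm (grad_s (\<phi> k) x))\<^sup>2 + (norm (w x))\<^sup>2 - 2 * (w x \<bullet> grad_s (\<phi> k) x) \<partial>lborel)"
      unfolding a_def by simp
    also have "\<dots> = (\<integral>x. (norm (grad_s (\<phi> k) x))\<^sup>2 \<partial>lborel) + (\<integral>x. (norm (w x))\<^sup>2 \<partial>lborel) - 2 * (\<integral>x. w x \<bullet> grad_s (\<phi> k) x \<partial>lborel)"
      using gL2 wL2 L2_Cauchy_Schwarz(1)[OF _ _ wL2 gL2] by simp
    finally show ?thesis using orth by simp
  qed
  then have "(\<integral>x. (norm (w x))\<^sup>2 \<partial>lborel) \<le> 0" using a by (meson LIMSEQ_le_const)
  then have "(\<integral>x. (norm (w x))\<^sup>2 \<partial>lborel) = 0" by (simp add: order_antisym)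
  then have "AE x in lborel. (norm (w x))\<^sup>2 = 0" using wL2 by (subst (asm) integral_nonneg_eq_0_iff_AE) auto
  then show ?thesis by simp
qed

text \<open>The difference of two candidate gradients belongs to the zero function. Since
  \<open>dgrad\<close> is selected by Hilbert choice, this is what links the gradients chosen for u,
  for v and for their combinations.\<close>

lemma D12r_rel_unique:
  fixes u :: "real^'n::finite \<Rightarrow> real"
  assumes "D12r_rel u w" "D12r_rel u z" and N: "CARD('n) \<ge> 3"
  shows "AE x in lborel. w x = z x"
proof -
  have "D12r_rel (\<lambda>_. 0) (\<lambda>x. w x - z x)"
    using D12r_rel_lincomb[OF assms, of 1 "-1"] by simp
  then have "AE x in lborel. w x - z x = 0" using N by (rule D12r_rel_0_imp_grad_0)
  then show ?thesis by simp
qed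

lemma D12r_rel_dgrad: "u \<in> D12r \<Longrightarrow> D12r_rel u (dgrad u)"
  unfolding D12r_def dgrad_def using someI_ex[of "D12r_rel u"] by simp

lemma dgrad_lincomb:
  fixes u v :: "real^'n::finite \<Rightarrow> real"
  assumes "u \<in> D12r" "v \<in> D12r" and N: "CARD('n) \<ge> 3"
  shows "(\<lambda>x. a * u x + b * v x) \<in> D12r"
    "AE x in lborel. dgrad (\<lambda>x. a * u x + b * v x) x = a *\<^sub>R dgrad u x + b *\<^sub>R dgrad v x"
proof -
  have r: "D12r_rel (\<lambda>x. a * u x + b * v x) (\<lambda>x. a *\<^sub>R dgrad u x + b *\<^sub>R dgrad v x)"
    using assms by (intro D12r_rel_lincomb D12r_rel_dgrad)
  then show i: "(\<lambda>x. a * u x + b * v x) \<in> D12r" unfolding D12r_def by blast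
  show "AE x in lborel. dgrad (\<lambda>x. a * u x + b * v x) x = a *\<^sub>R dgrad u x + b *\<^sub>R dgrad v x"
    by (rule D12r_rel_unique[OF D12r_rel_dgrad[OF i] r N])
qed

section \<open>Embedding of the energy space\<close>

lemma fsol_measurable [measurable]: "fsol \<in> borel_measurable borel" "fsol' \<in> borel_measurable borel"
  by (auto intro!: borel_measurable_continuous_onI continuous_intros)

text \<open>The functions |f|^p tend to 0 in L1, so a subsequence does so almost everywhere, and the
  p-th root preserves this.\<close>

lemma AE_subseq_tendsto_0_if_powr:
  fixes f :: "nat \<Rightarrow> 'a \<Rightarrow> real"
  assumes [measurable]: "\<And>k. f k \<in> borel_measurable M" and p: "0 < p"
    and lim: "(\<lambda>k. \<integral>\<^sup>+x. ennreal (\<bar>f k x\<bar> powr p) \<partial>M) \<longlonglongrightarrow> 0"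
  obtains r :: "nat \<Rightarrow> nat" where "strict_mono r" "AE x in M. (\<lambda>n. f (r n) x) \<longlonglongrightarrow> 0"
proof -
  have "\<forall>\<^sub>F k in sequentially. (\<integral>\<^sup>+x. ennreal (\<bar>f k x\<bar> powr p) \<partial>M) < 1"
    using lim by (rule order_tendstoD(2)) simp
  then obtain K where K: "\<And>k. K \<le> k \<Longrightarrow> (\<integral>\<^sup>+x. ennreal (\<bar>f k x\<bar> powr p) \<partial>M) < 1"
    unfolding eventually_sequentially by auto
  \<comment> \<open>The first K terms, whose integrals may be infinite, are discarded: the L1
    argument needs integrable functions.\<close>
  define h where "h k x = \<bar>f (k + K) x\<bar> powr p" for k x
  have h0: "0 \<le> h k x" for k x by (simp add: h_def)
  have int: "integrable M (h k)" for k
    unfolding h_def using less_trans[OF K[of "k + K"] ennreal_one_less_top]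
    by (intro integrableI_nonneg) auto
  have "(\<integral>\<^sup>+x. ennreal (\<bar>f (k + K) x\<bar> powr p) \<partial>M) = ennreal (\<integral>x. h k x \<partial>M)" for k
    using nn_integral_eq_integral[OF int[of k]] unfolding h_def by simp
  then have "(\<lambda>k. ennreal (\<integral>x. h k x \<partial>M)) \<longlonglongrightarrow> ennreal 0"
    using LIMSEQ_ignore_initial_segment[OF lim, of K] by simp
  then have "(\<lambda>k. \<integral>x. h k x \<partial>M) \<longlonglongrightarrow> 0"
    using h0 by (subst (asm) tendsto_ennreal_iff) auto
  moreover have "norm (h k x) = h k x" for k x using h0 by simp
  ultimately have "(\<lambda>k. \<integral>x. norm (h k x) \<partial>M) \<longlonglongrightarrow> 0" by simp
  from tendsto_L1_AE_subseq[OF int this]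
  obtain r where r: "strict_mono r" "AE x in M. (\<lambda>n. h (r n) x) \<longlonglongrightarrow> 0" by blast
  have "AE x in M. (\<lambda>n. f (r n + K) x) \<longlonglongrightarrow> 0"
    using r(2)
  proof eventually_elim
    case (elim x)
    have "(\<lambda>n. h (r n) x powr (1 / p)) \<longlonglongrightarrow> 0"
      using p by (intro tendsto_zero_powrI[OF elim tendsto_const]) (auto simp: h_def)
    then have "(\<lambda>n. \<bar>f (r n + K) x\<bar>) \<longlonglongrightarrow> 0" using p by (simp add: h_def powr_powr)
    then show ?case by (rule tendsto_rabs_zero_cancel)
  qed
  moreover have "strict_mono (\<lambda>n. r n + K)" using r(1) by (simp add: strict_mono_def)
  ultimately show thesis by (rule that[rotated])
qed

section \<open>Decay and Hardy's inequality on \<open>D12r\<close>\<close>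

lemma norm12_nonneg: "0 \<le> norm12 u"
  by (simp add: norm12_def)

lemma dgrad_measurable: "u \<in> D12r \<Longrightarrow> dgrad u \<in> borel_measurable borel"
  using D12r_rel_dgrad unfolding D12r_rel_def by auto

lemma D12r_measurable: "u \<in> D12r \<Longrightarrow> u \<in> borel_measurable borel"
  using D12r_rel_dgrad unfolding D12r_rel_def by auto

lemma dgrad_L2: "u \<in> D12r \<Longrightarrow> integrable lborel (\<lambda>x. (norm (dgrad u x))\<^sup>2)"
  using D12r_rel_dgrad D12r_rel_grad_L2 by blast

lemma norm12_sq: "(norm12 u)\<^sup>2 = (\<integral>x. (norm (dgrad u x))\<^sup>2 \<partial>lborel)"
  by (simp add: norm12_def)

lemma nn_integral_dgrad: "u \<in> D12r \<Longrightarrow> (\<integral>\<^sup>+x. ennreal ((norm (dgrad u x))\<^sup>2) \<partial>lborel) = ennreal ((norm12 u)\<^sup>2)"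
  using nn_integral_eq_integral[OF dgrad_L2] by (simp add: norm12_sq)

text \<open>The inequality for the square of a sum costs a factor 2, so the energies are only
  dominated by a sequence tending to twice the energy of u. The price is in the constants below,
  which are twice those for test functions.\<close>

lemma D12r_approximation:
  fixes u :: "real^'n::finite \<Rightarrow> real"
  assumes u: "u \<in> D12r" and N: "CARD('n) \<ge> 3"
  obtains \<phi> e where "\<And>k::nat. radial_test (\<phi> k)" "AE x in lborel. (\<lambda>k. \<phi> k x) \<longlonglongrightarrow> u x"
    "\<And>k. (\<integral>\<^sup>+x. ennreal ((norm (grad_s (\<phi> k) x))\<^sup>2) \<partial>lborel) \<le> e k" "e \<longlonglongrightarrow> ennreal (2 * (norm12 u)\<^sup>2)"
proof -
  let ?p = "2 * real CARD('n) / (real CARD('n) - 2)"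
  have p: "0 < ?p" using N by simp
  note [measurable] = dgrad_measurable[OF u] D12r_measurable[OF u]
  obtain \<phi> where \<phi>: "\<And>k::nat. radial_test (\<phi> k)"
    and \<phi>1: "(\<lambda>k. \<integral>\<^sup>+x. ennreal (\<bar>\<phi> k x - u x\<bar> powr ?p) \<partial>lborel) \<longlonglongrightarrow> 0"
    and \<phi>2: "(\<lambda>k. \<integral>\<^sup>+x. ennreal ((norm (grad_s (\<phi> k) x - dgrad u x))\<^sup>2) \<partial>lborel) \<longlonglongrightarrow> 0"
    using D12r_rel_dgrad[OF u] unfolding D12r_rel_def by auto
  note [measurable] = radial_test_measurable[OF \<phi>]
  obtain r where r: "strict_mono r" "AE x in lborel. (\<lambda>n. \<phi> (r n) x - u x) \<longlonglongrightarrow> 0"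
    using AE_subseq_tendsto_0_if_powr[OF _ p \<phi>1] by auto
  define E where "E k = (\<integral>\<^sup>+x. ennreal ((norm (grad_s (\<phi> k) x - dgrad u x))\<^sup>2) \<partial>lborel)" for k
  have E: "(\<lambda>k. E (r k)) \<longlonglongrightarrow> 0"
    using LIMSEQ_subseq_LIMSEQ[OF \<phi>2 r(1)] by (simp add: E_def o_def)
  show thesis
  proof (rule that[of "\<lambda>k. \<phi> (r k)" "\<lambda>k. 2 * E (r k) + ennreal (2 * (norm12 u)\<^sup>2)"])
    show "AE x in lborel. (\<lambda>k. \<phi> (r k) x) \<longlonglongrightarrow> u x" using r(2) by (simp add: LIM_zero_iff)
    have "(\<lambda>k. 2 * E (r k) + ennreal (2 * (norm12 u)\<^sup>2)) \<longlonglongrightarrow> 2 * 0 + ennreal (2 * (norm12 u)\<^sup>2)"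
      by (intro tendsto_add ennreal_tendsto_cmult E tendsto_const) simp
    then show "(\<lambda>k. 2 * E (r k) + ennreal (2 * (norm12 u)\<^sup>2)) \<longlonglongrightarrow> ennreal (2 * (norm12 u)\<^sup>2)" by simp
    fix k
    have "(\<integral>\<^sup>+x. ennreal ((norm (grad_s (\<phi> (r k)) x))\<^sup>2) \<partial>lborel)
      \<le> (\<integral>\<^sup>+x. 2 * ennreal ((norm (grad_s (\<phi> (r k)) x - dgrad u x))\<^sup>2) + 2 * ennreal ((norm (dgrad u x))\<^sup>2) \<partial>lborel)"
    proof (intro nn_integral_mono)
      fix x
      have "(norm (grad_s (\<phi> (r k)) x))\<^sup>2 \<le> 2 * (norm (grad_s (\<phi> (r k)) x - dgrad u x))\<^sup>2 + 2 * (norm (dgrad u x))\<^sup>2"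
        using norm_add_sq_le[of "grad_s (\<phi> (r k)) x - dgrad u x" "dgrad u x"] by simp
      from ennreal_leI[OF this]
      show "ennreal ((norm (grad_s (\<phi> (r k)) x))\<^sup>2)
         \<le> 2 * ennreal ((norm (grad_s (\<phi> (r k)) x - dgrad u x))\<^sup>2) + 2 * ennreal ((norm (dgrad u x))\<^sup>2)"
        by (simp add: ennreal_mult)
    qed
    also have "\<dots> = 2 * E (r k) + 2 * ennreal ((norm12 u)\<^sup>2)"
      by (simp add: nn_integral_add nn_integral_cmult E_def nn_integral_dgrad[OF u])
    finally show "(\<integral>\<^sup>+x. ennreal ((norm (grad_s (\<phi> (r k)) x))\<^sup>2) \<partial>lborel) \<le> 2 * E (r k) + ennreal (2 * (norm12 u)\<^sup>2)"
      by (simp add: ennreal_mult)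
  qed (use \<phi> in auto)
qed

lemma D12r_pointwise_bound:
  fixes u :: "real^'n::finite \<Rightarrow> real"
  assumes u: "u \<in> D12r" and n: "CARD('n) = d + 3"
  shows "AE x in lborel. sphere_area TYPE(real^'n) * norm x ^ (d+1) * (u x)\<^sup>2 \<le> 4 / (real d + 1) * (norm12 u)\<^sup>2"
proof -
  let ?c = "sphere_area TYPE(real^'n)"
  have N: "CARD('n) \<ge> 3" using n by simp
  obtain \<phi> e where \<phi>: "\<And>k::nat. radial_test (\<phi> k)" and lim: "AE x in lborel. (\<lambda>k. \<phi> k x) \<longlonglongrightarrow> u x"
    and le: "\<And>k. (\<integral>\<^sup>+x. ennreal ((norm (grad_s (\<phi> k) x))\<^sup>2) \<partial>lborel) \<le> e k" and e: "e \<longlonglongrightarrow> ennreal (2 * (norm12 u)\<^sup>2)"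
    using D12r_approximation[OF u N] by blast
  have "AE x in lborel. x \<noteq> (0::real^'n)" using AE_lborel_singleton .
  then show ?thesis using lim
  proof eventually_elim
    case (elim x)
    have "ennreal (?c * norm x ^ (d+1) * (u x)\<^sup>2) \<le> ennreal (2 / (real d + 1)) * ennreal (2 * (norm12 u)\<^sup>2)"
    proof (rule LIMSEQ_le)
      show "(\<lambda>k. ennreal (?c * norm x ^ (d+1) * (\<phi> k x)\<^sup>2)) \<longlonglongrightarrow> ennreal (?c * norm x ^ (d+1) * (u x)\<^sup>2)"
        by (intro tendsto_ennrealI tendsto_intros elim)
      show "(\<lambda>k. ennreal (2 / (real d + 1)) * e k) \<longlonglongrightarrow> ennreal (2 / (real d + 1)) * ennreal (2 * (norm12 u)\<^sup>2)"
        by (intro ennreal_tendsto_cmult e) auto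
      show "\<exists>N. \<forall>k\<ge>N. ennreal (?c * norm x ^ (d+1) * (\<phi> k x)\<^sup>2) \<le> ennreal (2 / (real d + 1)) * e k"
        using radial_test_pointwise[OF \<phi> n] elim le by (meson mult_left_mono order_trans zero_le)
    qed
    also have "\<dots> = ennreal (4 / (real d + 1) * (norm12 u)\<^sup>2)" by (simp add: ennreal_mult[symmetric])
    finally show ?case by (subst (asm) ennreal_le_iff) auto
  qed
qed

text \<open>Only almost everywhere convergence of the approximants is at hand, so the left-hand side
  is passed to the limit by Fatou's lemma.\<close>

lemma D12r_Hardy:
  fixes u :: "real^'n::finite \<Rightarrow> real"
  assumes u: "u \<in> D12r" and n: "CARD('n) = d + 3"
  shows "(\<integral>\<^sup>+x. ennreal ((u x)\<^sup>2 / (norm x)\<^sup>2) \<partial>lborel) \<le> ennreal (8 / (real d + 1)\<^sup>2 * (norm12 u)\<^sup>2)"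
proof -
  have N: "CARD('n) \<ge> 3" using n by simp
  note [measurable] = D12r_measurable[OF u]
  obtain \<phi> e where \<phi>: "\<And>k::nat. radial_test (\<phi> k)" and lim: "AE x in lborel. (\<lambda>k. \<phi> k x) \<longlonglongrightarrow> u x"
    and le: "\<And>k. (\<integral>\<^sup>+x. ennreal ((norm (grad_s (\<phi> k) x))\<^sup>2) \<partial>lborel) \<le> e k" and e: "e \<longlonglongrightarrow> ennreal (2 * (norm12 u)\<^sup>2)"
    using D12r_approximation[OF u N] by blast
  note [measurable] = radial_test_measurable[OF \<phi>]
  let ?C = "4 / (real d + 1)\<^sup>2"
  have "(\<integral>\<^sup>+x. ennreal ((u x)\<^sup>2 / (norm x)\<^sup>2) \<partial>lborel) = (\<integral>\<^sup>+x. liminf (\<lambda>k. ennreal ((\<phi> k x)\<^sup>2 / (norm x)\<^sup>2)) \<partial>lborel)"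
  proof (rule nn_integral_cong_AE)
    show "AE x in lborel. ennreal ((u x)\<^sup>2 / (norm x)\<^sup>2) = liminf (\<lambda>k. ennreal ((\<phi> k x)\<^sup>2 / (norm x)\<^sup>2))"
      using lim AE_lborel_singleton[of "0::real^'n"]
    proof eventually_elim
      case (elim x)
      have "(\<lambda>k. ennreal ((\<phi> k x)\<^sup>2 / (norm x)\<^sup>2)) \<longlonglongrightarrow> ennreal ((u x)\<^sup>2 / (norm x)\<^sup>2)"
        using elim by (intro tendsto_ennrealI tendsto_intros) auto
      then show ?case using lim_imp_Liminf[OF sequentially_bot] by metis
    qed
  qed
  also have "\<dots> \<le> liminf (\<lambda>k. \<integral>\<^sup>+x. ennreal ((\<phi> k x)\<^sup>2 / (norm x)\<^sup>2) \<partial>lborel)"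
    by (intro nn_integral_liminf) measurable
  also have "\<dots> \<le> liminf (\<lambda>k. ennreal ?C * e k)"
    using radial_test_Hardy[OF \<phi> n] le
    by (intro Liminf_mono always_eventually allI) (meson mult_left_mono order_trans zero_le)
  also have "\<dots> = ennreal ?C * ennreal (2 * (norm12 u)\<^sup>2)"
    by (intro lim_imp_Liminf[OF sequentially_bot] ennreal_tendsto_cmult e) auto
  also have "\<dots> = ennreal (8 / (real d + 1)\<^sup>2 * (norm12 u)\<^sup>2)" by (simp add: ennreal_mult[symmetric])
  finally show ?thesis .
qed

text \<open>Continuity is known on the open half-line only; the arbitrary value at the origin is put
  back as a separate measurable piece.\<close>

lemma measurable_radial_weight:
  fixes W :: "real \<Rightarrow> real"
  assumes "continuous_on {0<..} W"
  shows "(\<lambda>x::'a::euclidean_space. W (norm x)) \<in> borel_measurable borel"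
proof -
  have [measurable]: "(\<lambda>r. indicator {0<..} r *\<^sub>R W r) \<in> borel_measurable borel"
    using assms by (intro borel_measurable_continuous_on_indicator) auto
  have "(\<lambda>x::'a. indicator {0<..} (norm x) *\<^sub>R W (norm x) + indicator {0} x * W 0) \<in> borel_measurable borel"
    by measurable
  also have "(\<lambda>x::'a. indicator {0<..} (norm x) *\<^sub>R W (norm x) + indicator {0} x * W 0) = (\<lambda>x. W (norm x))"
    by (auto simp: indicator_def)
  finally show ?thesis .
qed

lemma AE_norm_pos: "AE x in lborel. 0 < norm (x::'a::euclidean_space)"
  using AE_lborel_singleton[of "0::'a"] by eventually_elim simp

lemma AE_radial_weight_nonneg:
  assumes "\<forall>r>0. 0 \<le> W r"
  shows "AE x in lborel. 0 \<le> W (norm (x::'a::euclidean_space))"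
  using AE_norm_pos by eventually_elim (use assms in auto)

definition wbound :: "(real \<Rightarrow> real) \<Rightarrow> real \<Rightarrow> (real^'n::finite \<Rightarrow> real) \<Rightarrow> bool" where
  "wbound V A u \<longleftrightarrow> 0 \<le> A \<and> u \<in> borel_measurable borel \<and>
     (AE x in lborel. \<bar>u x\<bar> \<le> A * norm x powr (- ((real CARD('n) - 2) / 2))) \<and>
     (\<integral>\<^sup>+x. ennreal (V (norm x) * (u x)\<^sup>2) \<partial>lborel) \<le> ennreal (A\<^sup>2)"

context
  fixes V :: "real \<Rightarrow> real" and dom :: "'n::finite itself"
  assumes N3: "CARD('n) \<ge> 3" and V_cont: "continuous_on {0<..} V" and V_nonneg: "\<forall>r>0. V r \<ge> 0"
begin

lemma V_measurable [measurable]: "(\<lambda>x::real^'n. V (norm x)) \<in> borel_measurable borel"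
  by (rule measurable_radial_weight[OF V_cont])

lemma Espace_D12r: "u \<in> Espace V \<Longrightarrow> u \<in> D12r"
  by (simp add: Espace_def)

lemma Espace_integrable:
  fixes u :: "real^'n \<Rightarrow> real"
  assumes "u \<in> Espace V"
  shows "integrable lborel (\<lambda>x. V (norm x) * (fsol (c * u x))\<^sup>2)"
proof -
  note [measurable] = D12r_measurable[OF Espace_D12r[OF assms]]
  have i: "integrable lborel (\<lambda>x. V (norm x) * (fsol (u x))\<^sup>2)"
    using AE_radial_weight_nonneg[OF V_nonneg] assms by (intro integrableI_nonneg) (auto simp: Espace_def)
  show ?thesis
  proof (rule Bochner_Integration.integrable_bound[OF integrable_mult_right[OF i, of "(max 1 \<bar>c\<bar>)\<^sup>2"]])
    show "AE x in lborel. norm (V (norm x) * (fsol (c * u x))\<^sup>2) \<le> norm ((max 1 \<bar>c\<bar>)\<^sup>2 * (V (norm x) * (fsol (u x))\<^sup>2))"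
      using AE_radial_weight_nonneg[OF V_nonneg]
    proof eventually_elim
      case (elim x)
      have "V (norm x) * (fsol (c * u x))\<^sup>2 \<le> V (norm x) * ((max 1 \<bar>c\<bar>)\<^sup>2 * (fsol (u x))\<^sup>2)"
        using fsol_mult_bound elim by (intro mult_left_mono) auto
      then show ?case using elim by (simp add: abs_mult mult_ac)
    qed
  qed measurable
qed

text \<open>The inequality f^2(s + t) <= 4 (f^2(s) + f^2(t)) makes E a vector space although its
  modular is not homogeneous.\<close>

lemma Espace_lincomb:
  fixes u v :: "real^'n \<Rightarrow> real"
  assumes u: "u \<in> Espace V" and v: "v \<in> Espace V"
  shows "(\<lambda>x. a * u x + b * v x) \<in> Espace V"
proof -
  note D = Espace_D12r[OF u] Espace_D12r[OF v]
  note [measurable] = D12r_measurable[OF D(1)] D12r_measurable[OF D(2)]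
  have "integrable lborel (\<lambda>x. V (norm x) * (fsol (a * u x + b * v x))\<^sup>2)"
  proof (rule Bochner_Integration.integrable_bound)
    show "integrable lborel (\<lambda>x. 4 * (V (norm x) * (fsol (a * u x))\<^sup>2 + V (norm x) * (fsol (b * v x))\<^sup>2))"
      by (intro integrable_mult_right Bochner_Integration.integrable_add Espace_integrable u v)
    show "AE x in lborel. norm (V (norm x) * (fsol (a * u x + b * v x))\<^sup>2)
        \<le> norm (4 * (V (norm x) * (fsol (a * u x))\<^sup>2 + V (norm x) * (fsol (b * v x))\<^sup>2))"
      using AE_radial_weight_nonneg[OF V_nonneg]
    proof eventually_elim
      case (elim x)
      have "V (norm x) * (fsol (a * u x + b * v x))\<^sup>2 \<le> V (norm x) * (4 * ((fsol (a * u x))\<^sup>2 + (fsol (b * v x))\<^sup>2))"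
        using fsol_sq_add elim by (intro mult_left_mono) auto
      then show ?case using elim by (simp add: abs_mult algebra_simps)
    qed
  qed measurable
  then have "(\<integral>\<^sup>+x. ennreal (norm (V (norm x) * (fsol (a * u x + b * v x))\<^sup>2)) \<partial>lborel) < \<infinity>"
    by (simp add: integrable_iff_bounded)
  moreover have "(\<integral>\<^sup>+x. ennreal (V (norm x) * (fsol (a * u x + b * v x))\<^sup>2) \<partial>lborel)
     \<le> (\<integral>\<^sup>+x. ennreal (norm (V (norm x) * (fsol (a * u x + b * v x))\<^sup>2)) \<partial>lborel)"
    by (intro nn_integral_mono ennreal_leI) auto
  ultimately show ?thesis
    using dgrad_lincomb(1)[OF D N3] unfolding Espace_def by auto
qed

lemma normo_nonneg:
  fixes u :: "real^'n \<Rightarrow> real"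
  shows "0 \<le> normo V u"
  unfolding normo_def
proof (rule cInf_greatest)
  fix y assume "y \<in> {1 / k * (1 + (\<integral>x. V (norm x) * (fsol (k * u x))\<^sup>2 \<partial>lborel)) |k. 0 < k}"
  then obtain k where k: "0 < k" "y = 1 / k * (1 + (\<integral>x. V (norm x) * (fsol (k * u x))\<^sup>2 \<partial>lborel))" by blast
  have "0 \<le> (\<integral>x. V (norm x) * (fsol (k * u x))\<^sup>2 \<partial>lborel)"
    using AE_radial_weight_nonneg[OF V_nonneg] by (intro integral_nonneg_AE) auto
  then show "0 \<le> y" using k by simp
qed (auto intro: exI[of _ 1])

text \<open>The Amemiya norm dominates the Luxemburg norm. Some k in the infimum satisfies 1 + J < k
  l, with J the modular of k u. Then k l >= 1, and convexity of f^2 gives f^2(u / l) <= f^2(k u) /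
  (k l), whose weighted integral is J / (k l) <= 1.\<close>

lemma normo_less_imp_modular:
  fixes u :: "real^'n \<Rightarrow> real"
  assumes u: "u \<in> Espace V" and "normo V u < l"
  shows "0 < l" "(\<integral>x. V (norm x) * (fsol (1 / l * u x))\<^sup>2 \<partial>lborel) \<le> 1"
proof -
  show l: "0 < l" using normo_nonneg[of u] assms by linarith
  obtain k where k: "0 < k" "1 / k * (1 + (\<integral>x. V (norm x) * (fsol (k * u x))\<^sup>2 \<partial>lborel)) < l"
  proof -
    have "{1 / k * (1 + (\<integral>x. V (norm x) * (fsol (k * u x))\<^sup>2 \<partial>lborel)) |k. 0 < k} \<noteq> {}"
      by (auto intro: exI[of _ 1])
    from cInf_lessD[OF this assms(2)[unfolded normo_def]] show thesis using that by blast
  qed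
  define J where "J = (\<integral>x. V (norm x) * (fsol (k * u x))\<^sup>2 \<partial>lborel)"
  have J: "0 \<le> J" unfolding J_def using AE_radial_weight_nonneg[OF V_nonneg] by (intro integral_nonneg_AE) auto
  have "1 + J < k * l" using k by (simp add: J_def field_simps)
  then have kl: "1 \<le> k * l" "J \<le> k * l" using J by auto
  have "(\<integral>x. V (norm x) * (fsol (1 / l * u x))\<^sup>2 \<partial>lborel) \<le> (\<integral>x. 1 / (k * l) * (V (norm x) * (fsol (k * u x))\<^sup>2) \<partial>lborel)"
  proof (rule integral_mono_AE)
    show "AE x in lborel. V (norm x) * (fsol (1 / l * u x))\<^sup>2 \<le> 1 / (k * l) * (V (norm x) * (fsol (k * u x))\<^sup>2)"
      using AE_radial_weight_nonneg[OF V_nonneg]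
    proof eventually_elim
      case (elim x)
      have "(fsol (1 / l * u x))\<^sup>2 \<le> 1 / (k * l) * (fsol (k * u x))\<^sup>2"
        using fsol_sq_superlinear[OF kl(1), of "1 / l * u x"] l k kl by (simp add: field_simps)
      then have "V (norm x) * (fsol (1 / l * u x))\<^sup>2 \<le> V (norm x) * (1 / (k * l) * (fsol (k * u x))\<^sup>2)"
        using elim by (rule mult_left_mono)
      then show ?case by (simp only: mult_ac)
    qed
  qed (intro integrable_mult_right Espace_integrable u)+
  also have "\<dots> = J / (k * l)" by (simp add: J_def)
  also have "\<dots> \<le> 1" using kl by (simp add: divide_le_eq)
  finally show "(\<integral>x. V (norm x) * (fsol (1 / l * u x))\<^sup>2 \<partial>lborel) \<le> 1" .
qed

text \<open>Near the origin the $L^2$ bound comes from Hardy's inequality; away from it, $u$ is bounded and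
  the modular of $u/l$ controls the square.\<close>
lemma Espace_wbound:
  assumes V_bound: "\<exists>C>0. \<forall>r. 0 < r \<and> r < 1 \<longrightarrow> V r \<le> C / r\<^sup>2"
  shows "\<exists>C>0. \<forall>u \<in> (Espace V :: (real^'n \<Rightarrow> real) set). \<forall>l. Enorm V u < l \<longrightarrow> wbound V (C * l) u"
proof -
  obtain d where d: "CARD('n) = d + 3" using N3 by (metis add.commute le_Suc_ex)
  obtain C where C: "0 < C" "\<And>r. 0 < r \<Longrightarrow> r < 1 \<Longrightarrow> V r \<le> C / r\<^sup>2" using V_bound by blast
  let ?c = "sphere_area TYPE(real^'n)"
  have c0: "0 < ?c" by (rule sphere_area_pos)
  define S where "S = 4 / (real d + 1) / ?c"
  have S: "0 < S" using c0 by (simp add: S_def)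
  \<comment> \<open>The three summands are the decay constant, the Hardy constant times the bound on
    r^2 V near the origin, and the factor lost outside the unit ball, where (u / l)^2 <= S.\<close>
  define B where "B = S + C * (8 / (real d + 1)\<^sup>2) + (1 + 2 * S)"
  have B: "0 < B" "S \<le> B" using S C(1) by (auto simp: B_def intro!: add_nonneg_pos)
  let ?g = "(real CARD('n) - 2) / 2"
  have "wbound V (sqrt B * l) u" if u: "u \<in> Espace V" and l: "Enorm V u < l" for u :: "real^'n \<Rightarrow> real" and l
  proof -
    note D = Espace_D12r[OF u]
    note [measurable] = D12r_measurable[OF D]
    have n: "norm12 u < l" "normo V u < l"
      using l normo_nonneg[of u] norm12_nonneg[of u] unfolding Enorm_def by linarith+
    note mod = normo_less_imp_modular[OF u n(2)]
    have nl: "(norm12 u)\<^sup>2 \<le> l\<^sup>2" using n norm12_nonneg[of u] by (intro power_mono) auto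
    have pt: "AE x in lborel. norm x ^ (d+1) * (u x)\<^sup>2 \<le> S * l\<^sup>2"
      using D12r_pointwise_bound[OF D d]
    proof eventually_elim
      case (elim x)
      have "?c * (norm x ^ (d+1) * (u x)\<^sup>2) \<le> 4 / (real d + 1) * l\<^sup>2"
      proof -
        have "4 / (real d + 1) * (norm12 u)\<^sup>2 \<le> 4 / (real d + 1) * l\<^sup>2" using nl by (intro mult_left_mono) auto
        then show ?thesis using elim by (simp only: mult.assoc)
      qed
      then have "norm x ^ (d+1) * (u x)\<^sup>2 \<le> 4 / (real d + 1) * l\<^sup>2 / ?c"
        using c0 by (subst pos_le_divide_eq) (auto simp only: mult.commute)
      then show ?case by (simp add: S_def)
    qed
    have A: "AE x in lborel. \<bar>u x\<bar> \<le> sqrt B * l * norm x powr (- ?g)"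
      using pt AE_lborel_singleton[of "0::real^'n"]
    proof eventually_elim
      case (elim x)
      let ?r = "norm x"
      have r: "0 < ?r" using elim by simp
      have pw: "(?r powr (- ?g))\<^sup>2 * ?r ^ (d+1) = 1"
      proof -
        have "(?r powr (- ?g))\<^sup>2 = ?r powr (- (real d + 1))"
          using r d by (simp add: power2_eq_square powr_add[symmetric] algebra_simps)
        moreover have "?r ^ (d+1) = ?r powr (real d + 1)" using r powr_realpow[OF r, of "d + 1"] by (simp add: add.commute)
        ultimately show ?thesis using r by (simp add: powr_add[symmetric])
      qed
      have "(u x)\<^sup>2 = (?r powr (- ?g))\<^sup>2 * (?r ^ (d+1) * (u x)\<^sup>2)" using pw by (simp add: mult.assoc[symmetric])
      also have "\<dots> \<le> (?r powr (- ?g))\<^sup>2 * (B * l\<^sup>2)"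
        using elim(1) B by (intro mult_left_mono order_trans[OF elim(1)] mult_right_mono) auto
      also have "\<dots> = (sqrt B * l * ?r powr (- ?g))\<^sup>2" using B by (simp add: power_mult_distrib)
      finally show ?case using mod(1) B by (simp add: abs_le_square_iff[symmetric])
    qed
    have "(\<integral>\<^sup>+x. ennreal (V (norm x) * (u x)\<^sup>2) \<partial>lborel)
       \<le> (\<integral>\<^sup>+x. ennreal C * ennreal ((u x)\<^sup>2 / (norm x)\<^sup>2) + ennreal ((1 + 2 * S) * l\<^sup>2) * ennreal (V (norm x) * (fsol (1 / l * u x))\<^sup>2) \<partial>lborel)"
    proof (rule nn_integral_mono_AE)
      show "AE x in lborel. ennreal (V (norm x) * (u x)\<^sup>2)
          \<le> ennreal C * ennreal ((u x)\<^sup>2 / (norm x)\<^sup>2) + ennreal ((1 + 2 * S) * l\<^sup>2) * ennreal (V (norm x) * (fsol (1 / l * u x))\<^sup>2)"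
        using pt AE_lborel_singleton[of "0::real^'n"]
      proof eventually_elim
        case (elim x)
        let ?r = "norm x"
        have r: "0 < ?r" using elim by simp
        have V0: "0 \<le> V ?r" using r V_nonneg by simp
        have "V ?r * (u x)\<^sup>2 \<le> C * ((u x)\<^sup>2 / ?r\<^sup>2) + (1 + 2 * S) * l\<^sup>2 * (V ?r * (fsol (1 / l * u x))\<^sup>2)"
        proof (cases "?r < 1")
          case True
          have "V ?r * (u x)\<^sup>2 \<le> C / ?r\<^sup>2 * (u x)\<^sup>2" using C(2)[OF r True] by (intro mult_right_mono) auto
          moreover have "0 \<le> (1 + 2 * S) * l\<^sup>2 * (V ?r * (fsol (1 / l * u x))\<^sup>2)" using S V0 by simp
          ultimately show ?thesis by simp
        next
          case False
          \<comment> \<open>For |x| >= 1 the decay estimate bounds (u / l)^2 by S, which makes f^2(u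
            / l) comparable to (u / l)^2.\<close>
          have "1 * (u x)\<^sup>2 \<le> ?r ^ (d+1) * (u x)\<^sup>2" using False by (intro mult_right_mono one_le_power) auto
          then have "(u x)\<^sup>2 \<le> S * l\<^sup>2" using elim(1) by simp
          then have "(1 / l * u x)\<^sup>2 \<le> S" using mod(1) by (simp add: power_mult_distrib power_divide divide_le_eq)
          then have "(1 + 2 * (1 / l * u x)\<^sup>2) * (fsol (1 / l * u x))\<^sup>2 \<le> (1 + 2 * S) * (fsol (1 / l * u x))\<^sup>2"
            by (intro mult_right_mono) auto
          then have "(1 / l * u x)\<^sup>2 \<le> (1 + 2 * S) * (fsol (1 / l * u x))\<^sup>2"
            using sq_le_fsol_sq[of "1 / l * u x"] by (rule order_trans[rotated])
          then have "l\<^sup>2 * (1 / l * u x)\<^sup>2 \<le> l\<^sup>2 * ((1 + 2 * S) * (fsol (1 / l * u x))\<^sup>2)"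
            by (intro mult_left_mono) auto
          moreover have "l\<^sup>2 * (1 / l * u x)\<^sup>2 = (u x)\<^sup>2" using mod(1) by (simp add: power_mult_distrib power_divide)
          ultimately have "V ?r * (u x)\<^sup>2 \<le> V ?r * (l\<^sup>2 * ((1 + 2 * S) * (fsol (1 / l * u x))\<^sup>2))"
            using V0 by (intro mult_left_mono) auto
          moreover have "0 \<le> C * ((u x)\<^sup>2 / ?r\<^sup>2)" using C by simp
          ultimately show ?thesis by (simp add: mult_ac)
        qed
        from ennreal_leI[OF this] show ?case
          using C(1) S V0
          by (subst (asm) ennreal_plus) (auto simp: ennreal_mult''[symmetric] simp del: ennreal_plus)
      qed
    qed
    also have "\<dots> = ennreal C * (\<integral>\<^sup>+x. ennreal ((u x)\<^sup>2 / (norm x)\<^sup>2) \<partial>lborel)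
        + ennreal ((1 + 2 * S) * l\<^sup>2) * (\<integral>\<^sup>+x. ennreal (V (norm x) * (fsol (1 / l * u x))\<^sup>2) \<partial>lborel)"
      by (subst nn_integral_add) (auto simp: nn_integral_cmult)
    also have "\<dots> \<le> ennreal C * ennreal (8 / (real d + 1)\<^sup>2 * l\<^sup>2) + ennreal ((1 + 2 * S) * l\<^sup>2) * ennreal 1"
    proof (intro add_mono mult_left_mono)
      show "(\<integral>\<^sup>+x. ennreal ((u x)\<^sup>2 / (norm x)\<^sup>2) \<partial>lborel) \<le> ennreal (8 / (real d + 1)\<^sup>2 * l\<^sup>2)"
        using nl by (intro order_trans[OF D12r_Hardy[OF D d]] ennreal_leI mult_left_mono) auto
      have "(\<integral>\<^sup>+x. ennreal (V (norm x) * (fsol (1 / l * u x))\<^sup>2) \<partial>lborel) = ennreal (\<integral>x. V (norm x) * (fsol (1 / l * u x))\<^sup>2 \<partial>lborel)"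
        using AE_radial_weight_nonneg[OF V_nonneg] by (intro nn_integral_eq_integral Espace_integrable u) auto
      also have "\<dots> \<le> ennreal 1" by (intro ennreal_leI mod(2))
      finally show "(\<integral>\<^sup>+x. ennreal (V (norm x) * (fsol (1 / l * u x))\<^sup>2) \<partial>lborel) \<le> ennreal 1" .
    qed auto
    also have "\<dots> = ennreal ((C * (8 / (real d + 1)\<^sup>2) + (1 + 2 * S)) * l\<^sup>2)"
    proof -
      have "ennreal C * ennreal (8 / (real d + 1)\<^sup>2 * l\<^sup>2) = ennreal (C * (8 / (real d + 1)\<^sup>2 * l\<^sup>2))"
        using C(1) by (intro ennreal_mult[symmetric]) auto
      moreover have "ennreal (C * (8 / (real d + 1)\<^sup>2 * l\<^sup>2)) + ennreal ((1 + 2 * S) * l\<^sup>2)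
          = ennreal (C * (8 / (real d + 1)\<^sup>2 * l\<^sup>2) + (1 + 2 * S) * l\<^sup>2)"
        using C(1) S by (intro ennreal_plus[symmetric]) auto
      ultimately show ?thesis by (simp add: distrib_right mult.assoc)
    qed
    also have "\<dots> \<le> ennreal ((sqrt B * l)\<^sup>2)"
      using B S by (intro ennreal_leI) (auto simp: power_mult_distrib B_def intro!: mult_right_mono)
    finally show ?thesis unfolding wbound_def using A B mod(1) by auto
  qed
  then show ?thesis using B by (intro exI[of _ "sqrt B"]) auto
qed

end

section \<open>Functionals of Nemytskii type\<close>

lemma wbound_nonneg: "wbound V A u \<Longrightarrow> 0 \<le> A"
  by (simp add: wbound_def)

lemma wbound_measurable: "wbound V A u \<Longrightarrow> u \<in> borel_measurable borel"
  by (simp add: wbound_def)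

lemma wbound_mono: "wbound V A u \<Longrightarrow> A \<le> B \<Longrightarrow> wbound V B u"
  unfolding wbound_def
proof (elim conjE, intro conjI)
  assume A: "0 \<le> A" "A \<le> B"
  then show "0 \<le> B" by simp
  assume "AE x in lborel. \<bar>u x\<bar> \<le> A * norm x powr (- ((real CARD('a) - 2) / 2))"
  then show "AE x in lborel. \<bar>u x\<bar> \<le> B * norm x powr (- ((real CARD('a) - 2) / 2))"
    by eventually_elim (rule order_trans, assumption, intro mult_right_mono A, simp)
  assume "(\<integral>\<^sup>+x. ennreal (V (norm x) * (u x)\<^sup>2) \<partial>lborel) \<le> ennreal (A\<^sup>2)"
  also have "\<dots> \<le> ennreal (B\<^sup>2)" using A by (intro ennreal_leI power_mono)
  finally show "(\<integral>\<^sup>+x. ennreal (V (norm x) * (u x)\<^sup>2) \<partial>lborel) \<le> ennreal (B\<^sup>2)" .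
qed

lemma ennreal_le_2_add: "x \<le> 2 * a + 2 * b \<Longrightarrow> 0 \<le> a \<Longrightarrow> 0 \<le> b \<Longrightarrow> ennreal x \<le> 2 * ennreal a + 2 * ennreal b"
  by (drule ennreal_leI) (simp add: ennreal_mult)

lemma wbound_scale:
  fixes u :: "real^'n::finite \<Rightarrow> real"
  assumes "wbound V A u" and [measurable]: "(\<lambda>x::real^'n. V (norm x)) \<in> borel_measurable borel"
  shows "wbound V (\<bar>c\<bar> * A) (\<lambda>x. c * u x)"
  unfolding wbound_def
proof (intro conjI)
  show "0 \<le> \<bar>c\<bar> * A" using assms unfolding wbound_def by simp
  have [measurable]: "u \<in> borel_measurable borel" using assms unfolding wbound_def by simp
  show "(\<lambda>x. c * u x) \<in> borel_measurable borel" by measurable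
  have "AE x in lborel. \<bar>u x\<bar> \<le> A * norm x powr (- ((real CARD('n) - 2) / 2))" using assms unfolding wbound_def by simp
  then show "AE x in lborel. \<bar>c * u x\<bar> \<le> \<bar>c\<bar> * A * norm x powr (- ((real CARD('n) - 2) / 2))"
    by eventually_elim (simp add: abs_mult mult.assoc mult_left_mono)
  have "(\<integral>\<^sup>+x. ennreal (V (norm x) * (c * u x)\<^sup>2) \<partial>lborel) = (\<integral>\<^sup>+x. ennreal (c\<^sup>2) * ennreal (V (norm x) * (u x)\<^sup>2) \<partial>lborel)"
    by (simp add: ennreal_mult'[symmetric] power_mult_distrib mult_ac)
  also have "\<dots> = ennreal (c\<^sup>2) * (\<integral>\<^sup>+x. ennreal (V (norm x) * (u x)\<^sup>2) \<partial>lborel)"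
    by (rule nn_integral_cmult) measurable
  also have "\<dots> \<le> ennreal (c\<^sup>2) * ennreal (A\<^sup>2)" using assms unfolding wbound_def by (intro mult_left_mono) auto
  finally show "(\<integral>\<^sup>+x. ennreal (V (norm x) * (c * u x)\<^sup>2) \<partial>lborel) \<le> ennreal ((\<bar>c\<bar> * A)\<^sup>2)"
    by (simp add: ennreal_mult'[symmetric] power_mult_distrib)
qed

text \<open>A crude triangle inequality: (s + t)^2 <= 2 s^2 + 2 t^2 takes the place of Minkowski's
  inequality, at the price of the factor 2.\<close>

lemma wbound_add:
  fixes u v :: "real^'n::finite \<Rightarrow> real"
  assumes u: "wbound V A u" and v: "wbound V B v"
    and [measurable]: "(\<lambda>x::real^'n. V (norm x)) \<in> borel_measurable borel"
    and V: "AE x in lborel. 0 \<le> V (norm (x::real^'n))"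
  shows "wbound V (2 * (A + B)) (\<lambda>x. u x + v x)"
  unfolding wbound_def
proof (intro conjI)
  have AB: "0 \<le> A" "0 \<le> B" using u v unfolding wbound_def by auto
  then show "0 \<le> 2 * (A + B)" by simp
  have [measurable]: "u \<in> borel_measurable borel" "v \<in> borel_measurable borel" using u v unfolding wbound_def by auto
  show "(\<lambda>x. u x + v x) \<in> borel_measurable borel" by measurable
  have "AE x in lborel. \<bar>u x\<bar> \<le> A * norm x powr (- ((real CARD('n) - 2) / 2))"
       "AE x in lborel. \<bar>v x\<bar> \<le> B * norm x powr (- ((real CARD('n) - 2) / 2))"
    using u v unfolding wbound_def by auto
  then show "AE x in lborel. \<bar>u x + v x\<bar> \<le> 2 * (A + B) * norm x powr (- ((real CARD('n) - 2) / 2))"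
  proof eventually_elim
    case (elim x)
    have "0 \<le> (A + B) * norm x powr (- ((real CARD('n) - 2) / 2))" using AB by simp
    with elim show ?case by (simp add: distrib_right distrib_left)
  qed
  have "(\<integral>\<^sup>+x. ennreal (V (norm x) * (u x + v x)\<^sup>2) \<partial>lborel)
     \<le> (\<integral>\<^sup>+x. 2 * ennreal (V (norm x) * (u x)\<^sup>2) + 2 * ennreal (V (norm x) * (v x)\<^sup>2) \<partial>lborel)"
  proof (rule nn_integral_mono_AE, use V in eventually_elim)
    case (elim x)
    have "V (norm x) * (u x + v x)\<^sup>2 \<le> V (norm x) * (2 * (u x)\<^sup>2 + 2 * (v x)\<^sup>2)"
      using elim norm_add_sq_le[of "u x" "v x"] by (intro mult_left_mono) auto
    also have "\<dots> = 2 * (V (norm x) * (u x)\<^sup>2) + 2 * (V (norm x) * (v x)\<^sup>2)" by (simp add: algebra_simps)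
    finally show ?case by (rule ennreal_le_2_add) (use elim in auto)
  qed
  also have "\<dots> = 2 * (\<integral>\<^sup>+x. ennreal (V (norm x) * (u x)\<^sup>2) \<partial>lborel) + 2 * (\<integral>\<^sup>+x. ennreal (V (norm x) * (v x)\<^sup>2) \<partial>lborel)"
    by (simp add: nn_integral_add nn_integral_cmult)
  also have "\<dots> \<le> 2 * ennreal (A\<^sup>2) + 2 * ennreal (B\<^sup>2)"
    using u v unfolding wbound_def by (intro add_mono mult_left_mono) auto
  also have "\<dots> = ennreal (2 * A\<^sup>2 + 2 * B\<^sup>2)" by (simp add: ennreal_mult)
  also have "\<dots> \<le> ennreal ((2 * (A + B))\<^sup>2)"
  proof (rule ennreal_leI)
    have "0 \<le> A * B" using AB by simp
    then show "2 * A\<^sup>2 + 2 * B\<^sup>2 \<le> (2 * (A + B))\<^sup>2"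
      by (simp add: power2_eq_square algebra_simps)
  qed
  finally show "(\<integral>\<^sup>+x. ennreal (V (norm x) * (u x + v x)\<^sup>2) \<partial>lborel) \<le> ennreal ((2 * (A + B))\<^sup>2)" .
qed

lemma FTC_unit_interval_bound:
  fixes H H' :: "real \<Rightarrow> real"
  assumes D: "\<And>t. (H has_real_derivative H' t) (at t)" and c: "continuous_on UNIV H'"
  shows "ennreal \<bar>H 1 - H 0\<bar> \<le> (\<integral>\<^sup>+t. ennreal \<bar>H' t\<bar> * indicator {0..1} t \<partial>lborel)"
proof -
  have hb: "has_bochner_integral lborel (\<lambda>t. H' t * indicator {0..1} t) (H 1 - H 0)"
    by (rule has_bochner_integral_FTC_Icc_real)
       (use D c in \<open>auto simp: continuous_on_eq_continuous_at\<close>)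
  then have "ennreal (norm (\<integral>t. H' t * indicator {0..1} t \<partial>lborel)) \<le> (\<integral>\<^sup>+t. ennreal (norm (H' t * indicator {0..1} t)) \<partial>lborel)"
    by (intro integral_norm_bound_ennreal) (simp add: has_bochner_integral_iff)
  also have "(\<integral>\<^sup>+t. ennreal (norm (H' t * indicator {0..1} t)) \<partial>lborel) = (\<integral>\<^sup>+t. ennreal \<bar>H' t\<bar> * indicator {0..1} t \<partial>lborel)"
    by (intro nn_integral_cong) (auto simp: indicator_def)
  finally show ?thesis using hb by (simp add: has_bochner_integral_iff)
qed

text \<open>All integrands are nonnegative, so the order of integration can be exchanged with no
  integrability known in advance, and a bound uniform in t survives integration over an interval of
  length 1. Finiteness for F is thus an outcome.\<close>

lemma nn_integral_path_bound:
  fixes W F :: "'a::euclidean_space \<Rightarrow> real" and P :: "real \<Rightarrow> 'a \<Rightarrow> real"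
  assumes [measurable]: "W \<in> borel_measurable borel" "case_prod P \<in> borel_measurable borel"
    and W: "AE x in lborel. 0 \<le> W x"
    and F: "\<And>x. ennreal \<bar>F x\<bar> \<le> (\<integral>\<^sup>+t. ennreal (P t x) * indicator {0..1} t \<partial>lborel)"
    and c: "\<And>t. 0 \<le> t \<Longrightarrow> t \<le> 1 \<Longrightarrow> (\<integral>\<^sup>+x. ennreal (W x * P t x) \<partial>lborel) \<le> c"
  shows "(\<integral>\<^sup>+x. ennreal (W x * \<bar>F x\<bar>) \<partial>lborel) \<le> c"
proof -
  have P: "(\<lambda>p. P (fst p) (snd p)) \<in> borel_measurable (lborel \<Otimes>\<^sub>M lborel)"
    using assms(2) by (simp add: case_prod_beta' lborel_prod)
  have Pm: "(\<lambda>p. P (f p) (g p)) \<in> borel_measurable M" if "f \<in> borel_measurable M" "g \<in> borel_measurable M" for f g and M :: "'c measure"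
  proof -
    have "(\<lambda>p. case_prod P (f p, g p)) \<in> borel_measurable M"
      using that by (intro measurable_compose[OF _ assms(2)]) (simp add: borel_measurable_Pair)
    then show ?thesis by simp
  qed
  have "(\<integral>\<^sup>+x. ennreal (W x * \<bar>F x\<bar>) \<partial>lborel)
     \<le> (\<integral>\<^sup>+x. (\<integral>\<^sup>+t. ennreal (W x) * ennreal (P t x) * indicator {0..1} t \<partial>lborel) \<partial>lborel)"
  proof (rule nn_integral_mono_AE, use W in eventually_elim)
    case (elim x)
    have "ennreal (W x * \<bar>F x\<bar>) = ennreal (W x) * ennreal \<bar>F x\<bar>" using elim by (simp add: ennreal_mult)
    also have "\<dots> \<le> ennreal (W x) * (\<integral>\<^sup>+t. ennreal (P t x) * indicator {0..1} t \<partial>lborel)"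
      using F by (intro mult_left_mono) auto
    also have "\<dots> = (\<integral>\<^sup>+t. ennreal (W x) * (ennreal (P t x) * indicator {0..1} t) \<partial>lborel)"
    proof (rule nn_integral_cmult[symmetric])
      have "(\<lambda>t. P t x) \<in> borel_measurable lborel" by (intro Pm) auto
      then show "(\<lambda>t. ennreal (P t x) * indicator {0..1} t) \<in> borel_measurable lborel" by measurable
    qed
    finally show ?case by (simp add: mult.assoc)
  qed
  also have "\<dots> = (\<integral>\<^sup>+t. (\<integral>\<^sup>+x. ennreal (W x) * ennreal (P t x) * indicator {0..1} t \<partial>lborel) \<partial>lborel)"
  proof (rule lborel_pair.Fubini')
    have [measurable]: "(\<lambda>p. P (fst p) (snd p)) \<in> borel_measurable (lborel \<Otimes>\<^sub>M lborel)" by (rule P)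
    show "(\<lambda>(t, x). ennreal (W x) * ennreal (P t x) * indicator {0..1} t) \<in> borel_measurable (lborel \<Otimes>\<^sub>M lborel)"
      unfolding case_prod_beta' by measurable
  qed
  also have "\<dots> \<le> (\<integral>\<^sup>+t. c * indicator {0..1::real} t \<partial>lborel)"
  proof (intro nn_integral_mono)
    fix t :: real
    have "(\<integral>\<^sup>+x. ennreal (W x) * ennreal (P t x) \<partial>lborel) = (\<integral>\<^sup>+x. ennreal (W x * P t x) \<partial>lborel)"
      by (rule nn_integral_cong_AE, use W in eventually_elim) (simp add: ennreal_mult')
    then show "(\<integral>\<^sup>+x. ennreal (W x) * ennreal (P t x) * indicator {0..1} t \<partial>lborel) \<le> c * indicator {0..1} t"
      using c[of t] by (auto simp: indicator_def)
  qed
  also have "\<dots> = c" by (subst nn_integral_cmult) auto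
  finally show ?thesis .
qed

text \<open>Common frame for the V-term and the K-term. The last two assumptions express boundedness
  and continuity of the candidate derivative in operator norm: their right-hand sides are linear in
  the bound B of the direction, and M and \<delta> do not depend on h. \<open>m_bounded\<close> is
  uniform over all u with a given bound A because the segment from 0 to u has to be
  followed.\<close>

locale integral_functional =
  fixes V :: "real \<Rightarrow> real" and W :: "real^'n::finite \<Rightarrow> real" and m \<Gamma> :: "real \<Rightarrow> real"
  assumes V_meas [measurable]: "(\<lambda>x::real^'n. V (norm x)) \<in> borel_measurable borel"
    and V_pos: "AE x in lborel. 0 \<le> V (norm (x::real^'n))"
    and W_meas [measurable]: "W \<in> borel_measurable borel"
    and W_pos: "AE x in lborel. 0 \<le> W x"
    and m_cont: "continuous_on UNIV m"
    and DERIV_\<Gamma>: "\<And>t. (\<Gamma> has_real_derivative m t) (at t)"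
    and \<Gamma>_0: "\<Gamma> 0 = 0"
    and m_bounded: "\<And>A. 0 \<le> A \<Longrightarrow> \<exists>M\<ge>0. \<forall>u h B. wbound V A u \<longrightarrow> wbound V B h \<longrightarrow>
        (\<integral>\<^sup>+x. ennreal (W x * (\<bar>m (u x)\<bar> * \<bar>h x\<bar>)) \<partial>lborel) \<le> ennreal (M * B)"
    and m_continuous: "\<And>A u \<epsilon>. wbound V A u \<Longrightarrow> 0 < \<epsilon> \<Longrightarrow> \<exists>\<delta>>0. \<forall>v h B. wbound V \<delta> (\<lambda>x. v x - u x) \<longrightarrow> wbound V B h \<longrightarrow>
        (\<integral>\<^sup>+x. ennreal (W x * (\<bar>m (v x) - m (u x)\<bar> * \<bar>h x\<bar>)) \<partial>lborel) \<le> ennreal (\<epsilon> * B)"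
begin

lemma m_meas [measurable]: "m \<in> borel_measurable borel"
  using m_cont by (rule borel_measurable_continuous_onI)

lemma \<Gamma>_meas [measurable]: "\<Gamma> \<in> borel_measurable borel"
  by (intro borel_measurable_continuous_onI continuous_at_imp_continuous_on ballI DERIV_isCont[OF DERIV_\<Gamma>])

lemma m_cont_compose: "continuous_on S f \<Longrightarrow> continuous_on S (\<lambda>x. m (f x))"
  using m_cont continuous_on_compose2 by blast

lemma integrable_if_bounded:
  assumes [measurable]: "F \<in> borel_measurable borel"
    and "(\<integral>\<^sup>+x. ennreal (W x * \<bar>F x\<bar>) \<partial>lborel) \<le> ennreal c" and "0 \<le> c"
  shows "integrable lborel (\<lambda>x. W x * F x)" "\<bar>\<integral>x. W x * F x \<partial>lborel\<bar> \<le> c"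
proof -
  have eq: "(\<integral>\<^sup>+x. ennreal (norm (W x * F x)) \<partial>lborel) = (\<integral>\<^sup>+x. ennreal (W x * \<bar>F x\<bar>) \<partial>lborel)"
    by (rule nn_integral_cong_AE, use W_pos in eventually_elim) (simp add: abs_mult)
  show i: "integrable lborel (\<lambda>x. W x * F x)"
  proof (rule integrableI_bounded)
    show "(\<integral>\<^sup>+x. ennreal (norm (W x * F x)) \<partial>lborel) < \<infinity>"
      unfolding eq using le_less_trans[OF assms(2) ennreal_less_top] by simp
  qed measurable
  have "ennreal (norm (\<integral>x. W x * F x \<partial>lborel)) \<le> ennreal c"
    using integral_norm_bound_ennreal[OF i] assms(2) unfolding eq by (rule order_trans)
  then show "\<bar>\<integral>x. W x * F x \<partial>lborel\<bar> \<le> c" using assms(3) by (simp add: ennreal_le_iff)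
qed

text \<open>As \<Gamma> vanishes at 0, \<Gamma>(u) is the integral of m(t u) u over the unit
  interval. The functions t u share the bound A of u, so boundedness of the derivative in the
  direction u applies for each t.\<close>

lemma integrable_\<Gamma>:
  assumes u: "wbound V A u"
  shows "integrable lborel (\<lambda>x. W x * \<Gamma> (u x))"
proof -
  have A: "0 \<le> A" using u by (simp add: wbound_def)
  obtain M where M: "0 \<le> M" "\<And>u h B. wbound V A u \<Longrightarrow> wbound V B h \<Longrightarrow>
        (\<integral>\<^sup>+x. ennreal (W x * (\<bar>m (u x)\<bar> * \<bar>h x\<bar>)) \<partial>lborel) \<le> ennreal (M * B)"
    using m_bounded[OF A] by blast
  note [measurable] = wbound_measurable[OF u]
  have "(\<integral>\<^sup>+x. ennreal (W x * \<bar>\<Gamma> (u x)\<bar>) \<partial>lborel) \<le> ennreal (M * A)"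
  proof (rule nn_integral_path_bound[where P = "\<lambda>t x. \<bar>m (t * u x)\<bar> * \<bar>u x\<bar>"])
    show "(\<lambda>(t, x). \<bar>m (t * u x)\<bar> * \<bar>u x\<bar>) \<in> borel_measurable borel"
      unfolding case_prod_beta' borel_prod[symmetric] by measurable
    fix x
    have "ennreal \<bar>\<Gamma> (1 * u x) - \<Gamma> (0 * u x)\<bar> \<le> (\<integral>\<^sup>+t. ennreal \<bar>m (t * u x) * u x\<bar> * indicator {0..1} t \<partial>lborel)"
    proof (rule FTC_unit_interval_bound)
      show "((\<lambda>t. \<Gamma> (t * u x)) has_real_derivative m (t * u x) * u x) (at t)" for t
        by (rule DERIV_chain2[OF DERIV_\<Gamma>]) (auto intro!: derivative_eq_intros)
      show "continuous_on UNIV (\<lambda>t. m (t * u x) * u x)"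
        by (intro continuous_intros m_cont_compose)
    qed
    then show "ennreal \<bar>\<Gamma> (u x)\<bar> \<le> (\<integral>\<^sup>+t. ennreal (\<bar>m (t * u x)\<bar> * \<bar>u x\<bar>) * indicator {0..1} t \<partial>lborel)"
      by (simp add: \<Gamma>_0 abs_mult)
  next
    fix t :: real assume t: "0 \<le> t" "t \<le> 1"
    have "wbound V A (\<lambda>x. t * u x)"
      by (rule wbound_mono[OF wbound_scale[OF u]]) (use t A in \<open>auto intro: mult_left_le_one_le\<close>)
    then show "(\<integral>\<^sup>+x. ennreal (W x * (\<bar>m (t * u x)\<bar> * \<bar>u x\<bar>)) \<partial>lborel) \<le> ennreal (M * A)"
      using M(2) u by blast
  qed (use W_pos in auto)
  from integrable_if_bounded(1)[OF _ this] M A show ?thesis by simp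
qed

lemma derivative_bounded:
  assumes "0 \<le> A"
  shows "\<exists>M\<ge>0. \<forall>u h B. wbound V A u \<longrightarrow> wbound V B h \<longrightarrow>
     integrable lborel (\<lambda>x. W x * (m (u x) * h x)) \<and> \<bar>\<integral>x. W x * (m (u x) * h x) \<partial>lborel\<bar> \<le> M * B"
proof -
  obtain M where M: "0 \<le> M" "\<And>u h B. wbound V A u \<Longrightarrow> wbound V B h \<Longrightarrow>
        (\<integral>\<^sup>+x. ennreal (W x * (\<bar>m (u x)\<bar> * \<bar>h x\<bar>)) \<partial>lborel) \<le> ennreal (M * B)"
    using m_bounded[OF assms] by blast
  have "integrable lborel (\<lambda>x. W x * (m (u x) * h x)) \<and> \<bar>\<integral>x. W x * (m (u x) * h x) \<partial>lborel\<bar> \<le> M * B"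
    if u: "wbound V A u" and h: "wbound V B h" for u h B
  proof -
    note [measurable] = wbound_measurable[OF u] wbound_measurable[OF h]
    have "0 \<le> M * B" using M h by (simp add: wbound_def)
    then show ?thesis
      using M(2)[OF u h] integrable_if_bounded[of "\<lambda>x. m (u x) * h x" "M * B"] by (simp add: abs_mult)
  qed
  then show ?thesis using M by blast
qed

lemma derivative_integrable:
  assumes u: "wbound V A u" and h: "wbound V B h"
  shows "integrable lborel (\<lambda>x. W x * (m (u x) * h x))"
  using derivative_bounded[of A] assms unfolding wbound_def[of V A] by blast

lemma derivative_continuous:
  assumes u: "wbound V A u" and "0 < \<epsilon>"
  shows "\<exists>\<delta>>0. \<forall>v h B. wbound V \<delta> (\<lambda>x. v x - u x) \<longrightarrow> wbound V B h \<longrightarrow>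
     \<bar>(\<integral>x. W x * (m (v x) * h x) \<partial>lborel) - (\<integral>x. W x * (m (u x) * h x) \<partial>lborel)\<bar> \<le> \<epsilon> * B"
proof -
  obtain \<delta> where \<delta>: "0 < \<delta>" "\<And>v h B. wbound V \<delta> (\<lambda>x. v x - u x) \<Longrightarrow> wbound V B h \<Longrightarrow>
        (\<integral>\<^sup>+x. ennreal (W x * (\<bar>m (v x) - m (u x)\<bar> * \<bar>h x\<bar>)) \<partial>lborel) \<le> ennreal (\<epsilon> * B)"
    using m_continuous[OF assms] by blast
  have "\<bar>(\<integral>x. W x * (m (v x) * h x) \<partial>lborel) - (\<integral>x. W x * (m (u x) * h x) \<partial>lborel)\<bar> \<le> \<epsilon> * B"
    if v: "wbound V \<delta> (\<lambda>x. v x - u x)" and h: "wbound V B h" for v h B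
  proof -
    have v': "wbound V (2 * (\<delta> + A)) (\<lambda>x. v x - u x + u x)" by (rule wbound_add[OF v u V_meas V_pos])
    then have v': "wbound V (2 * (\<delta> + A)) v" by simp
    note [measurable] = wbound_measurable[OF u] wbound_measurable[OF h] wbound_measurable[OF v']
    have "0 \<le> \<epsilon> * B" using assms(2) h by (simp add: wbound_def)
    then have "\<bar>\<integral>x. W x * ((m (v x) - m (u x)) * h x) \<partial>lborel\<bar> \<le> \<epsilon> * B"
      using \<delta>(2)[OF v h] integrable_if_bounded(2)[of "\<lambda>x. (m (v x) - m (u x)) * h x" "\<epsilon> * B"] by (simp add: abs_mult)
    moreover have "(\<integral>x. W x * ((m (v x) - m (u x)) * h x) \<partial>lborel) = (\<integral>x. W x * (m (v x) * h x) \<partial>lborel) - (\<integral>x. W x * (m (u x) * h x) \<partial>lborel)"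
      by (subst Bochner_Integration.integral_diff[symmetric, OF derivative_integrable[OF v' h] derivative_integrable[OF u h]])
         (simp add: algebra_simps)
    ultimately show ?thesis by simp
  qed
  then show ?thesis using \<delta>(1) by blast
qed

text \<open>The remainder is the increment over the unit interval of the function sending t to
  \<Gamma>(u + t h) - t m(u) h, whose derivative is (m(u + t h) - m(u)) h; continuity of the
  derivative makes this small for every t at once.\<close>

lemma differentiable:
  assumes u: "wbound V A u" and "0 < \<epsilon>"
  shows "\<exists>\<delta>>0. \<forall>h B. wbound V B h \<longrightarrow> B \<le> \<delta> \<longrightarrow>
     \<bar>(\<integral>x. W x * \<Gamma> (u x + h x) \<partial>lborel) - (\<integral>x. W x * \<Gamma> (u x) \<partial>lborel) - (\<integral>x. W x * (m (u x) * h x) \<partial>lborel)\<bar> \<le> \<epsilon> * B"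
proof -
  obtain \<delta> where \<delta>: "0 < \<delta>" "\<And>v h B. wbound V \<delta> (\<lambda>x. v x - u x) \<Longrightarrow> wbound V B h \<Longrightarrow>
        (\<integral>\<^sup>+x. ennreal (W x * (\<bar>m (v x) - m (u x)\<bar> * \<bar>h x\<bar>)) \<partial>lborel) \<le> ennreal (\<epsilon> * B)"
    using m_continuous[OF assms] by blast
  have "\<bar>(\<integral>x. W x * \<Gamma> (u x + h x) \<partial>lborel) - (\<integral>x. W x * \<Gamma> (u x) \<partial>lborel) - (\<integral>x. W x * (m (u x) * h x) \<partial>lborel)\<bar> \<le> \<epsilon> * B"
    if h: "wbound V B h" and B: "B \<le> \<delta>" for h B
  proof -
    have B0: "0 \<le> B" using h by (simp add: wbound_def)
    note uh = wbound_add[OF u h V_meas V_pos]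
    note [measurable] = wbound_measurable[OF u] wbound_measurable[OF h]
    define F where "F x = \<Gamma> (u x + h x) - \<Gamma> (u x) - m (u x) * h x" for x
    have [measurable]: "F \<in> borel_measurable borel" unfolding F_def by measurable
    have "(\<integral>\<^sup>+x. ennreal (W x * \<bar>F x\<bar>) \<partial>lborel) \<le> ennreal (\<epsilon> * B)"
    proof (rule nn_integral_path_bound[where P = "\<lambda>t x. \<bar>m (u x + t * h x) - m (u x)\<bar> * \<bar>h x\<bar>"])
      show "(\<lambda>(t, x). \<bar>m (u x + t * h x) - m (u x)\<bar> * \<bar>h x\<bar>) \<in> borel_measurable borel"
        unfolding case_prod_beta' borel_prod[symmetric] by measurable
      fix x
      have "ennreal \<bar>(\<Gamma> (u x + 1 * h x) - 1 * (m (u x) * h x)) - (\<Gamma> (u x + 0 * h x) - 0 * (m (u x) * h x))\<bar>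
         \<le> (\<integral>\<^sup>+t. ennreal \<bar>m (u x + t * h x) * h x - m (u x) * h x\<bar> * indicator {0..1} t \<partial>lborel)"
      proof (rule FTC_unit_interval_bound)
        fix t
        have "((\<lambda>t. \<Gamma> (u x + t * h x)) has_real_derivative m (u x + t * h x) * h x) (at t)"
          by (rule DERIV_chain2[OF DERIV_\<Gamma>]) (auto intro!: derivative_eq_intros)
        moreover have "((\<lambda>t. t * (m (u x) * h x)) has_real_derivative m (u x) * h x) (at t)"
          by (auto intro!: derivative_eq_intros)
        ultimately show "((\<lambda>t. \<Gamma> (u x + t * h x) - t * (m (u x) * h x)) has_real_derivative m (u x + t * h x) * h x - m (u x) * h x) (at t)"
          by (rule DERIV_diff)
      next
        show "continuous_on UNIV (\<lambda>t. m (u x + t * h x) * h x - m (u x) * h x)"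
          by (intro continuous_intros m_cont_compose)
      qed
      moreover have "\<bar>m (u x + t * h x) * h x - m (u x) * h x\<bar> = \<bar>m (u x + t * h x) - m (u x)\<bar> * \<bar>h x\<bar>" for t
        by (simp add: abs_mult[symmetric] algebra_simps)
      ultimately show "ennreal \<bar>F x\<bar> \<le> (\<integral>\<^sup>+t. ennreal (\<bar>m (u x + t * h x) - m (u x)\<bar> * \<bar>h x\<bar>) * indicator {0..1} t \<partial>lborel)"
        by (simp add: F_def algebra_simps)
    next
      fix t :: real assume t: "0 \<le> t" "t \<le> 1"
      have "wbound V \<delta> (\<lambda>x. (u x + t * h x) - u x)"
        using wbound_mono[OF wbound_scale[OF h V_meas, of t], of \<delta>] t B B0 mult_left_le_one_le[of B t] by simp
      then show "(\<integral>\<^sup>+x. ennreal (W x * (\<bar>m (u x + t * h x) - m (u x)\<bar> * \<bar>h x\<bar>)) \<partial>lborel) \<le> ennreal (\<epsilon> * B)"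
        by (rule \<delta>(2)[OF _ h])
    qed (use W_pos in auto)
    from integrable_if_bounded(2)[OF _ this] assms(2) B0 have "\<bar>\<integral>x. W x * F x \<partial>lborel\<bar> \<le> \<epsilon> * B" by simp
    moreover have "(\<integral>x. W x * F x \<partial>lborel) = (\<integral>x. W x * \<Gamma> (u x + h x) \<partial>lborel) - (\<integral>x. W x * \<Gamma> (u x) \<partial>lborel) - (\<integral>x. W x * (m (u x) * h x) \<partial>lborel)"
      using integrable_\<Gamma>[OF uh] integrable_\<Gamma>[OF u] derivative_integrable[OF u h]
      by (simp add: F_def right_diff_distrib)
    ultimately show ?thesis by simp
  qed
  then show ?thesis using \<delta>(1) by blast
qed

end

section \<open>Estimates for the nonlinearity\<close>

lemma vpow_nonneg: "0 \<le> vpow v b"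
  by (simp add: vpow_def)

text \<open>A weighted geometric mean lies below the larger of X and Y. With \<open>vpow\<close> the
  case b = 0 reads Y <= X + Y, also when X = 0.\<close>

lemma vpow_Young:
  assumes "0 \<le> X" "0 < Y" "0 \<le> b" "b \<le> 1"
  shows "vpow X b * Y powr (1 - b) \<le> X + Y"
proof (cases "X \<le> Y")
  case True
  have "vpow X b \<le> Y powr b" using assms True by (auto simp: vpow_def intro: powr_mono2)
  then have "vpow X b * Y powr (1 - b) \<le> Y powr b * Y powr (1 - b)" by (intro mult_right_mono) auto
  also have "\<dots> = Y" using assms by (simp add: powr_add[symmetric])
  finally show ?thesis using assms by simp
next
  case False
  then have X: "0 < X" using assms by simp
  have "vpow X b * Y powr (1 - b) \<le> X powr b * X powr (1 - b)"
    using assms False X by (intro mult_mono powr_mono2) (auto simp: vpow_def)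
  also have "\<dots> = X" using X by (simp add: powr_add[symmetric])
  finally show ?thesis using assms by simp
qed

text \<open>In s^q = s^(2\<beta>) s^(q - 2\<beta>) the first factor joins v^\<beta> to form (v
  s^2)^\<beta>, controlled by the V-integral, and the second is estimated by decay.
  \<open>del\<close> is the surplus of the resulting exponent: one half stays as the small factor
  r^(-del/2), the other makes r^(-N - del/2) integrable at infinity.\<close>

lemma tail_pointwise_bound:
  fixes r s A v \<alpha> \<beta> q \<gamma> N :: real
  assumes r: "1 \<le> r" and s: "0 \<le> s" "s \<le> A * r powr (- \<gamma>)" and v: "0 \<le> v"
    and b: "0 \<le> \<beta>" "\<beta> \<le> 1" "2 * \<beta> \<le> q"
    and del: "0 \<le> del" "del = \<gamma> * (q - 2 * \<beta>) - \<alpha> - N * (1 - \<beta>)"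
  shows "r powr \<alpha> * vpow v \<beta> * s powr q \<le> A powr (q - 2 * \<beta>) * (r powr (- del / 2) * (v * s\<^sup>2 + r powr (- N - del / 2)))"
proof (cases "s = 0")
  case True then show ?thesis by simp
next
  case False
  then have s0: "0 < s" using s by simp
  have "0 < A * r powr (- \<gamma>)" using s0 s(2) by linarith
  then have A: "0 < A" using r by (simp add: zero_less_mult_iff)
  define X where "X = v * s\<^sup>2"
  define Y where "Y = r powr (- N - del / 2)"
  have X: "0 \<le> X" using v by (simp add: X_def)
  have Y: "0 < Y" using r by (simp add: Y_def)
  have s2: "s powr (2 * \<beta>) = (s\<^sup>2) powr \<beta>" using s0 by (simp add: powr_powr[symmetric])
  have vX: "vpow v \<beta> * s powr (2 * \<beta>) = vpow X \<beta>"
    using s0 v unfolding s2 by (simp add: vpow_def X_def powr_mult)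
  have sq: "s powr q = s powr (2 * \<beta>) * s powr (q - 2 * \<beta>)" by (simp add: powr_add[symmetric])
  have "s powr (q - 2 * \<beta>) \<le> (A * r powr (- \<gamma>)) powr (q - 2 * \<beta>)" using s b by (intro powr_mono2) auto
  also have "\<dots> = A powr (q - 2 * \<beta>) * r powr (- \<gamma> * (q - 2 * \<beta>))" using A by (simp add: powr_mult powr_powr)
  finally have sp: "s powr (q - 2 * \<beta>) \<le> A powr (q - 2 * \<beta>) * r powr (- \<gamma> * (q - 2 * \<beta>))" .
  have "r powr \<alpha> * vpow v \<beta> * s powr q = r powr \<alpha> * vpow X \<beta> * s powr (q - 2 * \<beta>)"
    unfolding sq vX[symmetric] by simp
  also have "\<dots> \<le> r powr \<alpha> * vpow X \<beta> * (A powr (q - 2 * \<beta>) * r powr (- \<gamma> * (q - 2 * \<beta>)))"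
    using sp by (intro mult_left_mono) (auto simp: vpow_nonneg)
  also have "\<dots> = A powr (q - 2 * \<beta>) * (vpow X \<beta> * (r powr \<alpha> * r powr (- \<gamma> * (q - 2 * \<beta>))))" by simp
  also have "r powr \<alpha> * r powr (- \<gamma> * (q - 2 * \<beta>)) = r powr (- del / 2) * r powr (- del / 2 - N * (1 - \<beta>))"
    unfolding powr_add[symmetric] by (simp add: del(2))
  also have "A powr (q - 2 * \<beta>) * (vpow X \<beta> * (r powr (- del / 2) * r powr (- del / 2 - N * (1 - \<beta>))))
     \<le> A powr (q - 2 * \<beta>) * (r powr (- del / 2) * (X + Y))"
  proof -
    have "r powr (- del / 2 - N * (1 - \<beta>)) \<le> Y powr (1 - \<beta>)"
    proof -
      \<comment> \<open>An amount del \<beta> / 2 of the exponent is given away, so that the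
        remaining power of r becomes the power 1 - \<beta> of Y.\<close>
      have "0 \<le> del * \<beta>" using del(1) b by simp
      then have "- del / 2 - N * (1 - \<beta>) \<le> (- N - del / 2) * (1 - \<beta>)" by (simp add: algebra_simps)
      then show ?thesis using r unfolding Y_def powr_powr by (intro powr_mono) auto
    qed
    then have "vpow X \<beta> * r powr (- del / 2 - N * (1 - \<beta>)) \<le> vpow X \<beta> * Y powr (1 - \<beta>)"
      by (intro mult_left_mono vpow_nonneg)
    also have "\<dots> \<le> X + Y" using vpow_Young[OF X Y] b by simp
    finally have "r powr (- del / 2) * (vpow X \<beta> * r powr (- del / 2 - N * (1 - \<beta>))) \<le> r powr (- del / 2) * (X + Y)"
      by (intro mult_left_mono) auto
    then show ?thesis by (intro mult_left_mono) (auto simp: mult_ac)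
  qed
  finally show ?thesis by (simp add: X_def Y_def)
qed

lemma ennreal_less_topE:
  assumes "x < \<infinity>" obtains I where "0 \<le> I" "x = ennreal I"
  using assms by (cases x) auto

lemma wbound_abs: "wbound V A u \<Longrightarrow> wbound V A (\<lambda>x. \<bar>u x\<bar>)"
  by (auto simp: wbound_def)

text \<open>Cauchy-Schwarz after splitting V into sqrt V times sqrt V; the bound is linear in each
  of A and B, as estimates in operator norm require.\<close>

lemma wbound_product:
  fixes u h :: "real^'n::finite \<Rightarrow> real"
  assumes u: "wbound V A u" and h: "wbound V B h"
    and [measurable]: "(\<lambda>x::real^'n. V (norm x)) \<in> borel_measurable borel"
    and V: "AE x in lborel. 0 \<le> V (norm (x::real^'n))"
  shows "(\<integral>\<^sup>+x. ennreal (V (norm x) * (\<bar>u x\<bar> * \<bar>h x\<bar>)) \<partial>lborel) \<le> ennreal (A * B)"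
proof -
  note AB = wbound_nonneg[OF u] wbound_nonneg[OF h]
  note [measurable] = wbound_measurable[OF u] wbound_measurable[OF h]
  let ?s = "\<lambda>x::real^'n. sqrt (V (norm x))"
  have sq: "(\<integral>\<^sup>+x. (ennreal (?s x * \<bar>f x\<bar>))\<^sup>2 \<partial>lborel) = (\<integral>\<^sup>+x. ennreal (V (norm x) * (f x)\<^sup>2) \<partial>lborel)" for f
    by (rule nn_integral_cong_AE, use V in eventually_elim) (simp add: ennreal_power power_mult_distrib)
  have "(\<integral>\<^sup>+x. ennreal (V (norm x) * (\<bar>u x\<bar> * \<bar>h x\<bar>)) \<partial>lborel) =
      (\<integral>\<^sup>+x. ennreal (?s x * \<bar>u x\<bar>) * ennreal (?s x * \<bar>h x\<bar>) \<partial>lborel)"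
  proof (rule nn_integral_cong_AE, use V in eventually_elim)
    case (elim x)
    have "V (norm x) * (\<bar>u x\<bar> * \<bar>h x\<bar>) = (?s x * ?s x) * (\<bar>u x\<bar> * \<bar>h x\<bar>)" using elim by simp
    also have "\<dots> = (?s x * \<bar>u x\<bar>) * (?s x * \<bar>h x\<bar>)" by (simp only: mult_ac)
    finally show ?case using elim by (simp only: ennreal_mult real_sqrt_ge_zero mult_nonneg_nonneg abs_ge_zero)
  qed
  moreover define I where "I = (\<integral>\<^sup>+x. ennreal (?s x * \<bar>u x\<bar>) * ennreal (?s x * \<bar>h x\<bar>) \<partial>lborel)"
  moreover have "I \<le> ennreal (A * B)"
  proof -
    have "I\<^sup>2 \<le> (\<integral>\<^sup>+x. (ennreal (?s x * \<bar>u x\<bar>))\<^sup>2 \<partial>lborel) * (\<integral>\<^sup>+x. (ennreal (?s x * \<bar>h x\<bar>))\<^sup>2 \<partial>lborel)"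
      unfolding I_def by (rule Cauchy_Schwarz_nn_integral) auto
    also have "\<dots> \<le> ennreal (A\<^sup>2) * ennreal (B\<^sup>2)"
      unfolding sq using u h unfolding wbound_def by (intro mult_mono) auto
    also have "\<dots> = ennreal ((A * B)\<^sup>2)" by (simp add: ennreal_mult power_mult_distrib)
    finally have le: "I\<^sup>2 \<le> ennreal ((A * B)\<^sup>2)" .
    show ?thesis
    proof (cases I)
      case (real r)
      then have "r\<^sup>2 \<le> (A * B)\<^sup>2" using le by (simp add: ennreal_power)
      then have "r \<le> A * B" using AB by (intro power2_le_imp_le[of r "A * B"]) auto
      then show ?thesis using real by (simp add: ennreal_leI)
    next
      case top
      then show ?thesis using le by (simp add: top_unique)
    qed
  qed
  ultimately show ?thesis by simp
qed

text \<open>\<open>m\<close> stands for g(f) f'; its power \<open>s\<close> serves on balls, its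
  power \<open>q - 1\<close> outside them. \<open>expo_local\<close> is the integrability at the
  origin of r^(a - \<gamma> (s + 1)), which collects the weight, m(u) and a direction h under the
  decay rate \<gamma>. \<open>del\<close> is the surplus exponent at infinity.\<close>

context
  fixes V K m :: "real \<Rightarrow> real" and dom :: "'n::finite itself" and a s \<alpha> \<beta> q M C R \<gamma> del :: real
  assumes N3: "CARD('n) \<ge> 3"
    and V_cont: "continuous_on {0<..} V" and V_nonneg: "\<forall>r>0. V r \<ge> 0"
    and K_cont: "continuous_on {0<..} K" and K_nonneg: "\<forall>r>0. K r \<ge> 0"
    and m_cont: "continuous_on UNIV m" and C: "0 \<le> C"
    and m_local: "\<And>t. \<bar>m t\<bar> \<le> C * \<bar>t\<bar> powr s" and s: "0 \<le> s"
    and m_tail: "\<And>t. \<bar>m t\<bar> \<le> C * \<bar>t\<bar> powr (q - 1)" and q: "1 \<le> q" "2 * \<beta> \<le> q"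
    and K_local: "\<And>\<rho>. \<exists>L\<ge>0. \<forall>r. 0 < r \<longrightarrow> r \<le> \<rho> \<longrightarrow> K r \<le> L * r powr a"
    and K_tail: "\<And>r. R < r \<Longrightarrow> K r \<le> M * (r powr \<alpha> * vpow (V r) \<beta>)" and M: "0 \<le> M"
    and b: "0 \<le> \<beta>" "\<beta> \<le> 1"
    and \<gamma>_def: "\<gamma> = (real CARD('n) - 2) / 2"
    and expo_local: "0 < a - \<gamma> * (s + 1) + real CARD('n)"
    and del_def: "del = \<gamma> * (q - 2 * \<beta>) - \<alpha> - real CARD('n) * (1 - \<beta>)" and del: "0 < del"
begin

lemma K_meas [measurable]: "(\<lambda>x::real^'n. K (norm x)) \<in> borel_measurable borel"
  by (rule measurable_radial_weight[OF K_cont])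

lemma V_meas' [measurable]: "(\<lambda>x::real^'n. V (norm x)) \<in> borel_measurable borel"
  by (rule measurable_radial_weight[OF V_cont])

lemma m_measurable [measurable]: "m \<in> borel_measurable borel"
  using m_cont by (rule borel_measurable_continuous_onI)

lemma wboundD_pointwise:
  fixes u :: "real^'n \<Rightarrow> real"
  shows "wbound V A u \<Longrightarrow> AE x in lborel. \<bar>u x\<bar> \<le> A * norm x powr (- \<gamma>)"
  by (simp add: wbound_def \<gamma>_def)

text \<open>The extra factor |x|^(-\<gamma>) takes the place of a direction h, which decays at that
  rate. The bound is therefore uniform in h and serves as one majorant for all u with the same
  A.\<close>

lemma local_pointwise_bound:
  assumes "0 \<le> A"
  shows "\<exists>L\<ge>0. \<forall>u::real^'n \<Rightarrow> real. wbound V A u \<longrightarrow>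
    (AE x in lborel. norm x \<le> \<rho> \<longrightarrow> K (norm x) * \<bar>m (u x)\<bar> * norm x powr (- \<gamma>) \<le> L * norm x powr (a - \<gamma> * (s + 1)))"
proof -
  obtain L where L: "0 \<le> L" "\<And>r. 0 < r \<Longrightarrow> r \<le> \<rho> \<Longrightarrow> K r \<le> L * r powr a" using K_local by blast
  have "AE x in lborel. norm x \<le> \<rho> \<longrightarrow> K (norm x) * \<bar>m (u x)\<bar> * norm x powr (- \<gamma>) \<le> L * (C * A powr s) * norm x powr (a - \<gamma> * (s + 1))"
    if u: "wbound V A u" for u :: "real^'n \<Rightarrow> real"
    using wboundD_pointwise[OF u] AE_norm_pos
  proof eventually_elim
    case (elim x)
    let ?r = "norm x"
    show ?case
    proof
      assume r: "?r \<le> \<rho>"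
      have "\<bar>m (u x)\<bar> \<le> C * (A * ?r powr (- \<gamma>)) powr s"
        using elim s C by (intro order_trans[OF m_local] mult_left_mono powr_mono2) auto
      also have "\<dots> = C * A powr s * ?r powr (- \<gamma> * s)" using assms by (simp add: powr_mult powr_powr)
      finally have "K ?r * \<bar>m (u x)\<bar> \<le> (L * ?r powr a) * (C * A powr s * ?r powr (- \<gamma> * s))"
        using L r elim K_nonneg by (intro mult_mono) auto
      then have "K ?r * \<bar>m (u x)\<bar> * ?r powr (- \<gamma>) \<le> (L * ?r powr a) * (C * A powr s * ?r powr (- \<gamma> * s)) * ?r powr (- \<gamma>)"
        by (intro mult_right_mono) auto
      also have "\<dots> = L * (C * A powr s) * (?r powr a * ?r powr (- \<gamma> * s) * ?r powr (- \<gamma>))" by simp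
      also have "?r powr a * ?r powr (- \<gamma> * s) * ?r powr (- \<gamma>) = ?r powr (a - \<gamma> * (s + 1))"
        unfolding powr_add[symmetric] by (simp add: algebra_simps)
      finally show "K ?r * \<bar>m (u x)\<bar> * ?r powr (- \<gamma>) \<le> L * (C * A powr s) * ?r powr (a - \<gamma> * (s + 1))" .
    qed
  qed
  moreover have "0 \<le> L * (C * A powr s)" using L C by simp
  ultimately show ?thesis by blast
qed

lemma local_integral_bound:
  assumes "0 \<le> A" "0 \<le> \<rho>"
  shows "\<exists>L\<ge>0. \<forall>(u::real^'n \<Rightarrow> real) h B. wbound V A u \<longrightarrow> wbound V B h \<longrightarrow>
    (\<integral>\<^sup>+x. ennreal (K (norm x) * (\<bar>m (u x)\<bar> * \<bar>h x\<bar>)) * indicator {..\<rho>} (norm x) \<partial>lborel) \<le> ennreal (L * B)"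
proof -
  obtain L where L: "0 \<le> L" "\<And>u::real^'n \<Rightarrow> real. wbound V A u \<Longrightarrow>
    (AE x in lborel. norm x \<le> \<rho> \<longrightarrow> K (norm x) * \<bar>m (u x)\<bar> * norm x powr (- \<gamma>) \<le> L * norm x powr (a - \<gamma> * (s + 1)))"
    using local_pointwise_bound[OF assms(1)] by blast
  have fin: "(\<integral>\<^sup>+x. ennreal (norm (x::real^'n) powr (a - \<gamma> * (s + 1))) * indicator {..\<rho>} (norm x) \<partial>lborel) < \<infinity>"
    using expo_local assms by (intro nn_integral_norm_powr_near_0) auto
  then obtain I where I: "0 \<le> I" "(\<integral>\<^sup>+x. ennreal (norm (x::real^'n) powr (a - \<gamma> * (s + 1))) * indicator {..\<rho>} (norm x) \<partial>lborel) = ennreal I"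
    by (rule ennreal_less_topE)
  have "(\<integral>\<^sup>+x. ennreal (K (norm x) * (\<bar>m (u x)\<bar> * \<bar>h x\<bar>)) * indicator {..\<rho>} (norm x) \<partial>lborel) \<le> ennreal (L * I * B)"
    if u: "wbound V A u" and h: "wbound V B h" for u h :: "real^'n \<Rightarrow> real" and B
  proof -
    have B: "0 \<le> B" using wbound_nonneg[OF h] .
    have "(\<integral>\<^sup>+x. ennreal (K (norm x) * (\<bar>m (u x)\<bar> * \<bar>h x\<bar>)) * indicator {..\<rho>} (norm x) \<partial>lborel)
      \<le> (\<integral>\<^sup>+x. ennreal (L * B) * (ennreal (norm (x::real^'n) powr (a - \<gamma> * (s + 1))) * indicator {..\<rho>} (norm x)) \<partial>lborel)"
    proof (rule nn_integral_mono_AE, use L(2)[OF u] wboundD_pointwise[OF h] AE_norm_pos in eventually_elim)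
      case (elim x)
      show ?case
      proof (cases "norm x \<le> \<rho>")
        case True
        have "K (norm x) * (\<bar>m (u x)\<bar> * \<bar>h x\<bar>) \<le> K (norm x) * (\<bar>m (u x)\<bar> * (B * norm x powr (- \<gamma>)))"
          using elim K_nonneg by (intro mult_left_mono) auto
        also have "\<dots> = B * (K (norm x) * \<bar>m (u x)\<bar> * norm x powr (- \<gamma>))" by simp
        also have "\<dots> \<le> B * (L * norm x powr (a - \<gamma> * (s + 1)))" using True elim B by (intro mult_left_mono) auto
        finally have "K (norm x) * (\<bar>m (u x)\<bar> * \<bar>h x\<bar>) \<le> (L * B) * norm x powr (a - \<gamma> * (s + 1))" by (simp add: mult_ac)
        from ennreal_leI[OF this] show ?thesis using True by (simp add: ennreal_mult'')
      qed simp
    qed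
    also have "\<dots> = ennreal (L * B) * ennreal I" unfolding I(2)[symmetric] by (rule nn_integral_cmult) measurable
    also have "\<dots> = ennreal (L * I * B)" using ennreal_mult''[OF I(1), of "L * B"] by (simp add: mult_ac)
    finally show ?thesis .
  qed
  moreover have "0 \<le> L * I" using L I by simp
  ultimately show ?thesis by blast
qed

text \<open>The last argument is normalised to $h/B$, so that the bound is linear in $B$.\<close>
lemma tail_integral_bound:
  assumes "0 \<le> A"
  shows "\<exists>T\<ge>0. \<forall>(u::real^'n \<Rightarrow> real) h B \<rho>. wbound V A u \<longrightarrow> wbound V B h \<longrightarrow> 1 \<le> \<rho> \<longrightarrow> R \<le> \<rho> \<longrightarrow>
    (\<integral>\<^sup>+x. ennreal (K (norm x) * (\<bar>m (u x)\<bar> * \<bar>h x\<bar>)) * indicator {\<rho><..} (norm x) \<partial>lborel) \<le> ennreal (T * \<rho> powr (- del / 2) * B)"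
proof -
  \<comment> \<open>The bound that \<open>wbound_add\<close> gives for |u| + |h / B|, whose summands
    have bounds A and 1.\<close>
  define A1 where "A1 = 2 * (A + 1)"
  have A1: "0 < A1" using assms by (simp add: A1_def)
  have "(\<integral>\<^sup>+x. ennreal (norm (x::real^'n) powr (- real CARD('n) - del / 2)) * indicator {1..} (norm x) \<partial>lborel) < \<infinity>"
    using del by (intro nn_integral_norm_powr_at_top) auto
  then obtain I where I: "0 \<le> I" "(\<integral>\<^sup>+x. ennreal (norm (x::real^'n) powr (- real CARD('n) - del / 2)) * indicator {1..} (norm x) \<partial>lborel) = ennreal I"
    by (rule ennreal_less_topE)
  define Q where "Q = M * C * A1 powr (q - 2 * \<beta>)"
  have Q: "0 \<le> Q" using M C by (simp add: Q_def)
  have "(\<integral>\<^sup>+x. ennreal (K (norm x) * (\<bar>m (u x)\<bar> * \<bar>h x\<bar>)) * indicator {\<rho><..} (norm x) \<partial>lborel) \<le> ennreal (Q * (A1\<^sup>2 + I) * \<rho> powr (- del / 2) * B)"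
    if u: "wbound V A u" and h: "wbound V B h" and \<rho>: "1 \<le> \<rho>" "R \<le> \<rho>" for u h :: "real^'n \<Rightarrow> real" and B \<rho>
  proof (cases "B = 0")
    case True
    \<comment> \<open>A direction with bound 0 vanishes almost everywhere; it cannot be
      normalised.\<close>
    have "AE x in lborel. ennreal (K (norm x) * (\<bar>m (u x)\<bar> * \<bar>h x\<bar>)) * indicator {\<rho><..} (norm x) = 0"
      using wboundD_pointwise[OF h] by eventually_elim (simp add: True)
    from nn_integral_cong_AE[OF this] show ?thesis by simp
  next
    case False
    then have B: "0 < B" using wbound_nonneg[OF h] by simp
    \<comment> \<open>Majorises both |u| and |h| / B, so that |m(u)| |h| <= C B z^q and the tail
      estimate is applied to a single function.\<close>
    define z where "z x = \<bar>u x\<bar> + \<bar>1 / B * h x\<bar>" for x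
    have "wbound V (\<bar>1 / B\<bar> * B) (\<lambda>x. 1 / B * h x)" by (rule wbound_scale[OF h V_meas'])
    then have "wbound V 1 (\<lambda>x. 1 / B * h x)" using B by simp
    then have z: "wbound V A1 z"
      unfolding A1_def z_def by (intro wbound_add wbound_abs u V_meas' AE_radial_weight_nonneg[OF V_nonneg])
    note [measurable] = wbound_measurable[OF z]
    let ?c = "Q * \<rho> powr (- del / 2) * B"
    have c: "0 \<le> ?c" using Q B by simp
    have "(\<integral>\<^sup>+x. ennreal (K (norm x) * (\<bar>m (u x)\<bar> * \<bar>h x\<bar>)) * indicator {\<rho><..} (norm x) \<partial>lborel)
      \<le> (\<integral>\<^sup>+x. ennreal ?c * (ennreal (V (norm x) * (z x)\<^sup>2) + ennreal (norm x powr (- real CARD('n) - del / 2)) * indicator {1..} (norm x)) \<partial>lborel)"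
    proof (rule nn_integral_mono_AE, use wboundD_pointwise[OF z] AE_radial_weight_nonneg[OF V_nonneg] AE_norm_pos in eventually_elim)
      case (elim x)
      let ?r = "norm x"
      show ?case
      proof (cases "\<rho> < ?r")
        case True
        then have r: "1 \<le> ?r" "R < ?r" using \<rho> by auto
        have z0: "0 \<le> z x" by (simp add: z_def)
        have "\<bar>m (u x)\<bar> \<le> C * z x powr (q - 1)"
          using C q by (intro order_trans[OF m_tail] mult_left_mono powr_mono2) (auto simp: z_def)
        moreover have "\<bar>h x\<bar> \<le> B * z x" using B by (simp add: z_def algebra_simps abs_mult)
        ultimately have "\<bar>m (u x)\<bar> * \<bar>h x\<bar> \<le> (C * z x powr (q - 1)) * (B * z x)"
          using C by (intro mult_mono) auto
        also have "\<dots> = C * B * (z x powr (q - 1) * z x powr 1)" using z0 by simp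
        also have "z x powr (q - 1) * z x powr 1 = z x powr q" unfolding powr_add[symmetric] by simp
        finally have mh: "\<bar>m (u x)\<bar> * \<bar>h x\<bar> \<le> C * B * z x powr q" .
        have "K ?r * (\<bar>m (u x)\<bar> * \<bar>h x\<bar>) \<le> (M * (?r powr \<alpha> * vpow (V ?r) \<beta>)) * (C * B * z x powr q)"
          using K_tail[OF r(2)] mh M by - (rule mult_mono, auto simp: vpow_nonneg)
        also have "\<dots> = M * C * B * (?r powr \<alpha> * vpow (V ?r) \<beta> * z x powr q)" by simp
        also have "\<dots> \<le> M * C * B * (A1 powr (q - 2 * \<beta>) * (?r powr (- del / 2) * (V ?r * (z x)\<^sup>2 + ?r powr (- real CARD('n) - del / 2))))"
          using elim z0 r b q del del_def M C B
          by (intro mult_left_mono tail_pointwise_bound[where \<gamma> = \<gamma>]) auto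
        also have "\<dots> \<le> M * C * B * (A1 powr (q - 2 * \<beta>) * (\<rho> powr (- del / 2) * (V ?r * (z x)\<^sup>2 + ?r powr (- real CARD('n) - del / 2))))"
          using True \<rho> del M C B elim by (intro mult_left_mono mult_right_mono powr_mono2') auto
        also have "\<dots> = ?c * (V ?r * (z x)\<^sup>2 + ?r powr (- real CARD('n) - del / 2))"
          by (simp add: Q_def mult_ac)
        finally have "ennreal (K ?r * (\<bar>m (u x)\<bar> * \<bar>h x\<bar>)) \<le> ennreal (?c * (V ?r * (z x)\<^sup>2 + ?r powr (- real CARD('n) - del / 2)))"
          by (rule ennreal_leI)
        also have "\<dots> = ennreal ?c * (ennreal (V ?r * (z x)\<^sup>2) + ennreal (?r powr (- real CARD('n) - del / 2)))"
          using c elim by (subst ennreal_mult) (auto simp: ennreal_plus)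
        finally show ?thesis using True r by simp
      qed simp
    qed
    also have "\<dots> = ennreal ?c * ((\<integral>\<^sup>+x. ennreal (V (norm x) * (z x)\<^sup>2) \<partial>lborel) + ennreal I)"
      unfolding I(2)[symmetric] by (subst nn_integral_cmult, measurable) (subst nn_integral_add, auto)
    also have "\<dots> \<le> ennreal ?c * (ennreal (A1\<^sup>2) + ennreal I)"
      using z unfolding wbound_def by (intro mult_left_mono add_mono) auto
    also have "\<dots> = ennreal (?c * (A1\<^sup>2 + I))"
      using c I(1) by (simp only: ennreal_mult ennreal_plus[symmetric] zero_le_power2 add_nonneg_nonneg)
    finally show ?thesis by (simp add: mult_ac)
  qed
  moreover have "0 \<le> Q * (A1\<^sup>2 + I)" using Q I by simp
  ultimately show ?thesis by blast
qed

lemma nn_integral_split_radius: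
  fixes F :: "real^'n \<Rightarrow> ennreal"
  assumes [measurable]: "F \<in> borel_measurable borel"
  shows "(\<integral>\<^sup>+x. F x \<partial>lborel) = (\<integral>\<^sup>+x. F x * indicator {..\<rho>} (norm x) \<partial>lborel) + (\<integral>\<^sup>+x. F x * indicator {\<rho><..} (norm x) \<partial>lborel)"
proof -
  have "(\<integral>\<^sup>+x. F x \<partial>lborel) = (\<integral>\<^sup>+x. F x * indicator {..\<rho>} (norm x) + F x * indicator {\<rho><..} (norm x) \<partial>lborel)"
    by (intro nn_integral_cong) (auto simp: indicator_def)
  also have "\<dots> = (\<integral>\<^sup>+x. F x * indicator {..\<rho>} (norm x) \<partial>lborel) + (\<integral>\<^sup>+x. F x * indicator {\<rho><..} (norm x) \<partial>lborel)"
    by (rule nn_integral_add) measurable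
  finally show ?thesis .
qed

lemma nonlinearity_bounded:
  assumes A: "0 \<le> A"
  shows "\<exists>L\<ge>0. \<forall>(u::real^'n \<Rightarrow> real) h B. wbound V A u \<longrightarrow> wbound V B h \<longrightarrow>
    (\<integral>\<^sup>+x. ennreal (K (norm x) * (\<bar>m (u x)\<bar> * \<bar>h x\<bar>)) \<partial>lborel) \<le> ennreal (L * B)"
proof -
  define \<rho> where "\<rho> = max 1 R"
  have \<rho>: "1 \<le> \<rho>" "R \<le> \<rho>" "0 \<le> \<rho>" by (auto simp: \<rho>_def)
  obtain L where L: "0 \<le> L" "\<And>(u::real^'n \<Rightarrow> real) h B. wbound V A u \<Longrightarrow> wbound V B h \<Longrightarrow>
    (\<integral>\<^sup>+x. ennreal (K (norm x) * (\<bar>m (u x)\<bar> * \<bar>h x\<bar>)) * indicator {..\<rho>} (norm x) \<partial>lborel) \<le> ennreal (L * B)"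
    using local_integral_bound[OF A \<rho>(3)] by blast
  obtain T where T: "0 \<le> T" "\<And>(u::real^'n \<Rightarrow> real) h B \<rho>. wbound V A u \<Longrightarrow> wbound V B h \<Longrightarrow> 1 \<le> \<rho> \<Longrightarrow> R \<le> \<rho> \<Longrightarrow>
    (\<integral>\<^sup>+x. ennreal (K (norm x) * (\<bar>m (u x)\<bar> * \<bar>h x\<bar>)) * indicator {\<rho><..} (norm x) \<partial>lborel) \<le> ennreal (T * \<rho> powr (- del / 2) * B)"
    using tail_integral_bound[OF A] by blast
  let ?T = "T * \<rho> powr (- del / 2)"
  have "(\<integral>\<^sup>+x. ennreal (K (norm x) * (\<bar>m (u x)\<bar> * \<bar>h x\<bar>)) \<partial>lborel) \<le> ennreal ((L + ?T) * B)"
    if u: "wbound V A u" and h: "wbound V B h" for u h :: "real^'n \<Rightarrow> real" and B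
  proof -
    note [measurable] = wbound_measurable[OF u] wbound_measurable[OF h]
    have B: "0 \<le> B" using wbound_nonneg[OF h] .
    have "(\<integral>\<^sup>+x. ennreal (K (norm x) * (\<bar>m (u x)\<bar> * \<bar>h x\<bar>)) \<partial>lborel) \<le> ennreal (L * B) + ennreal (?T * B)"
      by (subst nn_integral_split_radius[of _ \<rho>], measurable) (intro add_mono L(2)[OF u h] T(2)[OF u h \<rho>(1,2)])
    also have "\<dots> = ennreal ((L + ?T) * B)"
      using L T B by (subst ennreal_plus[symmetric]) (auto simp: distrib_right)
    finally show ?thesis .
  qed
  moreover have "0 \<le> L + ?T" using L T by simp
  ultimately show ?thesis by blast
qed

text \<open>By contradiction, with bounds 1/(n+1): the pointwise part of \<open>wbound\<close>
  forces v_n to tend to u almost everywhere without passing to a subsequence, and a common bound for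
  u and all v_n provides the majorant. As |x|^(-\<gamma>) stands in for the direction, \<delta> is
  uniform in h.\<close>

lemma local_continuity:
  fixes u :: "real^'n \<Rightarrow> real"
  assumes u: "wbound V A u" and \<epsilon>: "0 < \<epsilon>" and \<rho>: "0 \<le> \<rho>"
  shows "\<exists>\<delta>>0. \<delta> \<le> 1 \<and> (\<forall>v. wbound V \<delta> (\<lambda>x. v x - u x) \<longrightarrow>
    (\<integral>\<^sup>+x. ennreal (K (norm x) * (\<bar>m (v x) - m (u x)\<bar> * norm x powr (- \<gamma>))) * indicator {..\<rho>} (norm x) \<partial>lborel) \<le> ennreal \<epsilon>)"
proof (rule ccontr)
  assume neg: "\<not> ?thesis"
  let ?J = "\<lambda>v x. ennreal (K (norm x) * (\<bar>m (v x) - m (u x)\<bar> * norm x powr (- \<gamma>))) * indicator {..\<rho>} (norm x)"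
  define d where "d n = inverse (real (Suc n))" for n
  have d: "0 < d n" "d n \<le> 1" for n by (auto simp: d_def field_simps)
  have "\<exists>v. wbound V (d n) (\<lambda>x. v x - u x) \<and> ennreal \<epsilon> < (\<integral>\<^sup>+x. ?J v x \<partial>lborel)" for n
  proof -
    have "\<not> (\<forall>v. wbound V (d n) (\<lambda>x. v x - u x) \<longrightarrow> (\<integral>\<^sup>+x. ?J v x \<partial>lborel) \<le> ennreal \<epsilon>)"
      using neg d[of n] by blast
    then show ?thesis unfolding not_all not_imp not_le by blast
  qed
  then have "\<forall>n. \<exists>v. wbound V (d n) (\<lambda>x. v x - u x) \<and> ennreal \<epsilon> < (\<integral>\<^sup>+x. ?J v x \<partial>lborel)" by blast
  from choice[OF this] obtain v where v: "\<And>n. wbound V (d n) (\<lambda>x. v n x - u x)" "\<And>n. ennreal \<epsilon> < (\<integral>\<^sup>+x. ?J (v n) x \<partial>lborel)"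
    by blast
  \<comment> \<open>From v_n = (v_n - u) + u, where the difference has bound d n <= 1,
    \<open>wbound_add\<close> yields this constant for every n.\<close>
  define A' where "A' = 2 * (1 + A)"
  have A: "0 \<le> A" using wbound_nonneg[OF u] .
  have vb: "wbound V A' (v n)" for n
    using wbound_add[OF wbound_mono[OF v(1) d(2)] u V_meas' AE_radial_weight_nonneg[OF V_nonneg]] by (simp add: A'_def)
  have ub: "wbound V A' u" by (rule wbound_mono[OF u]) (use A in \<open>simp add: A'_def\<close>)
  note [measurable] = wbound_measurable[OF u] wbound_measurable[OF vb]
  obtain L where L: "0 \<le> L" "\<And>u::real^'n \<Rightarrow> real. wbound V A' u \<Longrightarrow>
    (AE x in lborel. norm x \<le> \<rho> \<longrightarrow> K (norm x) * \<bar>m (u x)\<bar> * norm x powr (- \<gamma>) \<le> L * norm x powr (a - \<gamma> * (s + 1)))"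
    using local_pointwise_bound[OF wbound_nonneg[OF ub]] by blast
  let ?w = "\<lambda>x::real^'n. ennreal (2 * L) * (ennreal (norm x powr (a - \<gamma> * (s + 1))) * indicator {..\<rho>} (norm x))"
  have "(\<lambda>n. \<integral>\<^sup>+x. ?J (v n) x \<partial>lborel) \<longlonglongrightarrow> (\<integral>\<^sup>+x. 0 \<partial>(lborel :: (real^'n) measure))"
  proof (rule nn_integral_dominated_convergence[where w = ?w])
    show "AE x in lborel. ?J (v n) x \<le> ?w x" for n
      using L(2)[OF ub] L(2)[OF vb[of n]] AE_norm_pos
    proof eventually_elim
      case (elim x)
      show ?case
      proof (cases "norm x \<le> \<rho>")
        case True
        have "K (norm x) * (\<bar>m (v n x) - m (u x)\<bar> * norm x powr (- \<gamma>)) \<le> K (norm x) * ((\<bar>m (v n x)\<bar> + \<bar>m (u x)\<bar>) * norm x powr (- \<gamma>))"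
          using elim K_nonneg by (intro mult_left_mono mult_right_mono) auto
        also have "\<dots> = K (norm x) * \<bar>m (v n x)\<bar> * norm x powr (- \<gamma>) + K (norm x) * \<bar>m (u x)\<bar> * norm x powr (- \<gamma>)"
          by (simp add: algebra_simps)
        also have "\<dots> \<le> 2 * L * norm x powr (a - \<gamma> * (s + 1))" using elim True by simp
        finally show ?thesis using True ennreal_leI by (simp add: ennreal_mult''[symmetric])
      qed simp
    qed
    show "(\<integral>\<^sup>+x. ?w x \<partial>lborel) < \<infinity>"
    proof -
      have "(\<integral>\<^sup>+x. ennreal (norm (x::real^'n) powr (a - \<gamma> * (s + 1))) * indicator {..\<rho>} (norm x) \<partial>lborel) < \<infinity>"
        using expo_local \<rho> by (intro nn_integral_norm_powr_near_0) auto
      then show ?thesis by (subst nn_integral_cmult) (auto simp: ennreal_mult_less_top)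
    qed
    show "AE x in lborel. (\<lambda>n. ?J (v n) x) \<longlonglongrightarrow> 0"
    proof -
      have "AE x in lborel. \<forall>n. \<bar>v n x - u x\<bar> \<le> d n * norm x powr (- \<gamma>)"
        using wboundD_pointwise[OF v(1)] by (simp add: AE_all_countable)
      then show ?thesis
      proof eventually_elim
        case (elim x)
        have "(\<lambda>n. v n x - u x) \<longlonglongrightarrow> 0"
        proof (rule Lim_null_comparison)
          show "\<forall>\<^sub>F n in sequentially. norm (v n x - u x) \<le> d n * norm x powr (- \<gamma>)" using elim by simp
          show "(\<lambda>n. d n * norm x powr (- \<gamma>)) \<longlonglongrightarrow> 0"
            unfolding d_def by (intro tendsto_mult_left_zero LIMSEQ_inverse_real_of_nat)
        qed
        then have "(\<lambda>n. v n x) \<longlonglongrightarrow> u x" by (simp add: LIM_zero_iff)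
        then have "(\<lambda>n. m (v n x)) \<longlonglongrightarrow> m (u x)"
          using continuous_on_tendsto_compose[OF m_cont] by auto
        then have "(\<lambda>n. K (norm x) * (\<bar>m (v n x) - m (u x)\<bar> * norm x powr (- \<gamma>))) \<longlonglongrightarrow> K (norm x) * (\<bar>m (u x) - m (u x)\<bar> * norm x powr (- \<gamma>))"
          by (intro tendsto_mult tendsto_const tendsto_rabs tendsto_diff)
        then have "(\<lambda>n. ennreal (K (norm x) * (\<bar>m (v n x) - m (u x)\<bar> * norm x powr (- \<gamma>)))) \<longlonglongrightarrow> ennreal 0"
          by (intro tendsto_ennrealI) simp
        then show ?case by (cases "norm x \<le> \<rho>") auto
      qed
    qed
  qed measurable
  then have "(\<lambda>n. \<integral>\<^sup>+x. ?J (v n) x \<partial>lborel) \<longlonglongrightarrow> 0" by simp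
  then have "\<forall>\<^sub>F n in sequentially. (\<integral>\<^sup>+x. ?J (v n) x \<partial>lborel) < ennreal \<epsilon>"
    using \<epsilon> by (intro order_tendstoD(2)) auto
  then obtain n where "(\<integral>\<^sup>+x. ?J (v n) x \<partial>lborel) < ennreal \<epsilon>"
    using eventually_happens'[OF sequentially_bot] by blast
  then show False using v(2)[of n] by (simp add: less_le_not_le)
qed

text \<open>The radius is fixed first: the tail bounds depend only on a common constant for u and v,
  so both tails are made small before \<delta> is known. The condition \<delta> <= 1 keeps v under
  that constant. The ball receives \<epsilon>/2 and each tail \<epsilon>/4.\<close>

lemma nonlinearity_continuous:
  fixes u :: "real^'n \<Rightarrow> real"
  assumes u: "wbound V A u" and \<epsilon>: "0 < \<epsilon>"
  shows "\<exists>\<delta>>0. \<forall>v h B. wbound V \<delta> (\<lambda>x. v x - u x) \<longrightarrow> wbound V B h \<longrightarrow>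
    (\<integral>\<^sup>+x. ennreal (K (norm x) * (\<bar>m (v x) - m (u x)\<bar> * \<bar>h x\<bar>)) \<partial>lborel) \<le> ennreal (\<epsilon> * B)"
proof -
  define A' where "A' = 2 * (1 + A)"
  have A: "0 \<le> A" "0 \<le> A'" using wbound_nonneg[OF u] by (auto simp: A'_def)
  have ub: "wbound V A' u" by (rule wbound_mono[OF u]) (use A in \<open>simp add: A'_def\<close>)
  obtain T where T: "0 \<le> T" "\<And>(u::real^'n \<Rightarrow> real) h B \<rho>. wbound V A' u \<Longrightarrow> wbound V B h \<Longrightarrow> 1 \<le> \<rho> \<Longrightarrow> R \<le> \<rho> \<Longrightarrow>
    (\<integral>\<^sup>+x. ennreal (K (norm x) * (\<bar>m (u x)\<bar> * \<bar>h x\<bar>)) * indicator {\<rho><..} (norm x) \<partial>lborel) \<le> ennreal (T * \<rho> powr (- del / 2) * B)"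
    using tail_integral_bound[OF A(2)] by blast
  have "((\<lambda>\<rho>. T * \<rho> powr (- del / 2)) \<longlongrightarrow> T * 0) at_top"
    using del by (intro tendsto_intros tendsto_neg_powr filterlim_ident) auto
  then have "\<forall>\<^sub>F \<rho> in at_top. T * \<rho> powr (- del / 2) < \<epsilon> / 4" using \<epsilon> by (intro order_tendstoD(2)) auto
  then have "\<forall>\<^sub>F \<rho> in at_top. T * \<rho> powr (- del / 2) < \<epsilon> / 4 \<and> 1 \<le> \<rho> \<and> R \<le> \<rho>"
    by (intro eventually_conj eventually_ge_at_top)
  then obtain \<rho> where \<rho>: "T * \<rho> powr (- del / 2) < \<epsilon> / 4" "1 \<le> \<rho>" "R \<le> \<rho>"
    using eventually_happens'[OF trivial_limit_at_top_linorder] by blast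
  have "0 < \<epsilon> / 2" "0 \<le> \<rho>" using \<epsilon> \<rho> by auto
  then obtain \<delta> where \<delta>: "0 < \<delta>" "\<delta> \<le> 1" "\<And>v. wbound V \<delta> (\<lambda>x. v x - u x) \<Longrightarrow>
    (\<integral>\<^sup>+x. ennreal (K (norm x) * (\<bar>m (v x) - m (u x)\<bar> * norm x powr (- \<gamma>))) * indicator {..\<rho>} (norm x) \<partial>lborel) \<le> ennreal (\<epsilon> / 2)"
    using local_continuity[OF u] by blast
  have "(\<integral>\<^sup>+x. ennreal (K (norm x) * (\<bar>m (v x) - m (u x)\<bar> * \<bar>h x\<bar>)) \<partial>lborel) \<le> ennreal (\<epsilon> * B)"
    if v: "wbound V \<delta> (\<lambda>x. v x - u x)" and h: "wbound V B h" for v h :: "real^'n \<Rightarrow> real" and B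
  proof -
    have B: "0 \<le> B" using wbound_nonneg[OF h] .
    have vb: "wbound V A' v"
      using wbound_add[OF wbound_mono[OF v \<delta>(2)] u V_meas' AE_radial_weight_nonneg[OF V_nonneg]] by (simp add: A'_def)
    note [measurable] = wbound_measurable[OF u] wbound_measurable[OF h] wbound_measurable[OF vb]
    let ?F = "\<lambda>x. ennreal (K (norm x) * (\<bar>m (v x) - m (u x)\<bar> * \<bar>h x\<bar>))"
    have 1: "(\<integral>\<^sup>+x. ?F x * indicator {..\<rho>} (norm x) \<partial>lborel) \<le> ennreal (\<epsilon> / 2 * B)"
    proof -
      have "(\<integral>\<^sup>+x. ?F x * indicator {..\<rho>} (norm x) \<partial>lborel)
        \<le> (\<integral>\<^sup>+x. ennreal B * (ennreal (K (norm x) * (\<bar>m (v x) - m (u x)\<bar> * norm x powr (- \<gamma>))) * indicator {..\<rho>} (norm x)) \<partial>lborel)"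
      proof (rule nn_integral_mono_AE, use wboundD_pointwise[OF h] AE_norm_pos in eventually_elim)
        case (elim x)
        have "K (norm x) * (\<bar>m (v x) - m (u x)\<bar> * \<bar>h x\<bar>) \<le> K (norm x) * (\<bar>m (v x) - m (u x)\<bar> * (B * norm x powr (- \<gamma>)))"
          using elim K_nonneg by (intro mult_left_mono) auto
        then have "K (norm x) * (\<bar>m (v x) - m (u x)\<bar> * \<bar>h x\<bar>) \<le> B * (K (norm x) * (\<bar>m (v x) - m (u x)\<bar> * norm x powr (- \<gamma>)))"
          by (simp only: mult_ac)
        from ennreal_leI[OF this] show ?case
          using B by (auto simp: ennreal_mult' indicator_def)
      qed
      also have "\<dots> = ennreal B * (\<integral>\<^sup>+x. ennreal (K (norm x) * (\<bar>m (v x) - m (u x)\<bar> * norm x powr (- \<gamma>))) * indicator {..\<rho>} (norm x) \<partial>lborel)"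
        by (rule nn_integral_cmult) measurable
      also have "\<dots> \<le> ennreal B * ennreal (\<epsilon> / 2)" by (intro mult_left_mono \<delta>(3) v) simp
      also have "\<dots> = ennreal (\<epsilon> / 2 * B)" using B \<epsilon> by (simp add: ennreal_mult''[symmetric] mult_ac)
      finally show ?thesis .
    qed
    have 2: "(\<integral>\<^sup>+x. ?F x * indicator {\<rho><..} (norm x) \<partial>lborel) \<le> ennreal (\<epsilon> / 2 * B)"
    proof -
      have t: "(\<integral>\<^sup>+x. ennreal (K (norm x) * (\<bar>m (f x)\<bar> * \<bar>h x\<bar>)) * indicator {\<rho><..} (norm x) \<partial>lborel) \<le> ennreal (\<epsilon> / 4 * B)"
        if "wbound V A' f" for f
        using \<rho> B by (intro order_trans[OF T(2)[OF that h \<rho>(2,3)]] ennreal_leI mult_right_mono) auto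
      have "(\<integral>\<^sup>+x. ?F x * indicator {\<rho><..} (norm x) \<partial>lborel)
        \<le> (\<integral>\<^sup>+x. ennreal (K (norm x) * (\<bar>m (v x)\<bar> * \<bar>h x\<bar>)) * indicator {\<rho><..} (norm x)
              + ennreal (K (norm x) * (\<bar>m (u x)\<bar> * \<bar>h x\<bar>)) * indicator {\<rho><..} (norm x) \<partial>lborel)"
      proof (rule nn_integral_mono_AE, use AE_norm_pos in eventually_elim)
        case (elim x)
        have K: "0 \<le> K (norm x)" using elim K_nonneg by simp
        then have "K (norm x) * (\<bar>m (v x) - m (u x)\<bar> * \<bar>h x\<bar>) \<le> K (norm x) * ((\<bar>m (v x)\<bar> + \<bar>m (u x)\<bar>) * \<bar>h x\<bar>)"
          by (intro mult_left_mono mult_right_mono) auto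
        also have "\<dots> = K (norm x) * (\<bar>m (v x)\<bar> * \<bar>h x\<bar>) + K (norm x) * (\<bar>m (u x)\<bar> * \<bar>h x\<bar>)" by (simp add: algebra_simps)
        finally have "?F x \<le> ennreal \<dots>" by (rule ennreal_leI)
        then show ?case using K by (auto simp: indicator_def)
      qed
      also have "\<dots> = (\<integral>\<^sup>+x. ennreal (K (norm x) * (\<bar>m (v x)\<bar> * \<bar>h x\<bar>)) * indicator {\<rho><..} (norm x) \<partial>lborel)
          + (\<integral>\<^sup>+x. ennreal (K (norm x) * (\<bar>m (u x)\<bar> * \<bar>h x\<bar>)) * indicator {\<rho><..} (norm x) \<partial>lborel)"
        by (rule nn_integral_add) measurable
      also have "\<dots> \<le> ennreal (\<epsilon> / 4 * B) + ennreal (\<epsilon> / 4 * B)" by (intro add_mono t ub vb)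
      also have "\<dots> = ennreal (\<epsilon> / 2 * B)" using \<epsilon> B by (subst ennreal_plus[symmetric]) auto
      finally show ?thesis .
    qed
    have "(\<integral>\<^sup>+x. ?F x \<partial>lborel) \<le> ennreal (\<epsilon> / 2 * B) + ennreal (\<epsilon> / 2 * B)"
      by (subst nn_integral_split_radius[of _ \<rho>], measurable) (intro add_mono 1 2)
    also have "\<dots> = ennreal (\<epsilon> * B)" using \<epsilon> B by (subst ennreal_plus[symmetric]) auto
    finally show ?thesis .
  qed
  then show ?thesis using \<delta>(1) by blast
qed

end

section \<open>Continuously differentiable functionals\<close>

lemma DERIV_Gprim:
  assumes "continuous_on UNIV g"
  shows "(Gprim g has_real_derivative g t) (at t)"
proof -
  \<comment> \<open>An interval with 0 and t in its interior, so that the derivative within it is a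
    two-sided one.\<close>
  let ?a = "- \<bar>t\<bar> - 1" and ?b = "\<bar>t\<bar> + 1"
  have "((\<lambda>u. LBINT s=ereal 0..ereal u. g s) has_vector_derivative g t) (at t within {?a..?b})"
    by (rule interval_integral_FTC2) (use continuous_on_subset[OF assms] in auto)
  then have "(Gprim g has_real_derivative g t) (at t within {?a..?b})"
    unfolding Gprim_def[abs_def] has_real_derivative_iff_has_vector_derivative zero_ereal_def .
  moreover have "at t within {?a..?b} = at t" by (rule at_within_interior) auto
  ultimately show ?thesis by simp
qed

text \<open>First bound: |f|^(q1-1) f' = |f|^(q1-2) |f f'| and |f|^(q1-2) = (f^2)^((q1-2)/2), so |f
  f'| <= 1 and f^2 <= 2|t| halve the exponent. Second bound: |f(t)| <= |t| and f' <= 1 keep the full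
  power.\<close>

lemma nonlinearity_growth:
  fixes g :: "real \<Rightarrow> real"
  assumes g: "\<And>t. \<bar>g t\<bar> \<le> C * min (\<bar>t\<bar> powr (q1 - 1)) (\<bar>t\<bar> powr (q2 - 1))"
    and C: "0 \<le> C" and q: "2 \<le> q1" "1 \<le> q2"
  shows "\<bar>g (fsol t) * fsol' t\<bar> \<le> (C * 2 powr ((q1 - 2) / 2)) * \<bar>t\<bar> powr ((q1 - 2) / 2)"
    "\<bar>g (fsol t) * fsol' t\<bar> \<le> C * \<bar>t\<bar> powr (q2 - 1)"
proof -
  let ?f = "\<bar>fsol t\<bar>"
  have g1: "\<bar>g (fsol t)\<bar> \<le> C * ?f powr (q1 - 1)" "\<bar>g (fsol t)\<bar> \<le> C * ?f powr (q2 - 1)"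
    using C by (auto intro!: order_trans[OF g] mult_left_mono)
  have "\<bar>g (fsol t) * fsol' t\<bar> = \<bar>g (fsol t)\<bar> * fsol' t" using fsol'_pos[of t] by (simp add: abs_mult)
  also have "\<dots> \<le> (C * ?f powr (q1 - 1)) * fsol' t" using g1 fsol'_pos[of t] by (intro mult_right_mono) auto
  also have "\<dots> = C * (?f powr (q1 - 2) * (?f * fsol' t))"
  proof -
    have "?f powr (q1 - 1) = ?f powr (q1 - 2) * ?f powr 1" unfolding powr_add[symmetric] by simp
    then show ?thesis by simp
  qed
  also have "\<dots> \<le> C * (?f powr (q1 - 2) * 1)"
    using C abs_fsol_prod_le_1[of t] fsol'_pos[of t] by (intro mult_left_mono) (auto simp: abs_mult)
  also have "?f powr (q1 - 2) = (?f\<^sup>2) powr ((q1 - 2) / 2)"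
  proof (cases "fsol t = 0")
    case False
    then have "?f\<^sup>2 = ?f powr 2" by simp
    moreover have "2 * ((q1 - 2) / 2) = q1 - 2" by simp
    ultimately show ?thesis by (simp only: powr_powr)
  qed simp
  also have "C * ((?f\<^sup>2) powr ((q1 - 2) / 2) * 1) \<le> C * ((2 * \<bar>t\<bar>) powr ((q1 - 2) / 2) * 1)"
    using C fsol_sq_le[of t] q by (intro mult_left_mono mult_right_mono powr_mono2) auto
  finally show "\<bar>g (fsol t) * fsol' t\<bar> \<le> (C * 2 powr ((q1 - 2) / 2)) * \<bar>t\<bar> powr ((q1 - 2) / 2)"
    by (simp add: powr_mult mult.assoc)
  have "\<bar>g (fsol t) * fsol' t\<bar> = \<bar>g (fsol t)\<bar> * fsol' t" using fsol'_pos[of t] by (simp add: abs_mult)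
  also have "\<dots> \<le> (C * ?f powr (q2 - 1)) * 1"
    using g1 C fsol'_pos[of t] fsol'_le_1[of t] by (intro mult_mono) auto
  also have "\<dots> \<le> C * \<bar>t\<bar> powr (q2 - 1)"
    using C q abs_fsol_le[of t] by (simp, intro mult_left_mono powr_mono2) auto
  finally show "\<bar>g (fsol t) * fsol' t\<bar> \<le> C * \<bar>t\<bar> powr (q2 - 1)" .
qed

text \<open>Near 0 the inequality V <= C / r^2 turns V^\<beta> into r^(-2\<beta>); on the remaining
  compact interval up to \<rho> continuity of K is enough.\<close>

lemma weight_local_bound:
  fixes V K :: "real \<Rightarrow> real"
  assumes K_cont: "continuous_on {0<..} K" and V_nonneg: "\<forall>r>0. V r \<ge> 0"
    and V: "0 < C" "\<And>r. 0 < r \<Longrightarrow> r < 1 \<Longrightarrow> V r \<le> C / r\<^sup>2"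
    and K: "0 < R" "\<And>r. 0 < r \<Longrightarrow> r < R \<Longrightarrow> K r \<le> M * (r powr \<alpha> * vpow (V r) \<beta>)" and b: "0 \<le> \<beta>"
  shows "\<exists>L\<ge>0. \<forall>r. 0 < r \<longrightarrow> r \<le> \<rho> \<longrightarrow> K r \<le> L * r powr (\<alpha> - 2 * \<beta>)"
proof -
  \<comment> \<open>Below both R and 1, where the bounds on K and on V are available
    together.\<close>
  define r0 where "r0 = min R 1 / 2"
  have r0: "0 < r0" "r0 < R" "r0 < 1" using K(1) by (auto simp: r0_def)
  have near: "K r \<le> (\<bar>M\<bar> * vpow C \<beta>) * r powr (\<alpha> - 2 * \<beta>)" if r: "0 < r" "r \<le> r0" for r
  proof -
    have "vpow (V r) \<beta> \<le> vpow C \<beta> * r powr (- 2 * \<beta>)"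
    proof (cases "\<beta> = 0")
      case False
      have "V r powr \<beta> \<le> (C / r\<^sup>2) powr \<beta>" using r r0 V V_nonneg b by (intro powr_mono2) auto
      also have "\<dots> = C powr \<beta> * r powr (- 2 * \<beta>)"
      proof -
        have "C / r\<^sup>2 = C * r powr (- 2)" using r by (simp add: powr_minus divide_inverse)
        then show ?thesis using V(1) by (simp add: powr_mult powr_powr)
      qed
      finally show ?thesis using False by (simp add: vpow_def)
    qed (use r in \<open>simp add: vpow_def\<close>)
    then have "r powr \<alpha> * vpow (V r) \<beta> \<le> r powr \<alpha> * (vpow C \<beta> * r powr (- 2 * \<beta>))" by (intro mult_left_mono) auto
    also have "\<dots> = vpow C \<beta> * (r powr \<alpha> * r powr (- 2 * \<beta>))" by simp
    also have "r powr \<alpha> * r powr (- 2 * \<beta>) = r powr (\<alpha> - 2 * \<beta>)" unfolding powr_add[symmetric] by simp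
    finally have *: "r powr \<alpha> * vpow (V r) \<beta> \<le> vpow C \<beta> * r powr (\<alpha> - 2 * \<beta>)" .
    have "K r \<le> M * (r powr \<alpha> * vpow (V r) \<beta>)" using K(2) r r0 by simp
    also have "\<dots> \<le> \<bar>M\<bar> * (r powr \<alpha> * vpow (V r) \<beta>)" by (intro mult_right_mono) (auto simp: vpow_nonneg)
    also have "\<dots> \<le> \<bar>M\<bar> * (vpow C \<beta> * r powr (\<alpha> - 2 * \<beta>))" using * by (intro mult_left_mono) auto
    finally show ?thesis by simp
  qed
  have "compact ((\<lambda>r. K r * r powr - (\<alpha> - 2 * \<beta>)) ` {r0..\<rho>})"
    using r0 by (intro compact_continuous_image continuous_intros continuous_on_subset[OF K_cont]) auto
  then have "bounded ((\<lambda>r. K r * r powr - (\<alpha> - 2 * \<beta>)) ` {r0..\<rho>})" by (rule compact_imp_bounded)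
  then obtain B where "\<forall>y \<in> (\<lambda>r. K r * r powr - (\<alpha> - 2 * \<beta>)) ` {r0..\<rho>}. norm y \<le> B" unfolding bounded_iff by blast
  then have B: "\<bar>K r * r powr - (\<alpha> - 2 * \<beta>)\<bar> \<le> B" if "r0 \<le> r" "r \<le> \<rho>" for r using that by simp
  define L where "L = max (\<bar>M\<bar> * vpow C \<beta>) B"
  have "K r \<le> L * r powr (\<alpha> - 2 * \<beta>)" if r: "0 < r" "r \<le> \<rho>" for r
  proof (cases "r \<le> r0")
    case True
    have "K r \<le> (\<bar>M\<bar> * vpow C \<beta>) * r powr (\<alpha> - 2 * \<beta>)" using near r True by simp
    also have "\<dots> \<le> L * r powr (\<alpha> - 2 * \<beta>)" by (intro mult_right_mono) (auto simp: L_def)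
    finally show ?thesis .
  next
    case False
    have "K r = K r * r powr - (\<alpha> - 2 * \<beta>) * r powr (\<alpha> - 2 * \<beta>)" using r by (simp add: mult.assoc powr_add[symmetric])
    also have "\<dots> \<le> L * r powr (\<alpha> - 2 * \<beta>)"
      using B[of r] r False by (intro mult_right_mono) (auto simp: L_def)
    finally show ?thesis .
  qed
  moreover have "0 \<le> L" by (auto simp: L_def vpow_nonneg le_max_iff_disj)
  ultimately show ?thesis by blast
qed

text \<open>Frechet differentiability is spelled out for a set of functions with a gauge, since E is
  a set and not a normed type. Linearity of \<open>J' u\<close> is left to a separate
  argument.\<close>

definition C1_functional ::
  "('a \<Rightarrow> real) set \<Rightarrow> (('a \<Rightarrow> real) \<Rightarrow> real) \<Rightarrow> (('a \<Rightarrow> real) \<Rightarrow> real) \<Rightarrow> (('a \<Rightarrow> real) \<Rightarrow> ('a \<Rightarrow> real) \<Rightarrow> real) \<Rightarrow> bool" where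
  "C1_functional E nrm J J' \<longleftrightarrow>
     (\<forall>u\<in>E. \<exists>M. \<forall>h\<in>E. \<bar>J' u h\<bar> \<le> M * nrm h) \<and>
     (\<forall>u\<in>E. \<forall>\<epsilon>>0. \<exists>\<delta>>0. \<forall>h\<in>E. nrm h < \<delta> \<longrightarrow> \<bar>J (\<lambda>x. u x + h x) - J u - J' u h\<bar> \<le> \<epsilon> * nrm h) \<and>
     (\<forall>u\<in>E. \<forall>\<epsilon>>0. \<exists>\<delta>>0. \<forall>v\<in>E. nrm (\<lambda>x. v x - u x) < \<delta> \<longrightarrow> (\<forall>h\<in>E. \<bar>J' v h - J' u h\<bar> \<le> \<epsilon> * nrm h))"

lemma
  assumes "C1_functional E nrm J J'" "u \<in> E"
  shows C1_functional_bounded: "\<exists>M. \<forall>h\<in>E. \<bar>J' u h\<bar> \<le> M * nrm h"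
    and C1_functional_derivative: "0 < \<epsilon> \<Longrightarrow> \<exists>\<delta>>0. \<forall>h\<in>E. nrm h < \<delta> \<longrightarrow> \<bar>J (\<lambda>x. u x + h x) - J u - J' u h\<bar> \<le> \<epsilon> * nrm h"
    and C1_functional_derivative_continuous: "0 < \<epsilon> \<Longrightarrow>
      \<exists>\<delta>>0. \<forall>v\<in>E. nrm (\<lambda>x. v x - u x) < \<delta> \<longrightarrow> (\<forall>h\<in>E. \<bar>J' v h - J' u h\<bar> \<le> \<epsilon> * nrm h)"
  using assms unfolding C1_functional_def by auto

text \<open>The second error is divided by |c| + 1 rather than |c|, which covers c = 0.\<close>

lemma abs_lincomb_bound:
  fixes x y c e n :: real
  assumes "\<bar>x\<bar> \<le> e / 2 * n" "\<bar>y\<bar> \<le> e / (2 * (\<bar>c\<bar> + 1)) * n"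
  shows "\<bar>x + c * y\<bar> \<le> e * n"
proof -
  have "(\<bar>c\<bar> + 1) * \<bar>y\<bar> \<le> (\<bar>c\<bar> + 1) * (e / (2 * (\<bar>c\<bar> + 1)) * n)" using assms(2) by (intro mult_left_mono) auto
  also have "\<dots> = e / 2 * n" by (simp add: divide_simps)
  finally have "\<bar>c\<bar> * \<bar>y\<bar> + \<bar>y\<bar> \<le> e / 2 * n" by (simp add: distrib_right)
  moreover have "\<bar>x + c * y\<bar> \<le> \<bar>x\<bar> + \<bar>c\<bar> * \<bar>y\<bar>" using abs_triangle_ineq[of x "c * y"] by (simp add: abs_mult)
  ultimately have "\<bar>x + c * y\<bar> \<le> e / 2 * n + e / 2 * n" using assms(1) abs_ge_zero[of y] by linarith
  then show ?thesis by simp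
qed

lemma C1_functional_lincomb:
  assumes 1: "C1_functional E nrm J1 J1'" and 2: "C1_functional E nrm J2 J2'"
  shows "C1_functional E nrm (\<lambda>u. J1 u + c * J2 u) (\<lambda>u h. J1' u h + c * J2' u h)"
  unfolding C1_functional_def
proof (intro conjI ballI allI impI)
  fix u assume u: "u \<in> E"
  obtain M1 where M1: "\<And>h. h \<in> E \<Longrightarrow> \<bar>J1' u h\<bar> \<le> M1 * nrm h"
    using C1_functional_bounded[OF 1 u] by blast
  obtain M2 where M2: "\<And>h. h \<in> E \<Longrightarrow> \<bar>J2' u h\<bar> \<le> M2 * nrm h"
    using C1_functional_bounded[OF 2 u] by blast
  have "\<bar>J1' u h + c * J2' u h\<bar> \<le> (M1 + \<bar>c\<bar> * M2) * nrm h" if h: "h \<in> E" for h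
  proof -
    have "\<bar>J1' u h + c * J2' u h\<bar> \<le> \<bar>J1' u h\<bar> + \<bar>c\<bar> * \<bar>J2' u h\<bar>"
      using abs_triangle_ineq[of "J1' u h" "c * J2' u h"] by (simp add: abs_mult)
    also have "\<dots> \<le> M1 * nrm h + \<bar>c\<bar> * (M2 * nrm h)" by (intro add_mono mult_left_mono M1 M2 h) auto
    finally show ?thesis by (simp add: algebra_simps)
  qed
  then show "\<exists>M. \<forall>h\<in>E. \<bar>J1' u h + c * J2' u h\<bar> \<le> M * nrm h" by blast
  fix e :: real assume e: "0 < e"
  then have e2: "0 < e / 2" "0 < e / (2 * (\<bar>c\<bar> + 1))" by auto
  obtain d1 where d1: "0 < d1" "\<And>h. h \<in> E \<Longrightarrow> nrm h < d1 \<Longrightarrow> \<bar>J1 (\<lambda>x. u x + h x) - J1 u - J1' u h\<bar> \<le> e / 2 * nrm h"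
    using C1_functional_derivative[OF 1 u e2(1)] by blast
  obtain d2 where d2: "0 < d2" "\<And>h. h \<in> E \<Longrightarrow> nrm h < d2 \<Longrightarrow> \<bar>J2 (\<lambda>x. u x + h x) - J2 u - J2' u h\<bar> \<le> e / (2 * (\<bar>c\<bar> + 1)) * nrm h"
    using C1_functional_derivative[OF 2 u e2(2)] by blast
  show "\<exists>d>0. \<forall>h\<in>E. nrm h < d \<longrightarrow> \<bar>J1 (\<lambda>x. u x + h x) + c * J2 (\<lambda>x. u x + h x) - (J1 u + c * J2 u) - (J1' u h + c * J2' u h)\<bar> \<le> e * nrm h"
  proof (intro exI[of _ "min d1 d2"] conjI ballI impI)
    fix h assume h: "h \<in> E" "nrm h < min d1 d2"
    then have "\<bar>(J1 (\<lambda>x. u x + h x) - J1 u - J1' u h) + c * (J2 (\<lambda>x. u x + h x) - J2 u - J2' u h)\<bar> \<le> e * nrm h"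
      by (intro abs_lincomb_bound d1 d2) auto
    then show "\<bar>J1 (\<lambda>x. u x + h x) + c * J2 (\<lambda>x. u x + h x) - (J1 u + c * J2 u) - (J1' u h + c * J2' u h)\<bar> \<le> e * nrm h"
      by (simp add: algebra_simps)
  qed (use d1 d2 in auto)
  obtain d1 where d1: "0 < d1" "\<And>v h. v \<in> E \<Longrightarrow> nrm (\<lambda>x. v x - u x) < d1 \<Longrightarrow> h \<in> E \<Longrightarrow> \<bar>J1' v h - J1' u h\<bar> \<le> e / 2 * nrm h"
    using C1_functional_derivative_continuous[OF 1 u e2(1)] by blast
  obtain d2 where d2: "0 < d2" "\<And>v h. v \<in> E \<Longrightarrow> nrm (\<lambda>x. v x - u x) < d2 \<Longrightarrow> h \<in> E \<Longrightarrow> \<bar>J2' v h - J2' u h\<bar> \<le> e / (2 * (\<bar>c\<bar> + 1)) * nrm h"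
    using C1_functional_derivative_continuous[OF 2 u e2(2)] by blast
  show "\<exists>d>0. \<forall>v\<in>E. nrm (\<lambda>x. v x - u x) < d \<longrightarrow> (\<forall>h\<in>E. \<bar>J1' v h + c * J2' v h - (J1' u h + c * J2' u h)\<bar> \<le> e * nrm h)"
  proof (intro exI[of _ "min d1 d2"] conjI ballI impI)
    fix v h assume h: "v \<in> E" "nrm (\<lambda>x. v x - u x) < min d1 d2" "h \<in> E"
    then have "\<bar>(J1' v h - J1' u h) + c * (J2' v h - J2' u h)\<bar> \<le> e * nrm h"
      by (intro abs_lincomb_bound d1 d2) auto
    then show "\<bar>J1' v h + c * J2' v h - (J1' u h + c * J2' u h)\<bar> \<le> e * nrm h" by (simp add: algebra_simps)
  qed (use d1 d2 in auto)
qed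

text \<open>Differentiability with tolerance 1 and boundedness of the derivative give |J v - J u| <=
  (|M| + 1) times the distance, for v near u.\<close>

lemma C1_functional_continuous:
  assumes C1: "C1_functional E nrm J J'" and nrm: "\<And>h. 0 \<le> nrm h"
    and diff: "\<And>u v. u \<in> E \<Longrightarrow> v \<in> E \<Longrightarrow> (\<lambda>x. v x - u x) \<in> E"
    and u: "u \<in> E" and e: "0 < \<epsilon>"
  shows "\<exists>\<delta>>0. \<forall>v\<in>E. nrm (\<lambda>x. v x - u x) < \<delta> \<longrightarrow> \<bar>J v - J u\<bar> < \<epsilon>"
proof -
  obtain M where M: "\<And>h. h \<in> E \<Longrightarrow> \<bar>J' u h\<bar> \<le> M * nrm h" using C1_functional_bounded[OF C1 u] by blast
  obtain d where d: "0 < d" "\<And>h. h \<in> E \<Longrightarrow> nrm h < d \<Longrightarrow> \<bar>J (\<lambda>x. u x + h x) - J u - J' u h\<bar> \<le> 1 * nrm h"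
    using C1_functional_derivative[OF C1 u zero_less_one] by blast
  have M1: "0 < \<bar>M\<bar> + 1" by simp
  show ?thesis
  proof (intro exI[of _ "min d (\<epsilon> / (\<bar>M\<bar> + 1))"] conjI ballI impI)
    show "0 < min d (\<epsilon> / (\<bar>M\<bar> + 1))" using d e by simp
    fix v assume v: "v \<in> E" and n: "nrm (\<lambda>x. v x - u x) < min d (\<epsilon> / (\<bar>M\<bar> + 1))"
    let ?h = "\<lambda>x. v x - u x"
    have h: "?h \<in> E" using diff u v by simp
    have "\<bar>J v - J u - J' u ?h\<bar> \<le> nrm ?h" using d(2)[OF h] n by simp
    moreover have "\<bar>J' u ?h\<bar> \<le> \<bar>M\<bar> * nrm ?h"
      using M[OF h] mult_right_mono[OF abs_ge_self nrm, of M ?h] by linarith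
    ultimately have "\<bar>J v - J u\<bar> \<le> (\<bar>M\<bar> + 1) * nrm ?h" by (simp add: distrib_right)
    also have "\<dots> < \<epsilon>" using n M1 by (simp add: less_divide_eq mult.commute)
    finally show "\<bar>J v - J u\<bar> < \<epsilon>" .
  qed
qed

text \<open>The embedding into \<open>wbound\<close> is available for every l above the norm but not
  at the norm itself; letting l decrease to y restores estimates in terms of the norm. The upper
  limit b leaves room for a smallness condition on l.\<close>

lemma le_mult_if_le_above:
  fixes x c y b :: real
  assumes "\<And>l. y < l \<Longrightarrow> l < b \<Longrightarrow> x \<le> c * l" and "y < b"
  shows "x \<le> c * y"
proof (rule tendsto_lowerbound)
  show "((\<lambda>l. c * l) \<longlongrightarrow> c * y) (at_right y)" by (intro tendsto_intros)
  show "\<forall>\<^sub>F l in at_right y. x \<le> c * l"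
    using assms unfolding eventually_at_right[OF assms(2)] by blast
qed simp

text \<open>Transfers the estimates from \<open>wbound\<close> to the norm: tolerances and radii are
  divided by C because a norm below l means a bound C l.\<close>

lemma (in integral_functional) C1_functional_if_wbound:
  assumes C: "0 < C" and emb: "\<And>u l. u \<in> E \<Longrightarrow> nrm u < l \<Longrightarrow> wbound V (C * l) u"
    and diff: "\<And>u v. u \<in> E \<Longrightarrow> v \<in> E \<Longrightarrow> (\<lambda>x. v x - u x) \<in> E"
  shows "C1_functional E nrm (\<lambda>u. \<integral>x. W x * \<Gamma> (u x) \<partial>lborel) (\<lambda>u h. \<integral>x. W x * (m (u x) * h x) \<partial>lborel)"
  unfolding C1_functional_def
proof (intro conjI ballI allI impI)
  fix u assume u: "u \<in> E"
  define A where "A = C * (nrm u + 1)"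
  have uA: "wbound V A u" unfolding A_def by (rule emb[OF u]) simp
  then have A: "0 \<le> A" by (rule wbound_nonneg)
  obtain M where M: "0 \<le> M" "\<And>h B. wbound V B h \<Longrightarrow> \<bar>\<integral>x. W x * (m (u x) * h x) \<partial>lborel\<bar> \<le> M * B"
    using derivative_bounded[OF A] uA by blast
  have "\<bar>\<integral>x. W x * (m (u x) * h x) \<partial>lborel\<bar> \<le> (M * C) * nrm h" if h: "h \<in> E" for h
    by (rule le_mult_if_le_above[where b = "nrm h + 1"]) (use M(2)[OF emb[OF h]] in \<open>auto simp: mult.assoc\<close>)
  then show "\<exists>M. \<forall>h\<in>E. \<bar>\<integral>x. W x * (m (u x) * h x) \<partial>lborel\<bar> \<le> M * nrm h" by blast
  fix e :: real assume e: "0 < e"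
  then have eC: "0 < e / C" using C by simp
  obtain d where d: "0 < d" "\<And>h B. wbound V B h \<Longrightarrow> B \<le> d \<Longrightarrow>
     \<bar>(\<integral>x. W x * \<Gamma> (u x + h x) \<partial>lborel) - (\<integral>x. W x * \<Gamma> (u x) \<partial>lborel) - (\<integral>x. W x * (m (u x) * h x) \<partial>lborel)\<bar> \<le> e / C * B"
    using differentiable[OF uA eC] by blast
  show "\<exists>d>0. \<forall>h\<in>E. nrm h < d \<longrightarrow>
     \<bar>(\<integral>x. W x * \<Gamma> (u x + h x) \<partial>lborel) - (\<integral>x. W x * \<Gamma> (u x) \<partial>lborel) - (\<integral>x. W x * (m (u x) * h x) \<partial>lborel)\<bar> \<le> e * nrm h"
  proof (intro exI[of _ "d / C"] conjI ballI impI)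
    fix h assume h: "h \<in> E" "nrm h < d / C"
    show "\<bar>(\<integral>x. W x * \<Gamma> (u x + h x) \<partial>lborel) - (\<integral>x. W x * \<Gamma> (u x) \<partial>lborel) - (\<integral>x. W x * (m (u x) * h x) \<partial>lborel)\<bar> \<le> e * nrm h"
    proof (rule le_mult_if_le_above[OF _ h(2)])
      fix l assume l: "nrm h < l" "l < d / C"
      have "C * l \<le> d" using l(2) C by (simp add: less_divide_eq mult.commute)
      from d(2)[OF emb[OF h(1) l(1)] this]
      show "\<bar>(\<integral>x. W x * \<Gamma> (u x + h x) \<partial>lborel) - (\<integral>x. W x * \<Gamma> (u x) \<partial>lborel) - (\<integral>x. W x * (m (u x) * h x) \<partial>lborel)\<bar> \<le> e * l"
        using C by simp
    qed
  qed (use d C in auto)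
  obtain d where d: "0 < d" "\<And>v h B. wbound V d (\<lambda>x. v x - u x) \<Longrightarrow> wbound V B h \<Longrightarrow>
     \<bar>(\<integral>x. W x * (m (v x) * h x) \<partial>lborel) - (\<integral>x. W x * (m (u x) * h x) \<partial>lborel)\<bar> \<le> e / C * B"
    using derivative_continuous[OF uA eC] by blast
  show "\<exists>d>0. \<forall>v\<in>E. nrm (\<lambda>x. v x - u x) < d \<longrightarrow>
     (\<forall>h\<in>E. \<bar>(\<integral>x. W x * (m (v x) * h x) \<partial>lborel) - (\<integral>x. W x * (m (u x) * h x) \<partial>lborel)\<bar> \<le> e * nrm h)"
  proof (intro exI[of _ "d / C"] conjI ballI impI)
    fix v h assume v: "v \<in> E" "nrm (\<lambda>x. v x - u x) < d / C" and h: "h \<in> E"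
    have "wbound V (C * (d / C)) (\<lambda>x. v x - u x)" by (intro emb diff u v)
    then have vd: "wbound V d (\<lambda>x. v x - u x)" using C by simp
    show "\<bar>(\<integral>x. W x * (m (v x) * h x) \<partial>lborel) - (\<integral>x. W x * (m (u x) * h x) \<partial>lborel)\<bar> \<le> e * nrm h"
    proof (rule le_mult_if_le_above[where b = "nrm h + 1"])
      fix l assume "nrm h < l"
      from d(2)[OF vd emb[OF h this]]
      show "\<bar>(\<integral>x. W x * (m (v x) * h x) \<partial>lborel) - (\<integral>x. W x * (m (u x) * h x) \<partial>lborel)\<bar> \<le> e * l"
        using C by simp
    qed simp
  qed (use d C in auto)
qed

section \<open>The Dirichlet integral as a quadratic form\<close>

lemma dgrad_inner_bound:
  assumes "u \<in> D12r" "v \<in> D12r"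
  shows "integrable lborel (\<lambda>x. dgrad u x \<bullet> dgrad v x)"
    "\<bar>\<integral>x. dgrad u x \<bullet> dgrad v x \<partial>lborel\<bar> \<le> norm12 u * norm12 v"
  using L2_Cauchy_Schwarz[OF _ _ dgrad_L2[OF assms(1)] dgrad_L2[OF assms(2)]]
    dgrad_measurable[OF assms(1)] dgrad_measurable[OF assms(2)]
  by (auto simp: norm12_def)

lemma dgrad_inner_lincomb:
  fixes u v h :: "real^'n::finite \<Rightarrow> real"
  assumes u: "u \<in> D12r" and v: "v \<in> D12r" and h: "h \<in> D12r" and N: "CARD('n) \<ge> 3"
  shows "(\<integral>x. dgrad (\<lambda>x. a * u x + b * v x) x \<bullet> dgrad h x \<partial>lborel) =
    a * (\<integral>x. dgrad u x \<bullet> dgrad h x \<partial>lborel) + b * (\<integral>x. dgrad v x \<bullet> dgrad h x \<partial>lborel)"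
proof -
  note D = dgrad_lincomb[OF u v N, of a b]
  note [measurable] = dgrad_measurable[OF u] dgrad_measurable[OF v] dgrad_measurable[OF h] dgrad_measurable[OF D(1)]
  have "(\<integral>x. dgrad (\<lambda>x. a * u x + b * v x) x \<bullet> dgrad h x \<partial>lborel) =
     (\<integral>x. a * (dgrad u x \<bullet> dgrad h x) + b * (dgrad v x \<bullet> dgrad h x) \<partial>lborel)"
    by (rule integral_cong_AE, measurable) (use D(2) in \<open>eventually_elim, simp add: inner_add_left\<close>)
  also have "\<dots> = a * (\<integral>x. dgrad u x \<bullet> dgrad h x \<partial>lborel) + b * (\<integral>x. dgrad v x \<bullet> dgrad h x \<partial>lborel)"
    using dgrad_inner_bound(1)[OF u h] dgrad_inner_bound(1)[OF v h] by simp
  finally show ?thesis .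
qed

text \<open>For a quadratic form the remainder at h is exactly half the energy of h, and the
  derivative is linear in u; hence the radius e itself serves for both limits.\<close>

lemma C1_functional_Dirichlet:
  fixes E :: "(real^'n::finite \<Rightarrow> real) set"
  assumes N: "CARD('n) \<ge> 3" and E: "E \<subseteq> D12r" and nrm: "\<And>u. u \<in> E \<Longrightarrow> norm12 u \<le> nrm u"
    and diff: "\<And>u v. u \<in> E \<Longrightarrow> v \<in> E \<Longrightarrow> (\<lambda>x. v x - u x) \<in> E"
  shows "C1_functional E nrm (\<lambda>u. 1/2 * (\<integral>x. (norm (dgrad u x))\<^sup>2 \<partial>lborel)) (\<lambda>u h. \<integral>x. dgrad u x \<bullet> dgrad h x \<partial>lborel)"
  unfolding C1_functional_def
proof (intro conjI ballI allI impI)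
  fix u assume u: "u \<in> E"
  then have Du: "u \<in> D12r" using E by blast
  have "\<bar>\<integral>x. dgrad u x \<bullet> dgrad h x \<partial>lborel\<bar> \<le> norm12 u * nrm h" if h: "h \<in> E" for h
  proof -
    have "\<bar>\<integral>x. dgrad u x \<bullet> dgrad h x \<partial>lborel\<bar> \<le> norm12 u * norm12 h" using dgrad_inner_bound(2)[OF Du] h E by blast
    also have "\<dots> \<le> norm12 u * nrm h" using nrm[OF h] norm12_nonneg by (intro mult_left_mono) auto
    finally show ?thesis .
  qed
  then show "\<exists>M. \<forall>h\<in>E. \<bar>\<integral>x. dgrad u x \<bullet> dgrad h x \<partial>lborel\<bar> \<le> M * nrm h" by blast
  fix e :: real assume e: "0 < e"
  show "\<exists>d>0. \<forall>h\<in>E. nrm h < d \<longrightarrow> \<bar>1/2 * (\<integral>x. (norm (dgrad (\<lambda>x. u x + h x) x))\<^sup>2 \<partial>lborel)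
      - 1/2 * (\<integral>x. (norm (dgrad u x))\<^sup>2 \<partial>lborel) - (\<integral>x. dgrad u x \<bullet> dgrad h x \<partial>lborel)\<bar> \<le> e * nrm h"
  proof (intro exI[of _ e] conjI ballI impI e)
    fix h assume h: "h \<in> E" and he: "nrm h < e"
    then have Dh: "h \<in> D12r" using E by blast
    have s: "(\<lambda>x. u x + h x) \<in> D12r" using dgrad_lincomb(1)[OF Du Dh N, of 1 1] by simp
    have sq: "(\<integral>x. (norm (dgrad z x))\<^sup>2 \<partial>lborel) = (\<integral>x. dgrad z x \<bullet> dgrad z x \<partial>lborel)" for z :: "real^'n \<Rightarrow> real"
      by (simp add: power2_norm_eq_inner)
    have add: "(\<integral>x. dgrad (\<lambda>x. u x + h x) x \<bullet> dgrad z x \<partial>lborel) = (\<integral>x. dgrad u x \<bullet> dgrad z x \<partial>lborel) + (\<integral>x. dgrad h x \<bullet> dgrad z x \<partial>lborel)"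
      if "z \<in> D12r" for z using dgrad_inner_lincomb[OF Du Dh that N, of 1 1] by simp
    have sym: "(\<integral>x. dgrad y x \<bullet> dgrad z x \<partial>lborel) = (\<integral>x. dgrad z x \<bullet> dgrad y x \<partial>lborel)" for y z :: "real^'n \<Rightarrow> real"
      by (simp add: inner_commute)
    have "(\<integral>x. (norm (dgrad (\<lambda>x. u x + h x) x))\<^sup>2 \<partial>lborel)
       = (\<integral>x. (norm (dgrad u x))\<^sup>2 \<partial>lborel) + 2 * (\<integral>x. dgrad u x \<bullet> dgrad h x \<partial>lborel) + (\<integral>x. (norm (dgrad h x))\<^sup>2 \<partial>lborel)"
      unfolding sq add[OF s] sym[of u "\<lambda>x. u x + h x"] sym[of h "\<lambda>x. u x + h x"] add[OF Du] add[OF Dh]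
      using sym[of h u] by simp
    then have "1/2 * (\<integral>x. (norm (dgrad (\<lambda>x. u x + h x) x))\<^sup>2 \<partial>lborel)
      - 1/2 * (\<integral>x. (norm (dgrad u x))\<^sup>2 \<partial>lborel) - (\<integral>x. dgrad u x \<bullet> dgrad h x \<partial>lborel) = 1/2 * (norm12 h)\<^sup>2"
      unfolding norm12_sq by linarith
    moreover have "(norm12 h)\<^sup>2 \<le> e * nrm h"
      unfolding power2_eq_square using nrm[OF h] he norm12_nonneg[of h] e by (intro mult_mono) auto
    ultimately show "\<bar>1/2 * (\<integral>x. (norm (dgrad (\<lambda>x. u x + h x) x))\<^sup>2 \<partial>lborel)
      - 1/2 * (\<integral>x. (norm (dgrad u x))\<^sup>2 \<partial>lborel) - (\<integral>x. dgrad u x \<bullet> dgrad h x \<partial>lborel)\<bar> \<le> e * nrm h"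
      using zero_le_power2[of "norm12 h"] by linarith
  qed
  show "\<exists>d>0. \<forall>v\<in>E. nrm (\<lambda>x. v x - u x) < d \<longrightarrow>
     (\<forall>h\<in>E. \<bar>(\<integral>x. dgrad v x \<bullet> dgrad h x \<partial>lborel) - (\<integral>x. dgrad u x \<bullet> dgrad h x \<partial>lborel)\<bar> \<le> e * nrm h)"
  proof (intro exI[of _ e] conjI ballI impI e)
    fix v h assume v: "v \<in> E" "nrm (\<lambda>x. v x - u x) < e" and h: "h \<in> E"
    have Dv: "v \<in> D12r" and Dh: "h \<in> D12r" using v h E by auto
    have d: "(\<lambda>x. v x - u x) \<in> E" using diff u v by simp
    have "(\<integral>x. dgrad v x \<bullet> dgrad h x \<partial>lborel) - (\<integral>x. dgrad u x \<bullet> dgrad h x \<partial>lborel) = (\<integral>x. dgrad (\<lambda>x. v x - u x) x \<bullet> dgrad h x \<partial>lborel)"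
      using dgrad_inner_lincomb[OF Dv Du Dh N, of 1 "-1"] by simp
    then have "\<bar>(\<integral>x. dgrad v x \<bullet> dgrad h x \<partial>lborel) - (\<integral>x. dgrad u x \<bullet> dgrad h x \<partial>lborel)\<bar> \<le> norm12 (\<lambda>x. v x - u x) * norm12 h"
      using dgrad_inner_bound(2)[of "\<lambda>x. v x - u x" h] d Dh E by auto
    also have "\<dots> \<le> e * nrm h"
      using nrm[OF d] nrm[OF h] v(2) norm12_nonneg e by (intro mult_mono) auto
    finally show "\<bar>(\<integral>x. dgrad v x \<bullet> dgrad h x \<partial>lborel) - (\<integral>x. dgrad u x \<bullet> dgrad h x \<partial>lborel)\<bar> \<le> e * nrm h" .
  qed
qed

text \<open>The bound |f f'(t)| <= |t| and the Lipschitz constant 1 of f f' reduce both assumptions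
  of the locale to \<open>wbound_product\<close>, with M = A and \<delta> = \<epsilon>.\<close>

lemma integral_functional_fsol_sq:
  fixes V :: "real \<Rightarrow> real"
  assumes V_cont: "continuous_on {0<..} V" and V_nonneg: "\<forall>r>0. V r \<ge> 0"
  shows "integral_functional V (\<lambda>x::real^'n::finite. V (norm x)) fsol_prod (\<lambda>t. (fsol t)\<^sup>2 / 2)"
proof
  show m: "(\<lambda>x::real^'n. V (norm x)) \<in> borel_measurable borel" by (rule measurable_radial_weight[OF V_cont])
  show pos: "AE x in lborel. 0 \<le> V (norm (x::real^'n))"
    by (rule AE_radial_weight_nonneg[OF V_nonneg])
  show "continuous_on UNIV fsol_prod"
    unfolding fsol_prod_def by (intro continuous_on_mult continuous_on_fsol continuous_on_fsol' continuous_on_id)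
  show "((\<lambda>t. (fsol t)\<^sup>2 / 2) has_real_derivative fsol_prod t) (at t)" for t by (rule DERIV_half_fsol_sq)
  have le: "(\<integral>\<^sup>+x. ennreal (V (norm x) * (\<bar>F x\<bar> * \<bar>h x\<bar>)) \<partial>lborel) \<le> ennreal (A * B)"
    if "wbound V A z" "wbound V B h" "\<And>x. \<bar>F x\<bar> \<le> \<bar>z x\<bar>" for F z h :: "real^'n \<Rightarrow> real" and A B
  proof -
    have "(\<integral>\<^sup>+x. ennreal (V (norm x) * (\<bar>F x\<bar> * \<bar>h x\<bar>)) \<partial>lborel) \<le> (\<integral>\<^sup>+x. ennreal (V (norm x) * (\<bar>z x\<bar> * \<bar>h x\<bar>)) \<partial>lborel)"
      by (rule nn_integral_mono_AE, use pos in eventually_elim)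
         (use that(3) in \<open>auto intro!: ennreal_leI mult_left_mono mult_right_mono\<close>)
    also have "\<dots> \<le> ennreal (A * B)" by (rule wbound_product[OF that(1,2) m pos])
    finally show ?thesis .
  qed
  show "\<exists>M\<ge>0. \<forall>(u::real^'n \<Rightarrow> real) h B. wbound V A u \<longrightarrow> wbound V B h \<longrightarrow>
      (\<integral>\<^sup>+x. ennreal (V (norm x) * (\<bar>fsol_prod (u x)\<bar> * \<bar>h x\<bar>)) \<partial>lborel) \<le> ennreal (M * B)" if "0 \<le> A" for A
    using that le[of A] abs_fsol_prod_le by (intro exI[of _ A]) auto
  show "\<exists>\<delta>>0. \<forall>v h B. wbound V \<delta> (\<lambda>x. v x - u x) \<longrightarrow> wbound V B h \<longrightarrow>
      (\<integral>\<^sup>+x. ennreal (V (norm x) * (\<bar>fsol_prod (v x) - fsol_prod (u x)\<bar> * \<bar>h x\<bar>)) \<partial>lborel) \<le> ennreal (\<epsilon> * B)"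
    if "0 < \<epsilon>" for u :: "real^'n \<Rightarrow> real" and \<epsilon>
    using that fsol_prod_lipschitz le[of \<epsilon> "\<lambda>x. _ x - u x"] by (intro exI[of _ \<epsilon>]) auto
qed simp

section \<open>The energy functional\<close>

lemma Gprim_0: "Gprim g 0 = 0"
  by (simp add: Gprim_def zero_ereal_def[symmetric])

text \<open>What remains is arithmetic: the local power of the nonlinearity is (q1 - 2)/2, the
  weight has power \<alpha>0 - 2 \<beta>0 near 0, and both exponent conditions follow from the
  ranges of q1 and q2.\<close>

lemma integral_functional_Gprim:
  fixes V K g :: "real \<Rightarrow> real"
    and R1 R2 \<beta>0 \<beta>inf \<alpha>0 \<alpha>inf q1 q2 :: real
  assumes N3: "CARD('n::finite) \<ge> 3"
    and V_cont: "continuous_on {0<..} V" and V_nonneg: "\<forall>r>0. V r \<ge> 0"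
    and K_cont: "continuous_on {0<..} K" and K_pos: "\<forall>r>0. K r > 0"
    and V_bound: "\<exists>C>0. \<forall>r. 0 < r \<and> r < 1 \<longrightarrow> V r \<le> C / r\<^sup>2"
    and H0: "R1 > 0" "0 \<le> \<beta>0" "\<beta>0 \<le> 1"
      "\<exists>M. \<forall>r. 0 < r \<and> r < R1 \<longrightarrow> K r \<le> M * (r powr \<alpha>0 * vpow (V r) \<beta>0)"
    and Hinf: "R2 > 0" "0 \<le> \<beta>inf" "\<beta>inf \<le> 1"
      "\<exists>M. \<forall>r. r > R2 \<longrightarrow> K r \<le> M * (r powr \<alpha>inf * vpow (V r) \<beta>inf)"
    and q1: "4 < q1" "q1 < 2 * ((2 * \<alpha>0 + 2 * real CARD('n) - \<beta>0 * (real CARD('n) + 2)) / (real CARD('n) - 2))"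
    and q2: "q2 > max 4 (2 * (2 * (\<alpha>inf + real CARD('n) - 2 * \<beta>inf) / (real CARD('n) - 2)))"
    and g_cont: "continuous_on UNIV g"
    and g_growth: "\<exists>C>0. \<forall>t. \<bar>g t\<bar> \<le> C * min (\<bar>t\<bar> powr (q1 - 1)) (\<bar>t\<bar> powr (q2 - 1))"
  shows "integral_functional V (\<lambda>x::real^'n. K (norm x)) (\<lambda>t. g (fsol t) * fsol' t) (\<lambda>t. Gprim g (fsol t))"
proof -
  let ?N = "real CARD('n)"
  let ?m = "\<lambda>t. g (fsol t) * fsol' t"
  have N: "3 \<le> ?N" using N3 by simp
  obtain Cg where Cg: "0 < Cg" "\<And>t. \<bar>g t\<bar> \<le> Cg * min (\<bar>t\<bar> powr (q1 - 1)) (\<bar>t\<bar> powr (q2 - 1))"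
    using g_growth by blast
  obtain CV where CV: "0 < CV" "\<And>r. 0 < r \<Longrightarrow> r < 1 \<Longrightarrow> V r \<le> CV / r\<^sup>2" using V_bound by blast
  obtain M0 where M0: "\<And>r. 0 < r \<Longrightarrow> r < R1 \<Longrightarrow> K r \<le> M0 * (r powr \<alpha>0 * vpow (V r) \<beta>0)" using H0(4) by blast
  obtain M1 where M1: "\<And>r. R2 < r \<Longrightarrow> K r \<le> M1 * (r powr \<alpha>inf * vpow (V r) \<beta>inf)" using Hinf(4) by blast
  \<comment> \<open>The factor 2^((q1-2)/2) is at least 1, so this constant serves both growth
    bounds.\<close>
  define C where "C = Cg * 2 powr ((q1 - 2) / 2)"
  have "1 \<le> 2 powr ((q1 - 2) / 2)" using q1 by (intro ge_one_powr_ge_zero) auto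
  then have C: "0 \<le> C" "Cg \<le> C" using Cg(1) by (auto simp: C_def mult_le_cancel_left1)
  have q: "2 \<le> q1" "1 \<le> q2" "2 * \<beta>inf \<le> q2" "0 \<le> (q1 - 2) / 2" using q1 q2 Hinf by auto
  note growth = nonlinearity_growth[OF Cg(2) less_imp_le[OF Cg(1)] q(1,2)]
  have m_local: "\<bar>?m t\<bar> \<le> C * \<bar>t\<bar> powr ((q1 - 2) / 2)" for t using growth(1) by (simp add: C_def)
  have m_tail: "\<bar>?m t\<bar> \<le> C * \<bar>t\<bar> powr (q2 - 1)" for t
    using C(2) by (intro order_trans[OF growth(2)] mult_right_mono) auto
  have m_cont: "continuous_on UNIV ?m"
    by (intro continuous_on_mult continuous_on_fsol' continuous_on_compose2[OF g_cont] continuous_on_fsol continuous_on_id) auto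
  have K_nonneg: "\<forall>r>0. K r \<ge> 0" using K_pos less_imp_le by blast
  have K_local: "\<exists>L\<ge>0. \<forall>r. 0 < r \<longrightarrow> r \<le> \<rho> \<longrightarrow> K r \<le> L * r powr (\<alpha>0 - 2 * \<beta>0)" for \<rho>
    by (rule weight_local_bound[OF K_cont V_nonneg CV H0(1) M0 H0(2)])
  have K_tail: "K r \<le> \<bar>M1\<bar> * (r powr \<alpha>inf * vpow (V r) \<beta>inf)" if "R2 < r" for r
    by (rule order_trans[OF M1[OF that]], rule mult_right_mono) (auto simp: vpow_nonneg)
  \<comment> \<open>Here \<gamma> (s + 1) = q1 (N - 2) / 4. The upper bound on q1 gives q1 (N - 2) /
    4 < \<alpha>0 + N - \<beta>0 (N + 2) / 2, and N + 2 >= 4 allows \<beta>0 (N + 2) / 2 to be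
    replaced by 2 \<beta>0.\<close>
  have expo: "0 < \<alpha>0 - 2 * \<beta>0 - (?N - 2) / 2 * ((q1 - 2) / 2 + 1) + ?N"
  proof -
    have "q1 < 2 * (2 * \<alpha>0 + 2 * ?N - \<beta>0 * (?N + 2)) / (?N - 2)" using q1(2) by simp
    then have "q1 * (?N - 2) < 2 * (2 * \<alpha>0 + 2 * ?N - \<beta>0 * (?N + 2))"
      using N by (subst (asm) pos_less_divide_eq) auto
    moreover define P where "P = q1 * (?N - 2)"
    moreover define Q where "Q = \<beta>0 * (?N + 2)"
    moreover have "\<beta>0 * 4 \<le> \<beta>0 * (?N + 2)" using H0(2) N by (intro mult_left_mono) auto
    ultimately have "P < 2 * (2 * \<alpha>0 + 2 * ?N - Q)" "4 * \<beta>0 \<le> Q" by (simp_all add: mult.commute)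
    moreover have "(?N - 2) / 2 * ((q1 - 2) / 2 + 1) = P / 4" by (simp add: P_def field_simps)
    ultimately show ?thesis by simp
  qed
  \<comment> \<open>The surplus is (N - 2)/2 times q2 - \<open>?X\<close>, where \<open>?X\<close>
    is the critical exponent at infinity. If \<open>?X\<close> is negative, q2 > 4 makes the
    difference positive; otherwise q2 > 2 \<open>?X\<close> does.\<close>
  have del: "0 < (?N - 2) / 2 * (q2 - 2 * \<beta>inf) - \<alpha>inf - ?N * (1 - \<beta>inf)"
  proof -
    let ?X = "2 * (\<alpha>inf + ?N - 2 * \<beta>inf) / (?N - 2)"
    have "2 * ?X < q2" "4 < q2" using q2 by (simp_all only: max_less_iff_conj)
    then have "?X < q2" by argo
    then have "2 * (\<alpha>inf + ?N - 2 * \<beta>inf) < q2 * (?N - 2)"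
      using N by (subst (asm) pos_divide_less_eq) auto
    moreover define P where "P = q2 * (?N - 2)"
    moreover have "(?N - 2) / 2 * (q2 - 2 * \<beta>inf) - \<alpha>inf - ?N * (1 - \<beta>inf) = P / 2 - (\<alpha>inf + ?N - 2 * \<beta>inf)"
      by (simp add: P_def field_simps)
    ultimately show ?thesis by simp
  qed
  \<comment> \<open>Listed in the order of the context's assumptions; the two occurrences of
    \<open>refl\<close> instantiate the defining equations of \<gamma> and
    \<open>del\<close>.\<close>
  note hyps = N3 V_cont V_nonneg K_cont K_nonneg m_cont C(1) m_local q(4) m_tail q(2,3) K_local K_tail abs_ge_zero
    Hinf(2,3) refl expo refl del
  show ?thesis
  proof
    show "(\<lambda>x::real^'n. V (norm x)) \<in> borel_measurable borel" "(\<lambda>x::real^'n. K (norm x)) \<in> borel_measurable borel"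
      by (intro measurable_radial_weight V_cont K_cont)+
    show "AE x in lborel. 0 \<le> V (norm (x::real^'n))" "AE x in lborel. 0 \<le> K (norm (x::real^'n))"
      by (intro AE_radial_weight_nonneg V_nonneg K_nonneg)+
    show "((\<lambda>t. Gprim g (fsol t)) has_real_derivative ?m t) (at t)" for t
      by (rule DERIV_chain2[OF DERIV_Gprim[OF g_cont] DERIV_fsol])
    show "Gprim g (fsol 0) = 0" by (simp add: Gprim_0)
    show "\<exists>M\<ge>0. \<forall>(u::real^'n \<Rightarrow> real) h B. wbound V A u \<longrightarrow> wbound V B h \<longrightarrow>
        (\<integral>\<^sup>+x. ennreal (K (norm x) * (\<bar>?m (u x)\<bar> * \<bar>h x\<bar>)) \<partial>lborel) \<le> ennreal (M * B)" if "0 \<le> A" for A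
      by (rule nonlinearity_bounded[where m = ?m and \<gamma> = "(?N - 2) / 2" and a = "\<alpha>0 - 2 * \<beta>0" and K = K and V = V
          and M = "\<bar>M1\<bar>" and R = R2 and \<alpha> = \<alpha>inf and \<beta> = \<beta>inf, OF hyps that])
    show "\<exists>\<delta>>0. \<forall>v h B. wbound V \<delta> (\<lambda>x. v x - u x) \<longrightarrow> wbound V B h \<longrightarrow>
        (\<integral>\<^sup>+x. ennreal (K (norm x) * (\<bar>?m (v x) - ?m (u x)\<bar> * \<bar>h x\<bar>)) \<partial>lborel) \<le> ennreal (\<epsilon> * B)"
      if "wbound V A u" "0 < \<epsilon>" for A \<epsilon> and u :: "real^'n \<Rightarrow> real"
      by (rule nonlinearity_continuous[where m = ?m and \<gamma> = "(?N - 2) / 2" and a = "\<alpha>0 - 2 * \<beta>0" and K = K and V = V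
          and M = "\<bar>M1\<bar>" and R = R2 and \<alpha> = \<alpha>inf and \<beta> = \<beta>inf, OF hyps that])
  qed (rule m_cont)
qed

theorem theorem3p2:
  fixes V K g :: "real \<Rightarrow> real"
    and R1 R2 \<beta>0 \<beta>inf \<alpha>0 \<alpha>inf q1 q2 \<theta> :: real
  assumes N3: "CARD('n::finite) \<ge> 3"
    and V_cont: "continuous_on {0<..} V" and V_nonneg: "\<forall>r>0. V r \<ge> 0"
    and K_cont: "continuous_on {0<..} K" and K_pos: "\<forall>r>0. K r > 0"
    and V_bound: "\<exists>C>0. \<forall>r. 0 < r \<and> r < 1 \<longrightarrow> V r \<le> C / r\<^sup>2"
    and H0: "R1 > 0" "0 \<le> \<beta>0" "\<beta>0 \<le> 1"
      "\<exists>M. \<forall>r. 0 < r \<and> r < R1 \<longrightarrow> K r \<le> M * (r powr \<alpha>0 * vpow (V r) \<beta>0)"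
    and Hinf: "R2 > 0" "0 \<le> \<beta>inf" "\<beta>inf \<le> 1"
      "\<exists>M. \<forall>r. r > R2 \<longrightarrow> K r \<le> M * (r powr \<alpha>inf * vpow (V r) \<beta>inf)"
    and q1: "4 < q1" "q1 < 2 * ((2 * \<alpha>0 + 2 * real CARD('n) - \<beta>0 * (real CARD('n) + 2)) / (real CARD('n) - 2))"
    and q2: "q2 > max 4 (2 * (2 * (\<alpha>inf + real CARD('n) - 2 * \<beta>inf) / (real CARD('n) - 2)))"
    and g_cont: "continuous_on UNIV g"
    and AR: "\<theta> > 2" "\<forall>t. 0 \<le> 2 * \<theta> * Gprim g t \<and> 2 * \<theta> * Gprim g t \<le> g t * t"
    and G_pos: "\<exists>t0>0. Gprim g t0 > 0"
    and g_growth: "\<exists>C>0. \<forall>t. \<bar>g t\<bar> \<le> C * min (\<bar>t\<bar> powr (q1 - 1)) (\<bar>t\<bar> powr (q2 - 1))"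
  shows
    \<comment> \<open>(1) I is well defined on E\<close>
    "(\<forall>u \<in> (Espace V :: (real^'n \<Rightarrow> real) set).
        integrable lborel (\<lambda>x. (norm (dgrad u x))\<^sup>2) \<and>
        integrable lborel (\<lambda>x. V (norm x) * (fsol (u x))\<^sup>2) \<and>
        integrable lborel (\<lambda>x. K (norm x) * Gprim g (fsol (u x))))
     \<comment> \<open>(1) I is continuous on E\<close>
     \<and> (\<forall>u \<in> (Espace V :: (real^'n \<Rightarrow> real) set). \<forall>\<epsilon>>0. \<exists>\<delta>>0. \<forall>v \<in> Espace V.
          Enorm V (\<lambda>x. v x - u x) < \<delta> \<longrightarrow> \<bar>Ifun V K g v - Ifun V K g u\<bar> < \<epsilon>)
     \<comment> \<open>(2) the derivative formula is well defined, linear and bounded in h\<close>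
     \<and> (\<forall>u \<in> (Espace V :: (real^'n \<Rightarrow> real) set). \<forall>h \<in> Espace V.
          integrable lborel (\<lambda>x. dgrad u x \<bullet> dgrad h x) \<and>
          integrable lborel (\<lambda>x. V (norm x) * fsol (u x) * fsol' (u x) * h x) \<and>
          integrable lborel (\<lambda>x. K (norm x) * g (fsol (u x)) * fsol' (u x) * h x))
     \<and> (\<forall>u \<in> (Espace V :: (real^'n \<Rightarrow> real) set). \<forall>h1 \<in> Espace V. \<forall>h2 \<in> Espace V. \<forall>c::real.
          Ider V K g u (\<lambda>x. h1 x + h2 x) = Ider V K g u h1 + Ider V K g u h2 \<and>
          Ider V K g u (\<lambda>x. c * h1 x) = c * Ider V K g u h1)
     \<and> (\<forall>u \<in> (Espace V :: (real^'n \<Rightarrow> real) set). \<exists>M. \<forall>h \<in> Espace V.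
          \<bar>Ider V K g u h\<bar> \<le> M * Enorm V h)
     \<comment> \<open>(2) Frechet differentiability of I at every u in E with derivative Ider u\<close>
     \<and> (\<forall>u \<in> (Espace V :: (real^'n \<Rightarrow> real) set). \<forall>\<epsilon>>0. \<exists>\<delta>>0. \<forall>h \<in> Espace V.
          Enorm V h < \<delta> \<longrightarrow>
          \<bar>Ifun V K g (\<lambda>x. u x + h x) - Ifun V K g u - Ider V K g u h\<bar> \<le> \<epsilon> * Enorm V h)
     \<comment> \<open>(2) continuity of u \<mapsto> I'(u) in operator norm\<close>
     \<and> (\<forall>u \<in> (Espace V :: (real^'n \<Rightarrow> real) set). \<forall>\<epsilon>>0. \<exists>\<delta>>0. \<forall>v \<in> Espace V.
          Enorm V (\<lambda>x. v x - u x) < \<delta> \<longrightarrow>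
          (\<forall>h \<in> Espace V. \<bar>Ider V K g v h - Ider V K g u h\<bar> \<le> \<epsilon> * Enorm V h))"
proof -
  let ?E = "Espace V :: (real^'n \<Rightarrow> real) set"
  note lin = Espace_lincomb[OF N3 V_cont V_nonneg]
  have diff: "(\<lambda>x. v x - u x) \<in> ?E" if "u \<in> ?E" "v \<in> ?E" for u v
    using lin[OF that(2,1), of 1 "-1"] by simp
  have D: "?E \<subseteq> D12r" by (auto simp: Espace_def)
  have no: "0 \<le> normo V u" for u :: "real^'n \<Rightarrow> real" by (rule normo_nonneg[OF N3 V_cont V_nonneg])
  have nrm: "norm12 u \<le> Enorm V u" "0 \<le> Enorm V u" for u :: "real^'n \<Rightarrow> real"
    using no[of u] norm12_nonneg[of u] by (auto simp: Enorm_def)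
  obtain C where C: "0 < C" and emb: "\<And>u l. u \<in> ?E \<Longrightarrow> Enorm V u < l \<Longrightarrow> wbound V (C * l) u"
    using Espace_wbound[OF N3 V_cont V_nonneg V_bound] by blast
  \<comment> \<open>The summand 1 makes the inequality strict, as the embedding demands.\<close>
  have wb: "wbound V (C * (Enorm V u + 1)) u" if "u \<in> ?E" for u by (rule emb[OF that]) simp
  interpret JV: integral_functional V "\<lambda>x::real^'n. V (norm x)" fsol_prod "\<lambda>t. (fsol t)\<^sup>2 / 2"
    by (rule integral_functional_fsol_sq[OF V_cont V_nonneg])
  interpret JK: integral_functional V "\<lambda>x::real^'n. K (norm x)" "\<lambda>t. g (fsol t) * fsol' t" "\<lambda>t. Gprim g (fsol t)"
    by (rule integral_functional_Gprim[OF N3 V_cont V_nonneg K_cont K_pos V_bound H0 Hinf q1 q2 g_cont g_growth])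
  have iV: "integrable lborel (\<lambda>x. V (norm x) * fsol (u x) * fsol' (u x) * h x)" if "u \<in> ?E" "h \<in> ?E" for u h
    using JV.derivative_integrable[OF wb[OF that(1)] wb[OF that(2)]] by (simp add: fsol_prod_def mult.assoc)
  have iK: "integrable lborel (\<lambda>x. K (norm x) * g (fsol (u x)) * fsol' (u x) * h x)" if "u \<in> ?E" "h \<in> ?E" for u h
    using JK.derivative_integrable[OF wb[OF that(1)] wb[OF that(2)]] by (simp add: mult.assoc)
  have iD: "integrable lborel (\<lambda>x. dgrad u x \<bullet> dgrad h x)" if "u \<in> ?E" "h \<in> ?E" for u h
    using dgrad_inner_bound(1) D that by blast
  have 1: "\<forall>u \<in> ?E. integrable lborel (\<lambda>x. (norm (dgrad u x))\<^sup>2) \<and>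
        integrable lborel (\<lambda>x. V (norm x) * (fsol (u x))\<^sup>2) \<and>
        integrable lborel (\<lambda>x. K (norm x) * Gprim g (fsol (u x)))"
    using dgrad_L2 D Espace_integrable[OF N3 V_cont V_nonneg, of _ 1] JK.integrable_\<Gamma>[OF wb] by auto
  have 3: "\<forall>u \<in> ?E. \<forall>h \<in> ?E. integrable lborel (\<lambda>x. dgrad u x \<bullet> dgrad h x) \<and>
          integrable lborel (\<lambda>x. V (norm x) * fsol (u x) * fsol' (u x) * h x) \<and>
          integrable lborel (\<lambda>x. K (norm x) * g (fsol (u x)) * fsol' (u x) * h x)"
    using iV iK iD by blast
  \<comment> \<open>The gradient of a combination is known only almost everywhere, which is enough
    under the integral; the weighted terms split because each product is integrable.\<close>
  have lincomb: "Ider V K g u (\<lambda>x. a * h1 x + b * h2 x) = a * Ider V K g u h1 + b * Ider V K g u h2"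
    if u: "u \<in> ?E" and h: "h1 \<in> ?E" "h2 \<in> ?E" for u h1 h2 a b
  proof -
    have sym: "(\<integral>x. dgrad u x \<bullet> dgrad z x \<partial>lborel) = (\<integral>x. dgrad z x \<bullet> dgrad u x \<partial>lborel)" for z
      by (simp add: inner_commute)
    have "(\<integral>x. dgrad u x \<bullet> dgrad (\<lambda>x. a * h1 x + b * h2 x) x \<partial>lborel) =
        a * (\<integral>x. dgrad u x \<bullet> dgrad h1 x \<partial>lborel) + b * (\<integral>x. dgrad u x \<bullet> dgrad h2 x \<partial>lborel)"
      unfolding sym using D u h by (intro dgrad_inner_lincomb N3) auto
    moreover have "(\<integral>x. W x * (a * h1 x + b * h2 x) \<partial>lborel) = a * (\<integral>x. W x * h1 x \<partial>lborel) + b * (\<integral>x. W x * h2 x \<partial>lborel)"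
      if "integrable lborel (\<lambda>x. W x * h1 x)" "integrable lborel (\<lambda>x. W x * h2 x)" for W :: "real^'n \<Rightarrow> real"
    proof -
      have "(\<integral>x. W x * (a * h1 x + b * h2 x) \<partial>lborel) = (\<integral>x. a * (W x * h1 x) + b * (W x * h2 x) \<partial>lborel)"
        by (simp add: algebra_simps)
      then show ?thesis using that by simp
    qed
    note this[OF iV[OF u h(1)] iV[OF u h(2)]] this[OF iK[OF u h(1)] iK[OF u h(2)]]
    ultimately show ?thesis unfolding Ider_def by (simp add: algebra_simps)
  qed
  have 4: "\<forall>u \<in> ?E. \<forall>h1 \<in> ?E. \<forall>h2 \<in> ?E. \<forall>c::real.
          Ider V K g u (\<lambda>x. h1 x + h2 x) = Ider V K g u h1 + Ider V K g u h2 \<and>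
          Ider V K g u (\<lambda>x. c * h1 x) = c * Ider V K g u h1"
  proof (intro ballI allI conjI)
    fix u h1 h2 and c :: real assume "u \<in> ?E" "h1 \<in> ?E" "h2 \<in> ?E"
    \<comment> \<open>A scalar multiple is treated as the combination of \<open>h1\<close> with
      itself, the second coefficient being 0.\<close>
    then show "Ider V K g u (\<lambda>x. h1 x + h2 x) = Ider V K g u h1 + Ider V K g u h2"
      "Ider V K g u (\<lambda>x. c * h1 x) = c * Ider V K g u h1"
      using lincomb[of u h1 h2 1 1] lincomb[of u h1 h1 c 0] by auto
  qed
  have Q: "C1_functional ?E (Enorm V) (\<lambda>u. 1/2 * (\<integral>x. (norm (dgrad u x))\<^sup>2 \<partial>lborel)) (\<lambda>u h. \<integral>x. dgrad u x \<bullet> dgrad h x \<partial>lborel)"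
    by (rule C1_functional_Dirichlet[OF N3 D nrm(1) diff])
  have C1: "C1_functional ?E (Enorm V) (Ifun V K g) (Ider V K g)"
  proof -
    \<comment> \<open>To match the two locale instances, the factor 1/2 of the V-term is moved into
      the density f^2 / 2, and the K-term enters with coefficient -1.\<close>
    have I: "Ifun V K g = (\<lambda>u. (1/2 * (\<integral>x. (norm (dgrad u x))\<^sup>2 \<partial>lborel)
        + 1 * (\<integral>x. V (norm x) * ((fsol (u x))\<^sup>2 / 2) \<partial>lborel))
        + (-1) * (\<integral>x. K (norm x) * Gprim g (fsol (u x)) \<partial>lborel))"
      by (rule ext) (simp add: Ifun_def)
    have I': "Ider V K g = (\<lambda>u h. ((\<integral>x. dgrad u x \<bullet> dgrad h x \<partial>lborel)
        + 1 * (\<integral>x. V (norm x) * (fsol_prod (u x) * h x) \<partial>lborel))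
        + (-1) * (\<integral>x. K (norm x) * (g (fsol (u x)) * fsol' (u x) * h x) \<partial>lborel))"
      by (intro ext) (simp add: Ider_def fsol_prod_def mult.assoc)
    show ?thesis
      unfolding I I'
      by (intro C1_functional_lincomb Q JV.C1_functional_if_wbound[OF C emb diff] JK.C1_functional_if_wbound[OF C emb diff])
  qed
  have 2: "\<forall>u \<in> ?E. \<forall>\<epsilon>>0. \<exists>\<delta>>0. \<forall>v \<in> ?E.
          Enorm V (\<lambda>x. v x - u x) < \<delta> \<longrightarrow> \<bar>Ifun V K g v - Ifun V K g u\<bar> < \<epsilon>"
    using C1_functional_continuous[OF C1 nrm(2) diff] by blast
  show ?thesis
    by (intro conjI 1 2 3 4 ballI allI impI C1_functional_bounded[OF C1] C1_functional_derivative[OF C1]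
        C1_functional_derivative_continuous[OF C1])
qed

end
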